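(* Let $(X,T)$ be a weakly mixing minimal system, let $p_1,\dots,p_d\in\mathcal{G}$ be integer-valued generalized polynomials, and suppose that the tuple $(p_1,p_2,\dots,p_d)$ is non-degenerate. Then there is a dense $G_\delta$ subset $X_0$ of $X$ such that for all $x\in X_0$ the set $$\{(T^{p_1(n)}x,\dots,T^{p_d(n)}x): n\in\mathbb{Z}\}$$ is dense in $X^d$. Moreover, for any non-empty open subsets $U,V_1,\dots,V_d$ of $X$, any $\varepsilon>0$, any $s,t\in\mathbb{N}$ and any $g_1,\dots,g_t\in\widehat{SGP_s}$, put $$C=\bigcap_{k=1}^{t}\{n\in\mathbb{Z}:\{g_k(n)\}\in(-\varepsilon,\varepsilon)\},\qquad N=\{n\in\mathbb{Z}:U\cap T^{-p_1(n)}V_1\cap\cdots\cap T^{-p_d(n)}V_d\neq\emptyset\}.$$ Then $N\cap C$ is syndetic.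
   Context: Systems. A (topological dynamical) system $(X,T)$ is a compact metric space $X$ with a homeomorphism $T:X\to X$. It is minimal if every orbit $\{T^nx:n\in\mathbb{Z}\}$ is dense; transitive if for all non-empty open $U,V\subset X$ there is $n\in\mathbb{Z}$ with $U\cap T^{-n}V\ne\emptyset$; weakly mixing if $(X\times X,T\times T)$ is transitive. A set $S\subset\mathbb{Z}$ is syndetic if there is $L\in\mathbb{N}$ such that $\{n,n+1,\dots,n+L\}\cap S\neq\emptyset$ for every $n\in\mathbb{Z}$. $\mathbb{N}$ is the set of positive integers. Nearest integer. For $a\in\mathbb{R}$, $\|a\|=\inf\{|a-n|:n\in\mathbb{Z}\}$, $\lceil a\rceil=\min\{m\in\mathbb{Z}:|a-m|=\|a\|\}$ (nearest integer, NOT the ceiling), and $\{a\}=a-\lceil a\rceil\in(-\frac12,\frac12]$. Generalized polynomials. $GP_1$ is the smallest collection of functions $\mathbb{Z}\to\mathbb{R}$ containing all $n\mapsto an$ ($a\in\mathbb{R}$) and closed under $f\mapsto\lceil f\rceil$, multiplication by real constants and finite sums. Given $GP_i$ for $i<d$, $GP_d$ is the smallest collection of functions $\mathbb{Z}\to\mathbb{R}$ containing all $GP_i$ with $i<d$ and all functions $a_0n^{p_0}\lceil f_1(n)\rceil\cdots\lceil f_k(n)\rceil$ with $a_0\in\mathbb{R}$, $p_0\ge0$, $k\ge0$, $f_l\in GP_{p_l}$, $\sum_{l=0}^kp_l=d$, and closed under $f\mapsto\lceil f\rceil$, multiplication by real constants and finite sums. (All these functions vanish at $0$.) Put $\widetilde{GP_d}=\{\lceil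 p(n)\rceil:p\in GP_d\}$ and $\mathcal{G}=\bigcup_{d\ge1}\widetilde{GP_d}$, the integer-valued generalized polynomials. Simple generalized polynomials. Put $L(b)=b$ and $L(b_1,\dots,b_l)=b_1\lceil L(b_2,\dots,b_l)\rceil$ for $l\ge2$. $\widehat{SGP_d}$ is the collection of generalized polynomials of the form $\prod_{i=1}^{k}L(a_{i,1}n^{j_{i,1}},\dots,a_{i,l_i}n^{j_{i,l_i}})$ with $k\ge1$, $1\le l_i\le d$, $a_{i,t}\in\mathbb{R}$, integers $j_{i,t}\ge0$ with $j_{i,l_i}\ge1$ for every $i$, and $\sum_{i,t}j_{i,t}\le d$. Non-degeneracy. Integer-valued generalized polynomials are regarded as given by expressions. Given $p\in\mathcal{G}$, expand its expression by repeatedly replacing $\lceil f_1+\cdots+f_k\rceil$ by $\lceil f_1\rceil+\cdots+\lceil f_k\rceil$ (and $\lceil\lceil f\rceil\rceil$ by $\lceil f\rceil$) and multiplying out products of sums. The result is a formal sum of components, each built without sums from real constants, powers of $n$, products and brackets $\lceil\cdot\rceil$. The degree of a component is the total exponent of $n$ in it; its coefficient is the product of all real constants occurring in it. Opposite components inside the expansion of $p$ are not cancelled. $A(p)$ is the sum of the coefficients of the components of maximal degree. (Equivalently: if $D$ is the maximal degree of a component in the uncancelled expansion, $A(p)$ is the coefficient of $n^D$ in the ordinary polynomial obtained by deleting all brackets.) For a difference $p_i-p_j$, components occurring identically in $p_i$ and $p_j$ are cancelled before $A(p_i-p_j)$ is computed, and $A=0$ if nothing remains. The tuple $(p_1,\dots,p_d)$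 is non-degenerate if $A(p_i)\ne0$ and $A(p_i-p_j)\ne0$ for all $1\le i\ne j\le d$. Examples: $A(\lceil an^2\lceil bn\rceil+\lceil cn^3\rceil\rceil+dn^3+2n^2)=ab+c+d$; $A(n+n\lceil2\pi n-\lceil2\pi n\rceil\rceil)=0$; $(n^2+n,\,n^2+\lceil\sqrt3n\rceil)$ is non-degenerate; $(n\lceil2\pi n\rceil+n,\,\lceil2\pi n^2\rceil+2n)$ is not. *)

theory Defs
  imports "HOL-Analysis.Analysis"
begin

section \<open>Topological dynamical systems\<close>

text \<open>The space is the whole type \<open>'a\<close>.\<close>

definition tds :: "('a::metric_space \<Rightarrow> 'a) \<Rightarrow> bool" where
  "tds T \<longleftrightarrow> compact (UNIV :: 'a set) \<and> (\<exists>S. homeomorphism UNIV UNIV T S)"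

definition ziter :: "('a \<Rightarrow> 'a) \<Rightarrow> int \<Rightarrow> 'a \<Rightarrow> 'a" where
  "ziter T n = (if 0 \<le> n then T ^^ nat n else inv T ^^ nat (- n))"

definition tds_minimal :: "('a::metric_space \<Rightarrow> 'a) \<Rightarrow> bool" where
  "tds_minimal T \<longleftrightarrow> (\<forall>x. closure (range (\<lambda>n. ziter T n x)) = UNIV)"

definition tds_transitive :: "('a::metric_space \<Rightarrow> 'a) \<Rightarrow> bool" where
  "tds_transitive T \<longleftrightarrow>
     (\<forall>U V. open U \<and> U \<noteq> {} \<and> open V \<and> V \<noteq> {} \<longrightarrow> (\<exists>n. U \<inter> ziter T n -` V \<noteq> {}))"

definition weakly_mixing :: "('a::metric_space \<Rightarrow> 'a) \<Rightarrow> bool" where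
  "weakly_mixing T \<longleftrightarrow> tds_transitive (map_prod T T)"

definition syndetic :: "int set \<Rightarrow> bool" where
  "syndetic S \<longleftrightarrow> (\<exists>L\<ge>1::nat. \<forall>n. {n..n + int L} \<inter> S \<noteq> {})"


section \<open>Nearest integer\<close>

definition nint_dist :: "real \<Rightarrow> real" where
  "nint_dist a = (INF n::int. \<bar>a - of_int n\<bar>)"

definition nint :: "real \<Rightarrow> int" where
  "nint a = (LEAST m::int. \<bar>a - of_int m\<bar> = nint_dist a)"

definition nfrac :: "real \<Rightarrow> real" where
  "nfrac a = a - of_int (nint a)"


section \<open>Generalized polynomials\<close>

text \<open>
  Expressions for generalized polynomials. \<open>GMon a p [f\<^sub>1, \<dots>, f\<^sub>k]\<close> stands for
  \<open>a n\<^sup>p \<lceil>f\<^sub>1(n)\<rceil> \<cdots> \<lceil>f\<^sub>k(n)\<rceil>\<close> (the brackets around the \<open>f\<^sub>l\<close> are implicit),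
  and \<open>GBr f\<close> for \<open>\<lceil>f\<rceil>\<close>, where \<open>\<lceil>\<cdot>\<rceil>\<close> is the nearest integer.
\<close>

datatype gpexpr =
    GMon real nat "gpexpr list"
  | GBr gpexpr
  | GScale real gpexpr
  | GAdd gpexpr gpexpr

primrec gp_eval :: "gpexpr \<Rightarrow> int \<Rightarrow> real" where
  "gp_eval (GMon a p fs) =
     (\<lambda>n. a * of_int n ^ p * prod_list (map (\<lambda>f. of_int (nint (f n))) (map gp_eval fs)))"
| "gp_eval (GBr f) = (\<lambda>n. of_int (nint (gp_eval f n)))"
| "gp_eval (GScale a f) = (\<lambda>n. a * gp_eval f n)"
| "gp_eval (GAdd f g) = (\<lambda>n. gp_eval f n + gp_eval g n)"

text \<open>
  \<open>gp d e\<close>: the expression \<open>e\<close> exhibits its function as a member of \<open>GP\<^sub>d\<close>. As \<open>gp 0\<close> is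
  empty, the degrees \<open>ps\<close> below are positive. The generators \<open>n \<mapsto> a n\<close> of \<open>GP\<^sub>1\<close> are the
  instances \<open>GMon a 1 []\<close>; the instances \<open>GMon a 0 [f]\<close> with \<open>gp d f\<close> add no new functions,
  since \<open>a \<lceil>f\<rceil>\<close> is also \<open>GScale a (GBr f)\<close>.
\<close>

inductive gp :: "nat \<Rightarrow> gpexpr \<Rightarrow> bool" where
  lower: "gp i f \<Longrightarrow> i < d \<Longrightarrow> gp d f"
| mon: "d \<ge> 1 \<Longrightarrow> list_all2 gp ps fs \<Longrightarrow> p0 + sum_list ps = d \<Longrightarrow> gp d (GMon a p0 fs)"
| br: "gp d f \<Longrightarrow> gp d (GBr f)"
| scale: "gp d f \<Longrightarrow> gp d (GScale a f)"
| add: "gp d f \<Longrightarrow> gp d g \<Longrightarrow> gp d (GAdd f g)"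

text \<open>The integer-valued generalized polynomials, as expressions \<open>\<lceil>f\<rceil>\<close>.\<close>

definition IGP :: "gpexpr set" where
  "IGP = {GBr f | f d. d \<ge> 1 \<and> gp d f}"

text \<open>The value of a member of \<open>IGP\<close> as an integer; the floor only changes the type.\<close>

definition igp_eval :: "gpexpr \<Rightarrow> int \<Rightarrow> int" where
  "igp_eval p n = \<lfloor>gp_eval p n\<rfloor>"

lemma of_int_igp_eval: "p \<in> IGP \<Longrightarrow> real_of_int (igp_eval p n) = gp_eval p n"
  by (auto simp: IGP_def igp_eval_def)


section \<open>Simple generalized polynomials\<close>

text \<open>
  \<open>simple_L [(a\<^sub>1, j\<^sub>1), \<dots>, (a\<^sub>l, j\<^sub>l)]\<close> is \<open>L(a\<^sub>1 n\<^bsup>j\<^sub>1\<^esup>, \<dots>, a\<^sub>l n\<^bsup>j\<^sub>l\<^esup>)\<close>; the value at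
  the empty list is irrelevant.
\<close>

fun simple_L :: "(real \<times> nat) list \<Rightarrow> int \<Rightarrow> real" where
  "simple_L [] n = 0"
| "simple_L [(a, j)] n = a * of_int n ^ j"
| "simple_L ((a, j) # b # bs) n = a * of_int n ^ j * of_int (nint (simple_L (b # bs) n))"

definition SGP_hat :: "nat \<Rightarrow> (int \<Rightarrow> real) set" where
  "SGP_hat d =
     {(\<lambda>n. prod_list (map (\<lambda>bs. simple_L bs n) bss)) | bss.
        bss \<noteq> [] \<and>
        (\<forall>bs\<in>set bss. 1 \<le> length bs \<and> length bs \<le> d \<and> snd (last bs) \<ge> 1) \<and>
        sum_list (map snd (concat bss)) \<le> d}"


section \<open>Expansion into components and non-degeneracy\<close>

text \<open>
  \<open>Comp a j {#c\<^sub>1, \<dots>, c\<^sub>k#}\<close> is the sum-free product \<open>a n\<^sup>j \<lceil>c\<^sub>1\<rceil> \<cdots> \<lceil>c\<^sub>k\<rceil>\<close>. Two components are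
  identical when they agree up to the order of factors and up to collecting, in each product,
  the real constants into one constant and the powers of \<open>n\<close> into one power.
\<close>

datatype component = Comp real nat "component multiset"

primrec comp_degree :: "component \<Rightarrow> nat" where
  "comp_degree (Comp a j M) = j + sum_mset (image_mset comp_degree M)"

primrec comp_coeff :: "component \<Rightarrow> real" where
  "comp_coeff (Comp a j M) = a * prod_mset (image_mset comp_coeff M)"

fun comp_scale :: "real \<Rightarrow> component \<Rightarrow> component" where
  "comp_scale b (Comp a j M) = Comp (b * a) j M"

fun comp_mult :: "component \<Rightarrow> component \<Rightarrow> component" where
  "comp_mult (Comp a i M) (Comp b j N) = Comp (a * b) (i + j) (M + N)"

text \<open>The bracket of a component, with \<open>\<lceil>\<lceil>c\<rceil>\<rceil>\<close> replaced by \<open>\<lceil>c\<rceil>\<close>.\<close>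

definition comp_bracket :: "component \<Rightarrow> component" where
  "comp_bracket c = (if \<exists>c'. c = Comp 1 0 {#c'#} then c else Comp 1 0 {#c#})"

text \<open>Formal sums of components are multisets, so that nothing is cancelled or combined.\<close>

definition fsum_mult :: "component multiset \<Rightarrow> component multiset \<Rightarrow> component multiset" where
  "fsum_mult M N = (\<Sum>c\<in>#M. image_mset (comp_mult c) N)"

primrec expansion :: "gpexpr \<Rightarrow> component multiset" where
  "expansion (GMon a p fs) =
     foldr fsum_mult (map (image_mset comp_bracket) (map expansion fs)) {# Comp a p {#} #}"
| "expansion (GBr f) = image_mset comp_bracket (expansion f)"
| "expansion (GScale a f) = image_mset (comp_scale a) (expansion f)"
| "expansion (GAdd f g) = expansion f + expansion g"

definition max_degree :: "component multiset \<Rightarrow> nat" where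
  "max_degree M = Max (comp_degree ` set_mset M)"

definition top_coeff :: "component multiset \<Rightarrow> real" where
  "top_coeff M =
     (if M = {#} then 0
      else sum_mset (image_mset comp_coeff {# c \<in># M. comp_degree c = max_degree M #}))"

definition A_coeff :: "gpexpr \<Rightarrow> real" where
  "A_coeff p = top_coeff (expansion p)"

text \<open>
  The formal difference, in which the components common to both expansions, counted with
  multiplicity, are cancelled first.
\<close>

definition diff_expansion :: "gpexpr \<Rightarrow> gpexpr \<Rightarrow> component multiset" where
  "diff_expansion p q =
     (expansion p - expansion q) + image_mset (comp_scale (- 1)) (expansion q - expansion p)"

definition A_diff :: "gpexpr \<Rightarrow> gpexpr \<Rightarrow> real" where
  "A_diff p q = top_coeff (diff_expansion p q)"

definition non_degenerate :: "('d::finite \<Rightarrow> gpexpr) \<Rightarrow> bool" where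
  "non_degenerate p \<longleftrightarrow>
     (\<forall>i. A_coeff (p i) \<noteq> 0) \<and> (\<forall>i j. i \<noteq> j \<longrightarrow> A_diff (p i) (p j) \<noteq> 0)"

end

theory Submission
  imports Defs
begin

text \<open>
  Consider filters on the integers that are shift-stable, in the sense that a set of the filter
  is entered by \<open>n + k\<close> for most \<open>k\<close> and then most \<open>n\<close>, and whose sets are all syndetic. If
  \<open>f\<close> is additive modulo 1 up to small errors along such a filter \<open>F\<close>, then \<open>F\<close> can be refined so
  that \<open>f\<close> tends to 0 modulo 1. By Zorn's lemma some \<open>F\<close> admits no further refinement, and by
  induction on the degree all generalized polynomials tend to 0 modulo 1 along it. Hence
  brackets are additive along \<open>F\<close>, generalized polynomials coincide with their expansions, and
  the discrete derivatives \<open>f (n + k) - f n - f k\<close> lower the degree, as for ordinary polynomials.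

  Non-degeneracy now allows PET induction. Cover \<open>X\<close> by finitely many translates \<open>T\<^sup>jU\<close>, choose
  for every \<open>j\<close> a translation \<open>k\<^sub>j\<close>, the \<open>k\<^sub>j\<close> being far apart, and look for a point \<open>y\<close> with
  \<open>q(n + k\<^sub>j) - j\<close> taking \<open>y\<close> into \<open>V\<^sub>q\<close> for all \<open>q\<close> and \<open>j\<close>: if \<open>y \<in> T\<^sup>jU\<close>, then \<open>n + k\<^sub>j\<close> is
  a time as desired. Subtracting a function of minimal degree, this is a problem of smaller weight
  about the functions \<open>q(n + k\<^sub>j) - q(k\<^sub>j)\<close>. For \<open>q\<close> of degree 1 these do not depend on \<open>j\<close>; there
  the \<open>k\<^sub>j\<close> are chosen so that all the target sets meet, using that in a weakly mixing minimal
  system the hitting times of non-empty open sets are thickly syndetic.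
\<close>

section \<open>Near integers, syndetic sets and shift-stable filters\<close>

text \<open>The obstacle is that \<open>nint\<close> is not additive. To difference a bracket,
  \<open>f n\<close>, \<open>f k\<close> and \<open>f (n + k) - f n - f k\<close> must all be close
  to integers, and the last condition changes with k, so no fixed set of times serves the whole
  induction. A minimal filter meets all these conditions at once, in iterated form (for most k, then
  for most n), while each of its sets remains syndetic; this also yields the intersection with C.
  The weight counts classes of functions with equal degree and leading coefficient, not functions:
  the translates \<open>q (n + k) - q k\<close> stay in the class of q and cost nothing, while
  subtracting a function of least degree removes its class and adds only classes of smaller degree.
  The new family must again be pairwise non-degenerate. For two translates, by k and l, of functions
  in one class of degree at least 2, the leading terms cancel and the next coefficient grows with
  \<open>k - l\<close>; hence the translations have to be far apart. In degree 1 there is no next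
  coefficient: the translates coincide along the filter, only one target can be attached to them,
  and so the targets must be made to meet.\<close>

definition near_int :: "real \<Rightarrow> real \<Rightarrow> bool" where
  "near_int e x \<longleftrightarrow> (\<exists>m::int. \<bar>x - of_int m\<bar> < e)"

lemma near_int_zero [simp]: "e > 0 \<Longrightarrow> near_int e 0"
  unfolding near_int_def by (rule exI[of _ 0]) simp

lemma near_int_mono: "near_int d x \<Longrightarrow> d \<le> e \<Longrightarrow> near_int e x"
  unfolding near_int_def by (meson less_le_trans)

lemma near_int_add:
  assumes "near_int d x" "near_int e y" shows "near_int (d + e) (x + y)"
proof -
  obtain m k :: int where "\<bar>x - of_int m\<bar> < d" "\<bar>y - of_int k\<bar> < e"
    using assms unfolding near_int_def by blast
  then have "\<bar>(x + y) - of_int (m + k)\<bar> < d + e" by simp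
  then show ?thesis unfolding near_int_def by blast
qed

lemma nint_eqI:
  assumes "\<bar>x - of_int m\<bar> < 1/2" shows "nint x = m"
proof -
  have far: "\<bar>x - of_int m\<bar> < \<bar>x - of_int k\<bar>" if "k \<noteq> m" for k :: int
  proof -
    have "1 \<le> \<bar>real_of_int (k - m)\<bar>" using that by linarith
    then show ?thesis using assms by (simp add: abs_if split: if_splits)
  qed
  have "nint_dist x = \<bar>x - of_int m\<bar>"
    unfolding nint_dist_def
  proof (rule cInf_eq_minimum)
    show "\<bar>x - of_int m\<bar> \<in> range (\<lambda>n::int. \<bar>x - of_int n\<bar>)" by blast
  next
    fix y assume "y \<in> range (\<lambda>n::int. \<bar>x - of_int n\<bar>)"
    then show "\<bar>x - of_int m\<bar> \<le> y" using far by (force simp: less_imp_le)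
  qed
  then have "(\<bar>x - of_int k\<bar> = nint_dist x) = (k = m)" for k
    using far[of k] by fastforce
  then show ?thesis unfolding nint_def by (simp add: Least_equality)
qed

lemma nint_of_int [simp]: "nint (of_int m) = m"
  by (rule nint_eqI) simp

lemma nint_zero [simp]: "nint 0 = 0"
  by (rule nint_eqI) simp

lemma nint_bound: "\<bar>x - of_int (nint x)\<bar> \<le> 1/2"
proof (cases "\<bar>x - of_int (round x)\<bar> < 1/2")
  case True
  then show ?thesis using nint_eqI[OF True] by simp
next
  case False
  \<comment> \<open>Only half-integers are left. Both neighbours are then at distance 1/2, and
    \<open>LEAST\<close> picks the smaller one, the floor.\<close>
  have r: "x = of_int \<lfloor>x\<rfloor> + 1/2"
  proof -
    have "of_int (round x) \<le> x + 1/2" "x + 1/2 < of_int (round x) + 1"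
      unfolding round_def by linarith+
    then have x: "x = of_int (round x) - 1/2"
      using False by (auto simp: abs_if split: if_splits)
    then have "\<lfloor>x\<rfloor> = round x - 1" by (intro floor_unique) linarith+
    then show ?thesis using x by simp
  qed
  have far: "1/2 \<le> \<bar>x - of_int k\<bar>" for k :: int
  proof (cases "k \<le> \<lfloor>x\<rfloor>")
    case True
    then have "real_of_int k \<le> of_int \<lfloor>x\<rfloor>" by simp
    then show ?thesis using r by linarith
  next
    case False
    then have "\<lfloor>x\<rfloor> + 1 \<le> k" by simp
    then have "real_of_int (\<lfloor>x\<rfloor> + 1) \<le> of_int k" by (simp only: of_int_le_iff)
    then show ?thesis using r by linarith
  qed
  have at: "\<bar>x - of_int \<lfloor>x\<rfloor>\<bar> = 1/2" using r by linarith
  have d: "nint_dist x = 1/2"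
    unfolding nint_dist_def
  proof (rule cInf_eq_minimum)
    show "1/2 \<in> range (\<lambda>n::int. \<bar>x - of_int n\<bar>)" using at by (metis rangeI)
  next
    fix y assume "y \<in> range (\<lambda>n::int. \<bar>x - of_int n\<bar>)"
    then show "1/2 \<le> y" using far by auto
  qed
  have "nint x = \<lfloor>x\<rfloor>"
    unfolding nint_def d
  proof (rule Least_equality)
    show "\<bar>x - of_int \<lfloor>x\<rfloor>\<bar> = 1/2" by (rule at)
  next
    fix k :: int assume k: "\<bar>x - of_int k\<bar> = 1/2"
    show "\<lfloor>x\<rfloor> \<le> k"
      using k r by linarith
  qed
  then show ?thesis using at by simp
qed

lemma near_intD:
  assumes "near_int e x" "e \<le> 1/2" shows "\<bar>x - of_int (nint x)\<bar> < e"
proof -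
  obtain m :: int where "\<bar>x - of_int m\<bar> < e" using assms unfolding near_int_def by blast
  then show ?thesis using nint_eqI[of x m] assms by simp
qed

text \<open>Two errors below 1/4 add up to less than 1/2, the radius within which the nearest
  integer is determined.\<close>

lemma nint_add:
  assumes "near_int (1/4) x" "near_int (1/4) y"
  shows "nint (x + y) = nint x + nint y"
proof (rule nint_eqI)
  have "\<bar>x - of_int (nint x)\<bar> < 1/4" "\<bar>y - of_int (nint y)\<bar> < 1/4"
    using near_intD[OF assms(1)] near_intD[OF assms(2)] by auto
  then show "\<bar>x + y - of_int (nint x + nint y)\<bar> < 1/2" unfolding of_int_add by linarith
qed

text \<open>Dirichlet's argument: among the M + 1 points \<open>g 0\<close>, ..., \<open>g M\<close>
  on the circle, two lie in the same one of M arcs of length 1/M. The number of the arc is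
  \<open>h\<close>.\<close>

lemma finite_torus_pigeonhole:
  fixes g :: "nat \<Rightarrow> real"
  assumes "M > 0"
  shows "\<exists>a b. a < b \<and> b \<le> M \<and> near_int (1 / real M) (g b - g a)"
proof -
  define h where "h b = nat \<lfloor>real M * frac (g b)\<rfloor>" for b
  have "h b < M" for b
  proof -
    have "real M * frac (g b) < real M * 1"
      using assms by (intro mult_strict_left_mono) (auto simp: frac_lt_1)
    moreover have "0 \<le> real M * frac (g b)" by simp
    ultimately have "\<lfloor>real M * frac (g b)\<rfloor> < int M" "0 \<le> \<lfloor>real M * frac (g b)\<rfloor>"
      by (auto simp: floor_less_iff)
    then show ?thesis unfolding h_def by linarith
  qed
  then have "h ` {..M} \<subseteq> {..<M}" by auto
  then have "card (h ` {..M}) \<le> card {..<M}" by (intro card_mono) auto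
  then have "\<not> inj_on h {..M}" by (intro pigeonhole) simp
  then obtain a b where ab: "a \<le> M" "b \<le> M" "a \<noteq> b" "h a = h b"
    unfolding inj_on_def by auto
  have le: "near_int (1 / real M) (g b - g a)" if "h a = h b" for a b
  proof -
    have "0 \<le> \<lfloor>real M * frac (g a)\<rfloor>" "0 \<le> \<lfloor>real M * frac (g b)\<rfloor>" by auto
    then have "\<lfloor>real M * frac (g a)\<rfloor> = \<lfloor>real M * frac (g b)\<rfloor>"
      using that unfolding h_def by linarith
    then have "\<bar>real M * frac (g b) - real M * frac (g a)\<bar> < 1" by linarith
    then have "\<bar>real M * (frac (g b) - frac (g a))\<bar> < 1" by (simp add: algebra_simps)
    then have "real M * \<bar>frac (g b) - frac (g a)\<bar> < 1" by (simp add: abs_mult)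
    then have "\<bar>frac (g b) - frac (g a)\<bar> < 1 / real M" using assms by (simp add: field_simps)
    moreover have "frac (g b) - frac (g a) = (g b - g a) - of_int (\<lfloor>g b\<rfloor> - \<lfloor>g a\<rfloor>)"
      by (simp add: frac_def)
    ultimately show ?thesis unfolding near_int_def by metis
  qed
  show ?thesis
  proof (cases "a < b")
    case True
    then show ?thesis using ab le by blast
  next
    case False
    then have "b < a" using ab by simp
    moreover have "near_int (1 / real M) (g a - g b)" using le[of b a] ab by simp
    ultimately show ?thesis using ab by blast
  qed
qed

section \<open>Syndetic sets of integers\<close>

lemma syndetic_mono: "syndetic A \<Longrightarrow> A \<subseteq> B \<Longrightarrow> syndetic B"
  unfolding syndetic_def by blast

lemma syndetic_nonempty: "syndetic A \<Longrightarrow> A \<noteq> {}"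
  unfolding syndetic_def by blast

lemma syndeticI:
  assumes "\<And>n. \<exists>m\<in>A. n \<le> m \<and> m \<le> n + L"
  shows "syndetic A"
  unfolding syndetic_def
proof (intro exI[of _ "Suc (nat L)"] conjI allI)
  fix n
  obtain m where "m \<in> A" "n \<le> m" "m \<le> n + L" using assms by blast
  then have "m \<in> {n..n + int (Suc (nat L))} \<inter> A" by auto
  then show "{n..n + int (Suc (nat L))} \<inter> A \<noteq> {}" by blast
qed simp

lemma syndeticE:
  assumes "syndetic A"
  obtains L :: int where "L \<ge> 0" "\<And>n. \<exists>m\<in>A. n \<le> m \<and> m \<le> n + L"
proof -
  obtain L :: nat where L: "\<And>n. {n..n + int L} \<inter> A \<noteq> {}"
    using assms unfolding syndetic_def by blast
  show ?thesis
  proof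
    show "int L \<ge> 0" by simp
    show "\<exists>m\<in>A. n \<le> m \<and> m \<le> n + int L" for n using L[of n] by fastforce
  qed
qed

text \<open>Finitely many shifts are bounded, so the gaps grow by at most twice the largest shift.
  In this form syndeticity is carried from the times of a simpler problem to those of the original
  one.\<close>

lemma syndetic_finite_shifts:
  assumes "finite J" "syndetic A" and "\<And>n. n \<in> A \<Longrightarrow> \<exists>j\<in>J. n + k j \<in> B"
  shows "syndetic B"
proof -
  obtain L where L: "\<And>n. \<exists>m\<in>A. n \<le> m \<and> m \<le> n + L" using syndeticE[OF assms(2)] by blast
  define K where "K = Max (insert 0 ((\<lambda>j. \<bar>k j\<bar>) ` J))"
  have K: "\<bar>k j\<bar> \<le> K" if "j \<in> J" for j
    unfolding K_def using assms(1) that by (intro Max_ge) auto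
  show ?thesis
  proof (rule syndeticI[where L = "L + 2 * K"])
    fix n
    obtain m where m: "m \<in> A" "n + K \<le> m" "m \<le> n + K + L" using L[of "n + K"] by blast
    then obtain j where "j \<in> J" "m + k j \<in> B" using assms(3) by blast
    then show "\<exists>m\<in>B. n \<le> m \<and> m \<le> n + (L + 2 * K)"
      using m K[of j] by (intro bexI[of _ "m + k j"]) auto
  qed
qed

section \<open>Shift-stable filters and their refinement\<close>

definition good_filter :: "int filter \<Rightarrow> bool" where
  "good_filter F \<longleftrightarrow> F \<le> cofinite \<and>
     (\<forall>P. eventually P F \<longrightarrow> (\<forall>\<^sub>F k in F. \<forall>\<^sub>F n in F. P (n + k))) \<and>
     (\<forall>P. eventually P F \<longrightarrow> syndetic {n. P n})"

text \<open>The filter analogue of an idempotent ultrafilter: for an ultrafilter this clause says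
  that it equals its sum with itself.\<close>

lemma good_filter_shift:
  "good_filter F \<Longrightarrow> eventually P F \<Longrightarrow> \<forall>\<^sub>F k in F. \<forall>\<^sub>F n in F. P (n + k)"
  unfolding good_filter_def by blast

lemma good_filter_syndetic:
  "good_filter F \<Longrightarrow> eventually P F \<Longrightarrow> syndetic {n. P n}"
  unfolding good_filter_def by blast

lemma good_filter_not_bot: "good_filter F \<Longrightarrow> F \<noteq> bot"
  using good_filter_syndetic[of F "\<lambda>_. False"] syndetic_nonempty by fastforce

lemma good_filter_large:
  assumes "good_filter F" shows "\<forall>\<^sub>F n in F. \<bar>n\<bar> \<ge> M"
proof -
  have "finite {n::int. \<not> \<bar>n\<bar> \<ge> M}"
    by (rule finite_subset[of _ "{-M..M}"]) auto
  then have "\<forall>\<^sub>F n in cofinite. \<bar>n\<bar> \<ge> M" by (simp add: eventually_cofinite)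
  then show ?thesis using assms unfolding good_filter_def le_filter_def by blast
qed

lemma good_filter_cofinite: "good_filter cofinite"
  unfolding good_filter_def
proof (intro conjI allI impI)
  fix P :: "int \<Rightarrow> bool" assume P: "eventually P cofinite"
  have "finite {n. \<not> P (n + k)}" for k
  proof -
    have "{n. \<not> P (n + k)} = (\<lambda>n. n - k) ` {n. \<not> P n}"
      by (force simp: image_iff)
    then show ?thesis using P by (simp add: eventually_cofinite)
  qed
  then show "\<forall>\<^sub>F k in cofinite. \<forall>\<^sub>F n in cofinite. P (n + k)" by (simp add: eventually_cofinite)
  have fin: "finite {n. \<not> P n}" using P by (simp add: eventually_cofinite)
  show "syndetic {n. P n}"
  \<comment> \<open>An interval of this length contains one integer more than there are
    exceptions.\<close>
  proof (rule syndeticI[where L = "int (card {n. \<not> P n})"])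
    fix n
    show "\<exists>m\<in>{n. P n}. n \<le> m \<and> m \<le> n + int (card {n. \<not> P n})"
    proof (rule ccontr)
      assume "\<not> ?thesis"
      then have "{n..n + int (card {n. \<not> P n})} \<subseteq> {n. \<not> P n}" by auto
      from card_mono[OF fin this] show False by simp
    qed
  qed
qed simp

text \<open>
  If the refined set \<open>{n. Q n \<and> near_int e (f n)}\<close> missed arbitrarily long intervals, points
  \<open>s\<^sub>0, \<dots>, s\<^sub>M\<close> could be built whose differences avoid it although they satisfy \<open>Q\<close> and
  \<open>f\<close> is almost additive on them; the pigeonhole principle on the circle rules this out.
\<close>

lemma near_int_syndetic:
  assumes F: "good_filter F" and "e > 0" and Q: "eventually Q F"
    and f: "\<And>e. e > 0 \<Longrightarrow> \<forall>\<^sub>F k in F. \<forall>\<^sub>F n in F. near_int e (f (n + k) - f n - f k)"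
  shows "syndetic {n. Q n \<and> near_int e (f n)}"
proof (rule ccontr)
  define C where "C = {n. Q n \<and> near_int e (f n)}"
  assume "\<not> syndetic {n. Q n \<and> near_int e (f n)}"
  then have "\<not> syndetic C" by (simp add: C_def)
  then have thick: "\<exists>n. \<forall>m\<in>C. \<not> (n \<le> m \<and> m \<le> n + L)" for L
    using syndeticI[of C L] by blast
  obtain M :: nat where M: "2 / e < real M" using reals_Archimedean2 by blast
  have M0: "M > 0" using M \<open>e > 0\<close> by (cases M) (auto simp: divide_less_0_iff)
  \<comment> \<open>At most M errors \<eta> will accumulate, e/2 in total; the pigeonhole principle
    contributes the other part, 1/M < e/2.\<close>
  define \<eta> where "\<eta> = e / (2 * real M)"
  have \<eta>0: "\<eta> > 0" unfolding \<eta>_def using M0 \<open>e > 0\<close> by simp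
  define A where "A k \<longleftrightarrow> Q k \<and> (\<forall>\<^sub>F n in F. near_int \<eta> (f (n + k) - f n - f k))" for k
  have evA: "eventually A F"
    unfolding A_def using Q f[OF \<eta>0] by eventually_elim blast
  \<comment> \<open>As in the proof of Hindman's theorem, \<open>A\<close> is shrunk to those k for
    which \<open>n + k\<close> is in \<open>A\<close> for most n. This smaller set passes from k to
    \<open>n + k\<close> for most n, see \<open>Bshift\<close>.\<close>
  define B where "B k \<longleftrightarrow> A k \<and> (\<forall>\<^sub>F n in F. A (n + k))" for k
  have evB: "eventually B F"
    unfolding B_def using evA good_filter_shift[OF F evA] by eventually_elim blast
  have Bshift: "\<forall>\<^sub>F n in F. B (n + k)" if "B k" for k
  proof -
    have 1: "\<forall>\<^sub>F n in F. A (n + k)" using that unfolding B_def by blast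
    have 2: "\<forall>\<^sub>F m in F. \<forall>\<^sub>F n in F. A (n + m + k)" using good_filter_shift[OF F 1] .
    show ?thesis unfolding B_def using 1 2 by eventually_elim (simp add: add.assoc)
  qed
  have ex: "\<exists>n. B n \<and> n \<notin> C \<and> (\<forall>s\<in>S. B (n + s) \<and> n + s \<notin> C \<and> near_int \<eta> (f (n + s) - f n - f s))"
    if S: "finite S" "\<forall>s\<in>S. B s" for S
  proof -
    have "\<forall>\<^sub>F n in F. \<forall>s\<in>S. B (n + s) \<and> near_int \<eta> (f (n + s) - f n - f s)"
    proof (intro eventually_ball_finite S ballI eventually_conj)
      fix s assume "s \<in> S"
      then have "B s" using S by blast
      then show "\<forall>\<^sub>F n in F. B (n + s)" "\<forall>\<^sub>F n in F. near_int \<eta> (f (n + s) - f n - f s)"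
        using Bshift unfolding B_def A_def by auto
    qed
    with evB have "\<forall>\<^sub>F n in F. B n \<and> (\<forall>s\<in>S. B (n + s) \<and> near_int \<eta> (f (n + s) - f n - f s))"
      by eventually_elim blast
    from good_filter_syndetic[OF F this] obtain L where L:
      "\<And>n. \<exists>m. (B m \<and> (\<forall>s\<in>S. B (m + s) \<and> near_int \<eta> (f (m + s) - f m - f s))) \<and> n \<le> m \<and> m \<le> n + L"
      by (rule syndeticE) auto
    \<comment> \<open>\<open>C\<close> misses an interval of length \<open>L + 2 * K\<close>: its
      middle part of length L contains a suitable m, and the margins K keep every
      \<open>m + s\<close> inside.\<close>
    define K where "K = Max (insert 0 (abs ` S))"
    have K: "\<bar>s\<bar> \<le> K" if "s \<in> S" for s
      unfolding K_def using S that by (intro Max_ge) auto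
    have K0: "0 \<le> K" unfolding K_def using S by (intro Max_ge) auto
    obtain n0 where n0: "\<And>m. m \<in> C \<Longrightarrow> \<not> (n0 \<le> m \<and> m \<le> n0 + (L + 2 * K))"
      using thick by blast
    obtain m where m: "B m" "\<forall>s\<in>S. B (m + s) \<and> near_int \<eta> (f (m + s) - f m - f s)"
      "n0 + K \<le> m" "m \<le> n0 + K + L" using L[of "n0 + K"] by blast
    have "m \<notin> C" using n0[of m] m K0 by auto
    moreover have "m + s \<notin> C" if "s \<in> S" for s using n0[of "m + s"] m K[OF that] by auto
    ultimately show ?thesis using m by blast
  qed
  \<comment> \<open>A new point \<open>s N + n\<close> is appended each time. Its differences to the
    old points are n and \<open>n + (s N - s a)\<close>, where f is almost additive by the choice of
    n. Only l = b - 1 is recorded, which suffices for telescoping.\<close>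
  have "\<exists>s::nat \<Rightarrow> int. \<forall>b\<le>N. \<forall>a<b. B (s b - s a) \<and> s b - s a \<notin> C \<and>
          (\<forall>l. a < l \<and> l < b \<longrightarrow> l + 1 = b \<longrightarrow> near_int \<eta> (f (s b - s a) - f (s b - s l) - f (s l - s a)))" for N
  proof (induction N)
    case 0
    then show ?case by simp
  next
    case (Suc N)
    then obtain s :: "nat \<Rightarrow> int" where s: "\<And>a b. b \<le> N \<Longrightarrow> a < b \<Longrightarrow> B (s b - s a) \<and> s b - s a \<notin> C \<and>
      (\<forall>l. a < l \<and> l < b \<longrightarrow> l + 1 = b \<longrightarrow> near_int \<eta> (f (s b - s a) - f (s b - s l) - f (s l - s a)))"
      by blast
    obtain n where n: "B n" "n \<notin> C"
      "\<And>r. r \<in> (\<lambda>a. s N - s a) ` {..<N} \<Longrightarrow> B (n + r) \<and> n + r \<notin> C \<and> near_int \<eta> (f (n + r) - f n - f r)"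
    proof -
      have "\<forall>r\<in>(\<lambda>a. s N - s a) ` {..<N}. B r" using s by blast
      from ex[OF _ this] obtain n where "B n" "n \<notin> C"
        "\<forall>r\<in>(\<lambda>a. s N - s a) ` {..<N}. B (n + r) \<and> n + r \<notin> C \<and> near_int \<eta> (f (n + r) - f n - f r)"
        by blast
      then show thesis by (intro that) blast+
    qed
    define s' where "s' = s(Suc N := s N + n)"
    show ?case
    proof (intro exI[of _ s'] allI impI)
      fix a b assume ab: "b \<le> Suc N" "a < b"
      show "B (s' b - s' a) \<and> s' b - s' a \<notin> C \<and>
        (\<forall>l. a < l \<and> l < b \<longrightarrow> l + 1 = b \<longrightarrow> near_int \<eta> (f (s' b - s' a) - f (s' b - s' l) - f (s' l - s' a)))"
      proof (cases "b = Suc N")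
        case False
        then show ?thesis using s[of b a] ab by (auto simp: s'_def)
      next
        case b: True
        show ?thesis
        proof (cases "a = N")
          case True
          then show ?thesis using b n by (auto simp: s'_def)
        next
          case False
          then have a: "a < N" using ab b by simp
          have e: "s' b - s' a = n + (s N - s a)" "s' b - s' N = n" "s' N - s' a = s N - s a"
            using a b by (auto simp: s'_def)
          have r: "s N - s a \<in> (\<lambda>a. s N - s a) ` {..<N}" using a by blast
          show ?thesis
          proof (intro conjI allI impI)
            show "B (s' b - s' a)" "s' b - s' a \<notin> C" unfolding e using n(3)[OF r] by blast+
          next
            fix l assume "l + 1 = b"
            then have l: "l = N" using b by simp
            show "near_int \<eta> (f (s' b - s' a) - f (s' b - s' l) - f (s' l - s' a))"
              unfolding l e using n(3)[OF r] by blast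
          qed
        qed
      qed
    qed
  qed
  from this[of M] obtain s :: "nat \<Rightarrow> int" where s1: "\<And>a b. b \<le> M \<Longrightarrow> a < b \<Longrightarrow> B (s b - s a) \<and> s b - s a \<notin> C"
    and s2: "\<And>a l. Suc l \<le> M \<Longrightarrow> a < l \<Longrightarrow>
        near_int \<eta> (f (s (Suc l) - s a) - f (s (Suc l) - s l) - f (s l - s a))"
    by fastforce
  \<comment> \<open>By telescoping, f of a difference of two points is almost a difference of values
    of \<open>g\<close>, and to these the pigeonhole principle applies.\<close>
  define g where "g b = (\<Sum>l<b. f (s (Suc l) - s l))" for b
  have approx: "near_int (real (b - a) * \<eta>) (f (s b - s a) - (g b - g a))"
    if "Suc a \<le> b" "b \<le> M" for a b
    using that
  proof (induction b rule: dec_induct)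
    case base
    then show ?case using \<eta>0 by (simp add: g_def)
  next
    case (step l)
    have 1: "near_int (real (l - a) * \<eta>) (f (s l - s a) - (g l - g a))" using step by simp
    have 2: "near_int \<eta> (f (s (Suc l) - s a) - f (s (Suc l) - s l) - f (s l - s a))"
      using step by (intro s2) auto
    have "real (Suc l - a) * \<eta> = \<eta> + real (l - a) * \<eta>"
      using step by (simp add: of_nat_diff algebra_simps)
    moreover have "f (s (Suc l) - s a) - (g (Suc l) - g a) =
      (f (s (Suc l) - s a) - f (s (Suc l) - s l) - f (s l - s a)) + (f (s l - s a) - (g l - g a))"
      by (simp add: g_def)
    ultimately show ?case using near_int_add[OF 2 1] by (simp only:)
  qed
  obtain a b where ab: "a < b" "b \<le> M" "near_int (1 / real M) (g b - g a)"
    using finite_torus_pigeonhole[OF M0] by blast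
  have 1: "near_int (real (b - a) * \<eta>) (f (s b - s a) - (g b - g a))" using approx[of a b] ab by simp
  have "near_int (real (b - a) * \<eta> + 1 / real M) (f (s b - s a))"
    using near_int_add[OF 1 ab(3)] by simp
  moreover have "real (b - a) * \<eta> + 1 / real M \<le> e"
  proof -
    have "real (b - a) * \<eta> \<le> real M * \<eta>" using ab \<eta>0 by (intro mult_right_mono) auto
    also have "\<dots> = e / 2" unfolding \<eta>_def using M0 by simp
    finally have "real (b - a) * \<eta> \<le> e / 2" .
    moreover have "1 / real M \<le> e / 2" using M M0 \<open>e > 0\<close> by (simp add: field_simps)
    ultimately show ?thesis by simp
  qed
  ultimately have "near_int e (f (s b - s a))" by (rule near_int_mono)
  moreover have "Q (s b - s a)" using s1[of b a] ab unfolding B_def A_def by blast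
  ultimately have "s b - s a \<in> C" by (simp add: C_def)
  then show False using s1[of b a] ab by blast
qed

text \<open>The sets \<open>{n. near_int e (f n)}\<close> are added to F. Shift-stability survives
  because \<open>f (n + k)\<close> is the sum of \<open>f n\<close>, \<open>f k\<close> and the
  additivity defect, each within e/3 of an integer; syndeticity is
  \<open>near_int_syndetic\<close>.\<close>

lemma good_filter_refine:
  assumes F: "good_filter F"
    and f: "\<And>e. e > 0 \<Longrightarrow> \<forall>\<^sub>F k in F. \<forall>\<^sub>F n in F. near_int e (f (n + k) - f n - f k)"
  obtains G where "good_filter G" "G \<le> F" "\<And>e. e > 0 \<Longrightarrow> \<forall>\<^sub>F n in G. near_int e (f n)"
proof -
  define H where "H = (INF e\<in>{0<..}. principal {n. near_int e (f n)})"
  have evH: "eventually P H \<longleftrightarrow> (\<exists>e>0. \<forall>n. near_int e (f n) \<longrightarrow> P n)" for P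
  proof -
    have "eventually P H \<longleftrightarrow> (\<exists>e\<in>{0<..}. eventually P (principal {n. near_int e (f n)}))"
      unfolding H_def
    proof (rule eventually_INF_base)
      fix a b :: real assume "a \<in> {0<..}" "b \<in> {0<..}"
      then show "\<exists>x\<in>{0<..}. principal {n. near_int x (f n)}
          \<le> inf (principal {n. near_int a (f n)}) (principal {n. near_int b (f n)})"
        by (intro bexI[of _ "min a b"]) (auto elim: near_int_mono)
    qed auto
    then show ?thesis by (auto simp: eventually_principal)
  qed
  define G where "G = inf F H"
  have evG: "eventually P G \<longleftrightarrow> (\<exists>Q e. eventually Q F \<and> e > 0 \<and> (\<forall>n. Q n \<and> near_int e (f n) \<longrightarrow> P n))" for P
  proof
    assume "eventually P G"
    then obtain Q R where "eventually Q F" "eventually R H" "\<And>n. Q n \<and> R n \<Longrightarrow> P n"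
      unfolding G_def eventually_inf by blast
    then show "\<exists>Q e. eventually Q F \<and> e > 0 \<and> (\<forall>n. Q n \<and> near_int e (f n) \<longrightarrow> P n)"
      unfolding evH by metis
  next
    assume "\<exists>Q e. eventually Q F \<and> e > 0 \<and> (\<forall>n. Q n \<and> near_int e (f n) \<longrightarrow> P n)"
    then obtain Q e where Q: "eventually Q F" "e > 0" "\<And>n. Q n \<and> near_int e (f n) \<longrightarrow> P n" by blast
    then have "eventually (\<lambda>n. near_int e (f n)) H" unfolding evH by blast
    then show "eventually P G" unfolding G_def eventually_inf using Q by blast
  qed
  have GF: "G \<le> F" by (simp add: G_def)
  have near: "\<forall>\<^sub>F n in G. near_int e (f n)" if "e > 0" for e
    unfolding evG using that by (intro exI[of _ "\<lambda>_. True"] exI[of _ e]) auto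
  have "good_filter G"
    unfolding good_filter_def
  proof (intro conjI allI impI)
    show "G \<le> cofinite" using GF F unfolding good_filter_def by (meson order_trans)
  next
    fix P assume "eventually P G"
    then obtain Q e where Q: "eventually Q F" "e > 0" "\<And>n. Q n \<Longrightarrow> near_int e (f n) \<Longrightarrow> P n"
      unfolding evG by blast
    have e3: "e / 3 > 0" using Q by simp
    show "\<forall>\<^sub>F k in G. \<forall>\<^sub>F n in G. P (n + k)"
      using filter_leD[OF GF good_filter_shift[OF F Q(1)]] filter_leD[OF GF f[OF e3]] near[OF e3]
    proof eventually_elim
      case (elim k)
      show ?case
        using filter_leD[OF GF elim(1)] filter_leD[OF GF elim(2)] near[OF e3]
      proof eventually_elim
        case (elim n)
        have "near_int (e/3 + e/3 + e/3) ((f (n + k) - f n - f k) + f n + f k)"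
          using elim \<open>near_int (e/3) (f k)\<close> by (intro near_int_add)
        then show ?case using Q elim by simp
      qed
    qed
    have "syndetic {n. Q n \<and> near_int e (f n)}"
      by (rule near_int_syndetic[OF F Q(2) Q(1)]) (rule f)
    then show "syndetic {n. P n}" by (rule syndetic_mono) (use Q(3) in auto)
  qed
  with GF near that show ?thesis by blast
qed

text \<open>What holds eventually along the infimum of a nonempty chain already does so along a
  member, and each clause of \<open>good_filter\<close> speaks about a single predicate.\<close>

lemma good_filter_Inf_chain:
  assumes "\<And>F. F \<in> \<F> \<Longrightarrow> good_filter F" "\<F> \<noteq> {}" and chain: "\<And>F G. F \<in> \<F> \<Longrightarrow> G \<in> \<F> \<Longrightarrow> F \<le> G \<or> G \<le> F"
  shows "good_filter (Inf \<F>)"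
proof -
  have ev: "eventually P (Inf \<F>) \<longleftrightarrow> (\<exists>F\<in>\<F>. eventually P F)" for P
    using assms by (intro eventually_Inf_base) (metis inf.absorb_iff1 inf.absorb_iff2 order_refl)+
  have le: "Inf \<F> \<le> F" if "F \<in> \<F>" for F using that by (rule Inf_lower)
  show ?thesis
    unfolding good_filter_def
  proof (intro conjI allI impI)
    obtain F where "F \<in> \<F>" using assms(2) by blast
    then show "Inf \<F> \<le> cofinite" using le[of F] assms(1)[of F] unfolding good_filter_def by (meson order_trans)
  next
    fix P assume "eventually P (Inf \<F>)"
    then obtain F where F: "F \<in> \<F>" "eventually P F" unfolding ev by blast
    have "\<forall>\<^sub>F k in F. \<forall>\<^sub>F n in F. P (n + k)" using good_filter_shift assms(1) F by blast
    then have "\<forall>\<^sub>F k in F. \<forall>\<^sub>F n in Inf \<F>. P (n + k)"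
      by (rule eventually_mono) (rule filter_leD[OF le[OF F(1)]])
    then show "\<forall>\<^sub>F k in Inf \<F>. \<forall>\<^sub>F n in Inf \<F>. P (n + k)" by (rule filter_leD[OF le[OF F(1)]])
    show "syndetic {n. P n}" using good_filter_syndetic assms(1) F by blast
  qed
qed

text \<open>The consequence of minimality that is used later. As f is arbitrary, it also covers the
  derivatives, whose definition involves the parameter k.\<close>

definition nice_filter :: "int filter \<Rightarrow> bool" where
  "nice_filter F \<longleftrightarrow> good_filter F \<and>
     (\<forall>f. (\<forall>e>0. \<forall>\<^sub>F k in F. \<forall>\<^sub>F n in F. near_int e (f (n + k) - f n - f k))
          \<longrightarrow> (\<forall>e>0. \<forall>\<^sub>F n in F. near_int e (f n)))"

lemma nice_filter_good: "nice_filter F \<Longrightarrow> good_filter F"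
  by (simp add: nice_filter_def)

lemma nice_filter_near:
  assumes "nice_filter F" and "\<And>e. e > 0 \<Longrightarrow> \<forall>\<^sub>F k in F. \<forall>\<^sub>F n in F. near_int e (f (n + k) - f n - f k)" and "e > 0"
  shows "\<forall>\<^sub>F n in F. near_int e (f n)"
  using assms unfolding nice_filter_def by blast

lemma ex_nice_filter: "\<exists>F. nice_filter F"
proof -
  let ?A = "{F. good_filter F}"
  \<comment> \<open>Finer filters are smaller in the order of filters, so Zorn's lemma is applied to
    the reversed order; the empty chain is bounded by \<open>cofinite\<close>.\<close>
  have po: "partial_order_on ?A (relation_of (\<lambda>F G. G \<le> F) ?A)"
    by (rule partial_order_on_relation_ofI) auto
  have "\<exists>F\<in>?A. \<forall>G\<in>?A. G \<le> F \<longrightarrow> G = F"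
  proof (rule predicate_Zorn[OF po])
    fix \<F> assume c: "\<F> \<in> Chains (relation_of (\<lambda>F G. G \<le> F) ?A)"
    show "\<exists>u\<in>?A. \<forall>a\<in>\<F>. u \<le> a"
    proof (cases "\<F> = {}")
      case True
      then show ?thesis using good_filter_cofinite by blast
    next
      case False
      have "good_filter (Inf \<F>)"
        using c False by (intro good_filter_Inf_chain) (auto simp: Chains_def relation_of_def)
      then show ?thesis by (auto intro: Inf_lower)
    qed
  qed
  then obtain F where F: "good_filter F" "\<And>G. good_filter G \<Longrightarrow> G \<le> F \<Longrightarrow> G = F" by auto
  have "nice_filter F"
    unfolding nice_filter_def
  proof (intro conjI F(1) allI impI)
    fix f :: "int \<Rightarrow> real" and e :: real
    assume f: "\<forall>e>0. \<forall>\<^sub>F k in F. \<forall>\<^sub>F n in F. near_int e (f (n + k) - f n - f k)" and "e > 0"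
    obtain G where "good_filter G" "G \<le> F" "\<And>e. e > 0 \<Longrightarrow> \<forall>\<^sub>F n in G. near_int e (f n)"
      using good_filter_refine[OF F(1), of f] f by blast
    then show "\<forall>\<^sub>F n in F. near_int e (f n)" using F(2)[of G] \<open>e > 0\<close> by blast
  qed
  then show ?thesis by blast
qed

section \<open>Polynomial-like functions along a filter\<close>

text \<open>
  \<open>lead_term F d f a\<close>: along \<open>F\<close> the function \<open>f\<close> behaves like a polynomial without constant
  term, of degree at most \<open>d\<close> and with coefficient \<open>a\<close> at \<open>n\<^sup>d\<close>. For \<open>d = 0\<close> the value of
  \<open>a\<close> is irrelevant.
\<close>

primrec lead_term :: "int filter \<Rightarrow> nat \<Rightarrow> (int \<Rightarrow> real) \<Rightarrow> real \<Rightarrow> bool" where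
  "lead_term F 0 f a \<longleftrightarrow> (\<forall>\<^sub>F n in F. f n = 0)"
| "lead_term F (Suc d) f a \<longleftrightarrow>
     (\<exists>K. \<forall>\<^sub>F n in F. \<bar>f n - a * of_int n ^ Suc d\<bar> \<le> K * \<bar>of_int n\<bar> ^ d) \<and>
     (\<forall>\<^sub>F k in F. \<exists>c. lead_term F d (\<lambda>n. f (n + k) - f n - f k) c)"

definition poly_like :: "int filter \<Rightarrow> nat \<Rightarrow> (int \<Rightarrow> real) \<Rightarrow> bool" where
  "poly_like F d f \<longleftrightarrow> (\<exists>c. lead_term F d f c)"

lemma lead_term_Suc:
  "lead_term F (Suc d) f a \<longleftrightarrow>
     (\<exists>K. \<forall>\<^sub>F n in F. \<bar>f n - a * of_int n ^ Suc d\<bar> \<le> K * \<bar>of_int n\<bar> ^ d) \<and>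
     (\<forall>\<^sub>F k in F. poly_like F d (\<lambda>n. f (n + k) - f n - f k))"
  by (simp add: poly_like_def)

declare lead_term.simps(2) [simp del]

lemma lead_term_bound:
  assumes "lead_term F (Suc d) f a"
  obtains K where "K \<ge> 0" "\<forall>\<^sub>F n in F. \<bar>f n - a * of_int n ^ Suc d\<bar> \<le> K * \<bar>of_int n\<bar> ^ d"
proof -
  obtain K where K: "\<forall>\<^sub>F n in F. \<bar>f n - a * of_int n ^ Suc d\<bar> \<le> K * \<bar>of_int n\<bar> ^ d"
    using assms unfolding lead_term_Suc by blast
  have "\<forall>\<^sub>F n in F. \<bar>f n - a * of_int n ^ Suc d\<bar> \<le> \<bar>K\<bar> * \<bar>of_int n\<bar> ^ d"
    using K
  proof eventually_elim
    case (elim n)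
    have "K * \<bar>of_int n\<bar> ^ d \<le> \<bar>K\<bar> * \<bar>of_int n\<bar> ^ d" by (intro mult_right_mono) auto
    then show ?case using elim by linarith
  qed
  then show ?thesis using that[of "\<bar>K\<bar>"] by simp
qed

lemma lead_term_diff:
  "lead_term F (Suc d) f a \<Longrightarrow> \<forall>\<^sub>F k in F. poly_like F d (\<lambda>n. f (n + k) - f n - f k)"
  unfolding lead_term_Suc by blast

lemma poly_likeI: "lead_term F d f c \<Longrightarrow> poly_like F d f"
  unfolding poly_like_def by blast

section \<open>Algebra of polynomial-like functions and their brackets\<close>

context
  fixes F :: "int filter"
  assumes F: "good_filter F"
begin

lemma lead_term_cong:
  assumes "\<forall>\<^sub>F n in F. f n = g n" "lead_term F d f a"
  shows "lead_term F d g a"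
  using assms
proof (induction d arbitrary: f g a)
  case 0
  then have "\<forall>\<^sub>F n in F. f n = g n" "\<forall>\<^sub>F n in F. f n = 0" by simp_all
  then have "\<forall>\<^sub>F n in F. g n = 0" by eventually_elim simp
  then show ?case by simp
next
  case (Suc d)
  obtain K where K: "\<forall>\<^sub>F n in F. \<bar>f n - a * of_int n ^ Suc d\<bar> \<le> K * \<bar>of_int n\<bar> ^ d"
    by (rule lead_term_bound[OF Suc.prems(2)]) blast
  have "\<forall>\<^sub>F n in F. \<bar>g n - a * of_int n ^ Suc d\<bar> \<le> K * \<bar>of_int n\<bar> ^ d"
    using K Suc.prems(1) by eventually_elim simp
  moreover have "\<forall>\<^sub>F k in F. poly_like F d (\<lambda>n. g (n + k) - g n - g k)"
    using lead_term_diff[OF Suc.prems(2)] Suc.prems(1) good_filter_shift[OF F Suc.prems(1)]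
  proof eventually_elim
    case (elim k)
    from elim(1) obtain c where c: "lead_term F d (\<lambda>n. f (n + k) - f n - f k) c"
      unfolding poly_like_def by blast
    have "\<forall>\<^sub>F n in F. f (n + k) - f n - f k = g (n + k) - g n - g k"
      using elim(3) Suc.prems(1) by eventually_elim (use elim(2) in simp)
    from Suc.IH[OF this c] show ?case by (rule poly_likeI)
  qed
  ultimately show ?case unfolding lead_term_Suc by blast
qed

lemma poly_like_cong:
  "\<forall>\<^sub>F n in F. f n = g n \<Longrightarrow> poly_like F d f \<Longrightarrow> poly_like F d g"
  unfolding poly_like_def using lead_term_cong by blast

lemma lead_term_zero [simp]: "lead_term F d (\<lambda>_. 0) 0"
proof (induction d)
  case (Suc d)
  then have "poly_like F d (\<lambda>_. 0)" by (rule poly_likeI)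
  moreover have "\<forall>\<^sub>F n in F. \<bar>(0::real) - 0 * of_int n ^ Suc d\<bar> \<le> 0 * \<bar>of_int n\<bar> ^ d" by simp
  ultimately show ?case unfolding lead_term_Suc by (auto intro!: exI[of _ 0])
qed simp

lemma lead_term_add:
  assumes "lead_term F d f a" "lead_term F d g b"
  shows "lead_term F d (\<lambda>n. f n + g n) (a + b)"
  using assms
proof (induction d arbitrary: f g a b)
  case 0
  then have "\<forall>\<^sub>F n in F. f n = 0" "\<forall>\<^sub>F n in F. g n = 0" by simp_all
  then have "\<forall>\<^sub>F n in F. f n + g n = 0" by eventually_elim simp
  then show ?case by simp
next
  case (Suc d)
  obtain K where K: "\<forall>\<^sub>F n in F. \<bar>f n - a * of_int n ^ Suc d\<bar> \<le> K * \<bar>of_int n\<bar> ^ d"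
    by (rule lead_term_bound[OF Suc.prems(1)]) blast
  obtain L where L: "\<forall>\<^sub>F n in F. \<bar>g n - b * of_int n ^ Suc d\<bar> \<le> L * \<bar>of_int n\<bar> ^ d"
    by (rule lead_term_bound[OF Suc.prems(2)]) blast
  have "\<forall>\<^sub>F n in F. \<bar>f n + g n - (a + b) * of_int n ^ Suc d\<bar> \<le> (K + L) * \<bar>of_int n\<bar> ^ d"
    using K L
  proof eventually_elim
    case (elim n)
    have "f n + g n - (a + b) * of_int n ^ Suc d = (f n - a * of_int n ^ Suc d) + (g n - b * of_int n ^ Suc d)"
      by (simp add: algebra_simps)
    then show ?case
      using elim abs_triangle_ineq[of "f n - a * of_int n ^ Suc d" "g n - b * of_int n ^ Suc d"]
      unfolding distrib_right by linarith
  qed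
  moreover have "\<forall>\<^sub>F k in F. poly_like F d (\<lambda>n. f (n + k) + g (n + k) - (f n + g n) - (f k + g k))"
    using lead_term_diff[OF Suc.prems(1)] lead_term_diff[OF Suc.prems(2)]
  proof eventually_elim
    case (elim k)
    then obtain c e where "lead_term F d (\<lambda>n. f (n + k) - f n - f k) c"
      "lead_term F d (\<lambda>n. g (n + k) - g n - g k) e"
      unfolding poly_like_def by blast
    from Suc.IH[OF this] show ?case
      by (intro poly_likeI[where c = "c + e"]) (simp add: algebra_simps)
  qed
  ultimately show ?case unfolding lead_term_Suc by blast
qed

lemma lead_term_scale:
  assumes "lead_term F d f a"
  shows "lead_term F d (\<lambda>n. r * f n) (r * a)"
  using assms
proof (induction d arbitrary: f a)
  case 0
  then have "\<forall>\<^sub>F n in F. f n = 0" by simp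
  then have "\<forall>\<^sub>F n in F. r * f n = 0" by eventually_elim simp
  then show ?case by simp
next
  case (Suc d)
  obtain K where K: "\<forall>\<^sub>F n in F. \<bar>f n - a * of_int n ^ Suc d\<bar> \<le> K * \<bar>of_int n\<bar> ^ d"
    by (rule lead_term_bound[OF Suc.prems(1)]) blast
  have "\<forall>\<^sub>F n in F. \<bar>r * f n - r * a * of_int n ^ Suc d\<bar> \<le> (\<bar>r\<bar> * K) * \<bar>of_int n\<bar> ^ d"
    using K
  proof eventually_elim
    case (elim n)
    have "r * f n - r * a * of_int n ^ Suc d = r * (f n - a * of_int n ^ Suc d)"
      by (simp add: algebra_simps)
    then have "\<bar>r * f n - r * a * of_int n ^ Suc d\<bar> = \<bar>r\<bar> * \<bar>f n - a * of_int n ^ Suc d\<bar>"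
      by (simp only: abs_mult)
    also have "\<dots> \<le> \<bar>r\<bar> * (K * \<bar>of_int n\<bar> ^ d)" by (intro mult_left_mono elim) simp
    finally show ?case by (simp add: mult.assoc)
  qed
  moreover have "\<forall>\<^sub>F k in F. poly_like F d (\<lambda>n. r * f (n + k) - r * f n - r * f k)"
    using lead_term_diff[OF Suc.prems(1)]
  proof eventually_elim
    case (elim k)
    then obtain c where "lead_term F d (\<lambda>n. f (n + k) - f n - f k) c"
      unfolding poly_like_def by blast
    from Suc.IH[OF this] show ?case
      by (intro poly_likeI[where c = "r * c"]) (simp add: algebra_simps)
  qed
  ultimately show ?case unfolding lead_term_Suc by blast
qed

lemma lead_term_minus: "lead_term F d f a \<Longrightarrow> lead_term F d (\<lambda>n. - f n) (- a)"
  using lead_term_scale[of d f a "-1"] by simp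

lemma lead_term_sub:
  "lead_term F d f a \<Longrightarrow> lead_term F d g b \<Longrightarrow> lead_term F d (\<lambda>n. f n - g n) (a - b)"
  using lead_term_add[of d f a "\<lambda>n. - g n" "- b"] lead_term_minus[of d g b] by simp

text \<open>Since |n| >= 1 along F, the old leading term and the old error both fit into the error
  allowed in the next degree.\<close>

lemma lead_term_Suc_lift:
  assumes "lead_term F d f a" shows "lead_term F (Suc d) f 0"
  using assms
proof (induction d arbitrary: f a)
  case 0
  then have "\<forall>\<^sub>F n in F. f n = 0" by simp
  then have z: "\<forall>\<^sub>F n in F. 0 = f n" by eventually_elim simp
  show ?case by (rule lead_term_cong[OF z]) simp
next
  case (Suc d)
  obtain K where K: "\<forall>\<^sub>F n in F. \<bar>f n - a * of_int n ^ Suc d\<bar> \<le> K * \<bar>of_int n\<bar> ^ d" "K \<ge> 0"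
    by (rule lead_term_bound[OF Suc.prems(1)]) blast
  have "\<forall>\<^sub>F n in F. \<bar>f n - 0 * of_int n ^ Suc (Suc d)\<bar> \<le> (K + \<bar>a\<bar>) * \<bar>of_int n\<bar> ^ Suc d"
    using K(1) good_filter_large[OF F, of 1]
  proof eventually_elim
    case (elim n)
    have n1: "\<bar>real_of_int n\<bar> \<ge> 1" using elim(2) by linarith
    have "\<bar>f n\<bar> \<le> K * \<bar>of_int n\<bar> ^ d + \<bar>a * of_int n ^ Suc d\<bar>" using elim(1) by linarith
    also have "\<bar>a * of_int n ^ Suc d\<bar> = \<bar>a\<bar> * \<bar>of_int n\<bar> ^ Suc d"
      by (simp only: abs_mult power_abs)
    also have "K * \<bar>of_int n\<bar> ^ d \<le> K * \<bar>of_int n\<bar> ^ Suc d"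
      using n1 K(2) by (intro mult_left_mono power_increasing) auto
    finally show ?case by (simp add: distrib_right)
  qed
  moreover have "\<forall>\<^sub>F k in F. poly_like F (Suc d) (\<lambda>n. f (n + k) - f n - f k)"
    using lead_term_diff[OF Suc.prems(1)]
  proof eventually_elim
    case (elim k)
    then obtain c where "lead_term F d (\<lambda>n. f (n + k) - f n - f k) c"
      unfolding poly_like_def by blast
    from Suc.IH[OF this] show ?case by (rule poly_likeI)
  qed
  ultimately show ?case unfolding lead_term_Suc[of F "Suc d"] by blast
qed

lemma lead_term_lift:
  assumes "lead_term F d f a" "d < e" shows "lead_term F e f 0"
proof -
  have "lead_term F (Suc d + m) f 0" for m
    by (induction m) (auto intro: lead_term_Suc_lift assms)
  from this[of "e - Suc d"] show ?thesis using assms(2) by simp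
qed

lemma poly_like_lift: "poly_like F d f \<Longrightarrow> d \<le> e \<Longrightarrow> poly_like F e f"
  unfolding poly_like_def using lead_term_lift by (metis le_neq_implies_less)

lemma poly_like_add: "poly_like F d f \<Longrightarrow> poly_like F d g \<Longrightarrow> poly_like F d (\<lambda>n. f n + g n)"
  unfolding poly_like_def using lead_term_add by blast

lemma poly_like_scale: "poly_like F d f \<Longrightarrow> poly_like F d (\<lambda>n. r * f n)"
  unfolding poly_like_def using lead_term_scale by blast

lemma lead_term_id: "lead_term F 1 (\<lambda>n. of_int n) 1"
  unfolding One_nat_def lead_term_Suc
  by (auto simp: poly_like_def intro!: exI[of _ 0])

text \<open>With u and v the derivatives of f and g by k, the derivative of the product is
  \<open>f n * v n + u n * g n + u n * v n\<close> plus constant multiples of f, g, u and v. The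
  three products have smaller total degree, so induction on \<open>d + e\<close> applies.\<close>

lemma lead_term_mult:
  assumes "lead_term F (Suc d) f a" "lead_term F (Suc e) g b"
  shows "lead_term F (Suc d + Suc e) (\<lambda>n. f n * g n) (a * b)"
  using assms
proof (induction "d + e" arbitrary: d e f g a b rule: less_induct)
  case less
  \<comment> \<open>The induction hypothesis covers factors of positive degree; a derivative may
    also have degree 0, and then it vanishes along F together with the product.\<close>
  have prod: "poly_like F m (\<lambda>n. u n * v n)"
    if u: "poly_like F d' u" and v: "poly_like F e' v" and m: "d' + e' \<le> m" and de: "d' + e' < Suc d + Suc e"
    for d' e' u v m
  proof -
    have "poly_like F (d' + e') (\<lambda>n. u n * v n)"
    proof (cases "d' = 0 \<or> e' = 0")
      case True
      then have "(\<forall>\<^sub>F n in F. u n = 0) \<or> (\<forall>\<^sub>F n in F. v n = 0)"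
        using u v unfolding poly_like_def by auto
      then have z: "\<forall>\<^sub>F n in F. 0 = u n * v n" by (auto elim: eventually_mono)
      show ?thesis by (rule poly_like_cong[OF z]) (rule poly_likeI, rule lead_term_zero)
    next
      case False
      then obtain d'' e'' where s: "d' = Suc d''" "e' = Suc e''" by (metis not0_implies_Suc)
      have "d'' + e'' < d + e" using de s by simp
      from less.hyps[OF this] u v show ?thesis unfolding s poly_like_def by blast
    qed
    then show ?thesis using m by (rule poly_like_lift)
  qed
  obtain K where K: "\<forall>\<^sub>F n in F. \<bar>f n - a * of_int n ^ Suc d\<bar> \<le> K * \<bar>of_int n\<bar> ^ d" "K \<ge> 0"
    by (rule lead_term_bound[OF less.prems(1)]) blast
  obtain L where L: "\<forall>\<^sub>F n in F. \<bar>g n - b * of_int n ^ Suc e\<bar> \<le> L * \<bar>of_int n\<bar> ^ e" "L \<ge> 0"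
    by (rule lead_term_bound[OF less.prems(2)]) blast
  have "\<forall>\<^sub>F n in F. \<bar>f n * g n - a * b * of_int n ^ Suc (Suc d + e)\<bar>
      \<le> (\<bar>a\<bar> * L + \<bar>b\<bar> * K + K * L) * \<bar>of_int n\<bar> ^ (Suc d + e)"
    using K(1) L(1) good_filter_large[OF F, of 1]
  proof eventually_elim
    case (elim n)
    define x where "x = real_of_int n"
    define u where "u = f n - a * x ^ Suc d"
    define v where "v = g n - b * x ^ Suc e"
    have x1: "\<bar>x\<bar> \<ge> 1" using elim(3) unfolding x_def by linarith
    have u: "\<bar>u\<bar> \<le> K * \<bar>x\<bar> ^ d" and v: "\<bar>v\<bar> \<le> L * \<bar>x\<bar> ^ e" using elim by (auto simp: u_def v_def x_def)
    have "f n * g n - a * b * x ^ Suc (Suc d + e) = a * x ^ Suc d * v + b * x ^ Suc e * u + u * v"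
      by (simp add: u_def v_def algebra_simps power_add)
    also have "\<bar>\<dots>\<bar> \<le> \<bar>a * x ^ Suc d * v\<bar> + \<bar>b * x ^ Suc e * u\<bar> + \<bar>u * v\<bar>" by linarith
    also have "\<bar>a * x ^ Suc d * v\<bar> \<le> \<bar>a\<bar> * \<bar>x\<bar> ^ Suc d * (L * \<bar>x\<bar> ^ e)"
      unfolding abs_mult power_abs by (intro mult_mono v) auto
    also have "\<bar>b * x ^ Suc e * u\<bar> \<le> \<bar>b\<bar> * \<bar>x\<bar> ^ Suc e * (K * \<bar>x\<bar> ^ d)"
      unfolding abs_mult power_abs by (intro mult_mono u) auto
    also have "\<bar>u * v\<bar> \<le> K * \<bar>x\<bar> ^ d * (L * \<bar>x\<bar> ^ e)"
      unfolding abs_mult power_abs by (intro mult_mono u v) (auto simp: K)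
    also have "K * \<bar>x\<bar> ^ d * (L * \<bar>x\<bar> ^ e) \<le> K * L * \<bar>x\<bar> ^ (Suc d + e)"
    proof -
      have "K * L * \<bar>x\<bar> ^ (d + e) \<le> K * L * \<bar>x\<bar> ^ (Suc d + e)"
        using x1 K(2) L(2) by (intro mult_left_mono power_increasing) auto
      then show ?thesis by (simp add: power_add mult_ac)
    qed
    finally show ?case by (simp add: x_def[symmetric] algebra_simps power_add)
  qed
  moreover have "\<forall>\<^sub>F k in F. poly_like F (Suc d + e) (\<lambda>n. f (n + k) * g (n + k) - f n * g n - f k * g k)"
    using lead_term_diff[OF less.prems(1)] lead_term_diff[OF less.prems(2)]
  proof eventually_elim
    case (elim k)
    define u where "u n = f (n + k) - f n - f k" for n
    define v where "v n = g (n + k) - g n - g k" for n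
    have u: "poly_like F d u" and v: "poly_like F e v" using elim unfolding u_def v_def by auto
    have f: "poly_like F (Suc d) f" and g: "poly_like F (Suc e) g" using less.prems by (auto intro: poly_likeI)
    have l: "poly_like F (Suc d + e) f" "poly_like F (Suc d + e) g"
      "poly_like F (Suc d + e) u" "poly_like F (Suc d + e) v"
      using f g u v by (auto elim!: poly_like_lift)
    have "poly_like F (Suc d + e) (\<lambda>n. f n * v n)" "poly_like F (Suc d + e) (\<lambda>n. u n * g n)"
      "poly_like F (Suc d + e) (\<lambda>n. u n * v n)"
      by (rule prod[OF f v] prod[OF u g] prod[OF u v]; simp)+
    then have "poly_like F (Suc d + e) (\<lambda>n. f n * v n + u n * g n + u n * v n
        + g k * f n + f k * g n + f k * v n + g k * u n)"
      using l by (intro poly_like_add poly_like_scale)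
    moreover have "f n * v n + u n * g n + u n * v n + g k * f n + f k * g n + f k * v n + g k * u n
        = f (n + k) * g (n + k) - f n * g n - f k * g k" for n
      by (simp add: u_def v_def algebra_simps)
    ultimately show ?case by simp
  qed
  ultimately show ?case using lead_term_Suc[of F "Suc d + e" "\<lambda>n. f n * g n" "a * b"] by auto
qed

text \<open>The induction hypothesis for the derivatives is exactly the almost additivity that
  \<open>nice_filter\<close> asks for.\<close>

lemma poly_like_near_int:
  assumes "nice_filter F" "poly_like F d f" "e > 0"
  shows "\<forall>\<^sub>F n in F. near_int e (f n)"
  using assms(2,3)
proof (induction d arbitrary: f e)
  case 0
  then have "\<forall>\<^sub>F n in F. f n = 0" by (simp add: poly_like_def)
  then show ?case by eventually_elim (simp add: 0)
next
  case (Suc d)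
  have "\<forall>\<^sub>F k in F. poly_like F d (\<lambda>n. f (n + k) - f n - f k)"
    using Suc.prems(1) lead_term_diff unfolding poly_like_def[of F "Suc d"] by blast
  then have "\<forall>\<^sub>F k in F. \<forall>\<^sub>F n in F. near_int e (f (n + k) - f n - f k)" if "e > 0" for e
    by eventually_elim (use Suc.IH that in blast)
  then show ?case using nice_filter_near[OF assms(1)] Suc.prems(2) by blast
qed

text \<open>Rounding commutes with the derivative: for most k and n, the numbers \<open>f n\<close>,
  \<open>f k\<close> and the derivative \<open>u n\<close> are within 1/8 of integers, so
  \<open>f n + f k\<close> is within the 1/4 required by \<open>nint_add\<close>. The leading
  coefficient is kept because rounding moves f by at most 1/2.\<close>

lemma lead_term_nint:
  assumes "nice_filter F" "lead_term F d f a"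
  shows "lead_term F d (\<lambda>n. of_int (nint (f n))) a"
  using assms(2)
proof (induction d arbitrary: f a)
  case 0
  then have "\<forall>\<^sub>F n in F. f n = 0" by simp
  then have "\<forall>\<^sub>F n in F. real_of_int (nint (f n)) = 0" by eventually_elim simp
  then show ?case by simp
next
  case (Suc d)
  obtain K where K: "\<forall>\<^sub>F n in F. \<bar>f n - a * of_int n ^ Suc d\<bar> \<le> K * \<bar>of_int n\<bar> ^ d" "K \<ge> 0"
    by (rule lead_term_bound[OF Suc.prems(1)]) blast
  have "\<forall>\<^sub>F n in F. \<bar>of_int (nint (f n)) - a * of_int n ^ Suc d\<bar> \<le> (K + 1) * \<bar>of_int n\<bar> ^ d"
    using K(1) good_filter_large[OF F, of 1]
  proof eventually_elim
    case (elim n)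
    have "\<bar>real_of_int n\<bar> \<ge> 1" using elim(2) by linarith
    then have "\<bar>real_of_int n\<bar> ^ d \<ge> 1" by simp
    then have "\<bar>f n - of_int (nint (f n))\<bar> \<le> \<bar>real_of_int n\<bar> ^ d"
      using nint_bound[of "f n"] by linarith
    then show ?case using elim(1) unfolding distrib_right by linarith
  qed
  moreover have near: "\<forall>\<^sub>F n in F. near_int (1/8) (f n)"
    using poly_like_near_int[OF assms(1)] poly_likeI[OF Suc.prems] by simp
  have "\<forall>\<^sub>F k in F. poly_like F d (\<lambda>n. of_int (nint (f (n + k))) - of_int (nint (f n)) - of_int (nint (f k)))"
    using lead_term_diff[OF Suc.prems(1)] near
  proof eventually_elim
    case (elim k)
    define u where "u n = f (n + k) - f n - f k" for n
    from elim(1) obtain c where c: "lead_term F d u c"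
      unfolding poly_like_def u_def by blast
    have "\<forall>\<^sub>F n in F. near_int (1/8) (u n)"
      using poly_like_near_int[OF assms(1)] poly_likeI[OF c] by simp
    with near have "\<forall>\<^sub>F n in F. of_int (nint (u n)) =
        (of_int (nint (f (n + k))) - of_int (nint (f n)) - of_int (nint (f k)) :: real)"
    proof eventually_elim
      case (elim n)
      have "near_int (1/4) (f n + f k)"
        using near_int_add[OF elim(1) \<open>near_int (1/8) (f k)\<close>] by simp
      then have "nint (f n + f k + u n) = nint (f n + f k) + nint (u n)"
        using elim(2) by (intro nint_add) (auto elim: near_int_mono)
      moreover have "nint (f n + f k) = nint (f n) + nint (f k)"
        using elim(1) \<open>near_int (1/8) (f k)\<close> by (intro nint_add) (auto elim: near_int_mono)
      moreover have "f n + f k + u n = f (n + k)" by (simp add: u_def)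
      ultimately show ?case by simp
    qed
    from lead_term_cong[OF this Suc.IH[OF c]] show ?case by (rule poly_likeI)
  qed
  ultimately show ?case unfolding lead_term_Suc by blast
qed

section \<open>Uniqueness of degree and leading coefficient\<close>

lemma leading_coeff_tendsto:
  assumes "lead_term F (Suc d) f a"
  shows "((\<lambda>n. f n / of_int n ^ Suc d) \<longlongrightarrow> a) F"
proof (rule tendstoI)
  fix e :: real assume "e > 0"
  obtain K where K: "\<forall>\<^sub>F n in F. \<bar>f n - a * of_int n ^ Suc d\<bar> \<le> K * \<bar>of_int n\<bar> ^ d" "K \<ge> 0"
    by (rule lead_term_bound[OF assms]) blast
  show "\<forall>\<^sub>F n in F. dist (f n / of_int n ^ Suc d) a < e"
    using K(1) good_filter_large[OF F, of "\<lceil>K / e\<rceil> + 1"]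
  proof eventually_elim
    case (elim n)
    have "K / e < \<bar>real_of_int n\<bar>" using elim(2) by linarith
    then have Ke: "K < e * \<bar>real_of_int n\<bar>" using \<open>e > 0\<close> by (simp add: field_simps)
    then have n0: "\<bar>real_of_int n\<bar> > 0" using K(2) \<open>e > 0\<close> by (cases "n = 0") auto
    have "\<bar>f n - a * of_int n ^ Suc d\<bar> < e * \<bar>of_int n\<bar> ^ Suc d"
    proof -
      have "K * \<bar>real_of_int n\<bar> ^ d < e * \<bar>of_int n\<bar> * \<bar>of_int n\<bar> ^ d"
        using Ke n0 by (intro mult_strict_right_mono) auto
      then show ?thesis using elim(1) by (simp add: mult.assoc)
    qed
    then have "\<bar>f n - a * of_int n ^ Suc d\<bar> / \<bar>of_int n ^ Suc d\<bar> < e"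
      using n0 by (subst pos_divide_less_eq) (auto simp: power_abs abs_mult)
    then have "\<bar>(f n - a * of_int n ^ Suc d) / of_int n ^ Suc d\<bar> < e" by (simp only: abs_divide)
    then show ?case using n0 by (simp add: dist_real_def diff_divide_distrib)
  qed
qed

lemma lead_term_unique_coeff:
  assumes "lead_term F (Suc d) f a" "lead_term F (Suc d) f b" shows "a = b"
  using leading_coeff_tendsto[OF assms(1)] leading_coeff_tendsto[OF assms(2)]
    tendsto_unique good_filter_not_bot[OF F] by blast

text \<open>If the degrees differed, lifting the smaller one would give the coefficient 0 in the
  larger degree.\<close>

lemma lead_term_unique:
  assumes "lead_term F (Suc d) f a" "lead_term F (Suc e) f b" "a \<noteq> 0" "b \<noteq> 0"
  shows "d = e \<and> a = b"
proof (rule linorder_cases[of d e])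
  assume "d < e"
  then show ?thesis using lead_term_unique_coeff[OF assms(2)] lead_term_lift[OF assms(1), of "Suc e"] assms by auto
next
  assume "e < d"
  then show ?thesis using lead_term_unique_coeff[OF assms(1)] lead_term_lift[OF assms(2), of "Suc d"] assms by auto
next
  assume "d = e"
  then show ?thesis using lead_term_unique_coeff assms by auto
qed

end

text \<open>The first two terms of the binomial expansion of \<open>(x + k) ^ (d + 2)\<close>. For
  fixed k the rest is of order d in x.\<close>

lemma power_shift_approx:
  fixes k :: real
  shows "\<exists>C\<ge>0. \<forall>x::real. \<bar>x\<bar> \<ge> 1 \<longrightarrow>
    \<bar>((x + k) ^ Suc (Suc d) - x ^ Suc (Suc d)) - (real d + 2) * k * x ^ Suc d\<bar> \<le> C * \<bar>x\<bar> ^ d"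
proof (induction d)
  case 0
  show ?case
  proof (intro exI[of _ "k\<^sup>2"] conjI allI impI)
    fix x :: real
    have "((x + k) ^ Suc (Suc 0) - x ^ Suc (Suc 0)) - (real 0 + 2) * k * x ^ Suc 0 = k\<^sup>2"
      by (simp add: power2_eq_square algebra_simps)
    then show "\<bar>((x + k) ^ Suc (Suc 0) - x ^ Suc (Suc 0)) - (real 0 + 2) * k * x ^ Suc 0\<bar> \<le> k\<^sup>2 * \<bar>x\<bar> ^ 0"
      by simp
  qed simp
next
  case (Suc d)
  then obtain C where C: "C \<ge> 0" "\<And>x::real. \<bar>x\<bar> \<ge> 1 \<Longrightarrow>
    \<bar>((x + k) ^ Suc (Suc d) - x ^ Suc (Suc d)) - (real d + 2) * k * x ^ Suc d\<bar> \<le> C * \<bar>x\<bar> ^ d" by blast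
  show ?case
  proof (intro exI[of _ "(1 + \<bar>k\<bar>) * C + (real d + 2) * k\<^sup>2"] conjI allI impI)
    show "0 \<le> (1 + \<bar>k\<bar>) * C + (real d + 2) * k\<^sup>2" using C(1) by simp
  next
    fix x :: real assume x: "\<bar>x\<bar> \<ge> 1"
    define r where "r = ((x + k) ^ Suc (Suc d) - x ^ Suc (Suc d)) - (real d + 2) * k * x ^ Suc d"
    have e: "(x + k) ^ Suc (Suc d) = r + x ^ Suc (Suc d) + (real d + 2) * k * x ^ Suc d"
      by (simp add: r_def)
    have r: "\<bar>r\<bar> \<le> C * \<bar>x\<bar> ^ d" unfolding r_def by (rule C(2)[OF x])
    have "(x + k) ^ Suc (Suc (Suc d)) - x ^ Suc (Suc (Suc d)) - (real (Suc d) + 2) * k * x ^ Suc (Suc d)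
       = (x + k) * (r + x ^ Suc (Suc d) + (real d + 2) * k * x ^ Suc d)
          - x ^ Suc (Suc (Suc d)) - (real (Suc d) + 2) * k * x ^ Suc (Suc d)"
      unfolding e[symmetric] by simp
    also have "\<dots> = (x + k) * r + (real d + 2) * k\<^sup>2 * x ^ Suc d"
      by (simp add: algebra_simps power2_eq_square)
    also have "\<bar>\<dots>\<bar> \<le> \<bar>x + k\<bar> * \<bar>r\<bar> + (real d + 2) * k\<^sup>2 * \<bar>x\<bar> ^ Suc d"
    proof -
      have "\<bar>(real d + 2) * k\<^sup>2 * x ^ Suc d\<bar> = (real d + 2) * k\<^sup>2 * \<bar>x\<bar> ^ Suc d"
        by (simp add: abs_mult power_abs)
      then show ?thesis
        using abs_triangle_ineq[of "(x + k) * r" "(real d + 2) * k\<^sup>2 * x ^ Suc d"]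
        by (simp only: abs_mult)
    qed
    also have "\<bar>x + k\<bar> * \<bar>r\<bar> \<le> ((1 + \<bar>k\<bar>) * \<bar>x\<bar>) * (C * \<bar>x\<bar> ^ d)"
    proof (intro mult_mono r)
      have "\<bar>k\<bar> * 1 \<le> \<bar>k\<bar> * \<bar>x\<bar>" using x by (intro mult_left_mono) auto
      then show "\<bar>x + k\<bar> \<le> (1 + \<bar>k\<bar>) * \<bar>x\<bar>" unfolding distrib_right by linarith
    qed auto
    finally show "\<bar>(x + k) ^ Suc (Suc (Suc d)) - x ^ Suc (Suc (Suc d)) - (real (Suc d) + 2) * k * x ^ Suc (Suc d)\<bar>
      \<le> ((1 + \<bar>k\<bar>) * C + (real d + 2) * k\<^sup>2) * \<bar>x\<bar> ^ Suc d"
      by (simp add: algebra_simps)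
  qed
qed

text \<open>For the monomial \<open>a * n ^ (d + 2)\<close> the coefficient of the derivative by k
  is \<open>(d + 2) * a * k\<close>. The error of f against it has the order of the derivative
  itself and so changes the coefficient, but by an amount independent of k. This uniformity later
  separates translations that are far apart.\<close>

lemma lead_term_diff_coeff:
  assumes F: "good_filter F" and f: "lead_term F (Suc (Suc d)) f a"
  obtains K where "\<forall>\<^sub>F k in F. \<exists>c. lead_term F (Suc d) (\<lambda>n. f (n + k) - f n - f k) c \<and>
                      \<bar>c - (real d + 2) * a * of_int k\<bar> \<le> K"
proof -
  obtain K where K: "\<forall>\<^sub>F n in F. \<bar>f n - a * of_int n ^ Suc (Suc d)\<bar> \<le> K * \<bar>of_int n\<bar> ^ Suc d" "K \<ge> 0"
    by (rule lead_term_bound[OF f]) blast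
  \<comment> \<open>The error of f enters at n and at \<open>n + k\<close>, where |n + k| <= 2 |n|
    produces the power of 2. The final 1 absorbs all terms of order d, collected in \<open>R\<close>
    below, once |n| >= R.\<close>
  define K' where "K' = K * (2 ^ Suc d + 1) + 1"
  have "\<forall>\<^sub>F k in F. \<exists>c. lead_term F (Suc d) (\<lambda>n. f (n + k) - f n - f k) c \<and>
                      \<bar>c - (real d + 2) * a * of_int k\<bar> \<le> K'"
    using lead_term_diff[OF f] good_filter_shift[OF F K(1)]
  proof eventually_elim
    case (elim k)
    obtain c where c: "lead_term F (Suc d) (\<lambda>n. f (n + k) - f n - f k) c"
      using elim(1) unfolding poly_like_def by blast
    obtain L where L: "\<forall>\<^sub>F n in F. \<bar>(f (n + k) - f n - f k) - c * of_int n ^ Suc d\<bar> \<le> L * \<bar>of_int n\<bar> ^ d" "L \<ge> 0"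
      by (rule lead_term_bound[OF c]) blast
    obtain C where C: "C \<ge> 0" "\<And>x::real. \<bar>x\<bar> \<ge> 1 \<Longrightarrow>
      \<bar>((x + of_int k) ^ Suc (Suc d) - x ^ Suc (Suc d)) - (real d + 2) * of_int k * x ^ Suc d\<bar> \<le> C * \<bar>x\<bar> ^ d"
      using power_shift_approx[of "of_int k" d] by blast
    define R where "R = L + \<bar>a\<bar> * C + \<bar>f k\<bar>"
    have R0: "R \<ge> 0" using L(2) C(1) by (simp add: R_def)
    have "\<forall>\<^sub>F n in F. \<bar>c - (real d + 2) * a * of_int k\<bar> \<le> K'"
      using L(1) K(1) elim(2) good_filter_large[OF F, of "max (\<bar>k\<bar> + 1) (\<lceil>R\<rceil>)"]
    proof eventually_elim
      case (elim n)
      define x where "x = real_of_int n"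
      define y where "y = real_of_int k"
      define m where "m = (real d + 2) * a * y"
      have xk: "\<bar>x\<bar> \<ge> \<bar>y\<bar> + 1" "\<bar>x\<bar> \<ge> R"
        using elim(4) unfolding x_def y_def by linarith+
      then have x1: "\<bar>x\<bar> \<ge> 1" by linarith
      have x0: "\<bar>x\<bar> > 0" using x1 by linarith
      have 1: "\<bar>(f (n + k) - f n - f k) - c * x ^ Suc d\<bar> \<le> L * \<bar>x\<bar> ^ d" using elim(1) by (simp add: x_def)
      have 2: "\<bar>f n - a * x ^ Suc (Suc d)\<bar> \<le> K * \<bar>x\<bar> ^ Suc d" using elim(2) by (simp add: x_def)
      have "\<bar>x + y\<bar> \<le> 2 * \<bar>x\<bar>" using xk by linarith
      then have "\<bar>x + y\<bar> ^ Suc d \<le> (2 * \<bar>x\<bar>) ^ Suc d" by (intro power_mono) auto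
      then have "K * \<bar>x + y\<bar> ^ Suc d \<le> K * (2 * \<bar>x\<bar>) ^ Suc d" using K(2) by (rule mult_left_mono)
      then have 3: "\<bar>f (n + k) - a * (x + y) ^ Suc (Suc d)\<bar> \<le> K * (2 ^ Suc d * \<bar>x\<bar> ^ Suc d)"
        using elim(3) by (simp only: x_def y_def of_int_add power_mult_distrib)
      have "\<bar>a * (((x + y) ^ Suc (Suc d) - x ^ Suc (Suc d)) - (real d + 2) * y * x ^ Suc d)\<bar> \<le> \<bar>a\<bar> * (C * \<bar>x\<bar> ^ d)"
        unfolding abs_mult by (intro mult_left_mono C(2)[OF x1, folded y_def]) simp
      moreover have "a * (((x + y) ^ Suc (Suc d) - x ^ Suc (Suc d)) - (real d + 2) * y * x ^ Suc d)
         = a * (x + y) ^ Suc (Suc d) - a * x ^ Suc (Suc d) - m * x ^ Suc d"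
        unfolding m_def right_diff_distrib by (simp only: mult_ac)
      ultimately have 4: "\<bar>a * (x + y) ^ Suc (Suc d) - a * x ^ Suc (Suc d) - m * x ^ Suc d\<bar> \<le> \<bar>a\<bar> * (C * \<bar>x\<bar> ^ d)"
        by simp
      have xd: "\<bar>x\<bar> ^ d \<ge> 1" using x1 by simp
      then have 5: "\<bar>f k\<bar> \<le> \<bar>f k\<bar> * \<bar>x\<bar> ^ d" by (simp add: mult_le_cancel_left1)
      have "\<bar>c * x ^ Suc d - m * x ^ Suc d\<bar>
          \<le> L * \<bar>x\<bar> ^ d + K * \<bar>x\<bar> ^ Suc d + K * (2 ^ Suc d * \<bar>x\<bar> ^ Suc d) + \<bar>a\<bar> * (C * \<bar>x\<bar> ^ d) + \<bar>f k\<bar> * \<bar>x\<bar> ^ d"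
        using 1 2 3 4 5 by linarith
      also have "\<dots> = R * \<bar>x\<bar> ^ d + (K * (2 ^ Suc d + 1)) * \<bar>x\<bar> ^ Suc d"
        by (simp add: R_def algebra_simps)
      also have "R * \<bar>x\<bar> ^ d \<le> \<bar>x\<bar> * \<bar>x\<bar> ^ d" using xk(2) by (intro mult_right_mono) auto
      finally have "\<bar>c * x ^ Suc d - m * x ^ Suc d\<bar> \<le> K' * \<bar>x\<bar> ^ Suc d"
        by (simp add: K'_def algebra_simps)
      moreover have "c * x ^ Suc d - m * x ^ Suc d = (c - m) * x ^ Suc d" by (simp add: algebra_simps)
      ultimately have "\<bar>c - m\<bar> * \<bar>x\<bar> ^ Suc d \<le> K' * \<bar>x\<bar> ^ Suc d" by (simp only: abs_mult power_abs)
      then have "\<bar>c - m\<bar> \<le> K'" using x0 by (simp only: mult_le_cancel_right) (simp add: not_less)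
      then show ?case by (simp add: m_def y_def)
    qed
    then have "\<bar>c - (real d + 2) * a * of_int k\<bar> \<le> K'"
      using good_filter_not_bot[OF F] by (metis eventually_const_iff)
    with c show ?case by blast
  qed
  then show ?thesis by (rule that)
qed

section \<open>Expansions of generalized polynomials\<close>

lemma lead_term_monom:
  assumes F: "good_filter F"
  shows "lead_term F (Suc j) (\<lambda>n. a * of_int n ^ Suc j) a"
proof -
  have "lead_term F (Suc j) (\<lambda>n. of_int n ^ Suc j) 1"
  proof (induction j)
    case 0
    then show ?case using lead_term_id[OF F] by simp
  next
    case (Suc j)
    have "lead_term F (Suc 0) (\<lambda>n. of_int n) 1" using lead_term_id[OF F] by simp
    from lead_term_mult[OF F this Suc] show ?case by simp
  qed
  from lead_term_scale[OF F this, of a] show ?thesis by simp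
qed

text \<open>Degree 0 is left out because there the coefficient carries no information.\<close>

definition nondeg :: "int filter \<Rightarrow> (int \<Rightarrow> real) \<Rightarrow> bool" where
  "nondeg F f \<longleftrightarrow> (\<exists>d a. a \<noteq> 0 \<and> lead_term F (Suc d) f a)"

text \<open>A factor with exponent 0 only rescales a bracket, one with positive exponent raises its
  degree. The last exponent must be positive: a constant tends to 0 modulo 1 only if it is an
  integer.\<close>

lemma simple_L_poly_like:
  assumes F: "nice_filter F" and "bs \<noteq> []" "snd (last bs) \<ge> 1"
  shows "\<exists>d. poly_like F (Suc d) (simple_L bs)"
  using assms(2,3)
proof (induction bs rule: induct_list012)
  case 1
  then show ?case by simp
next
  case (2 b)
  obtain a j where b: "b = (a, Suc j)" using 2 by (cases b; cases "snd b") auto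
  have "simple_L [b] = (\<lambda>n. a * of_int n ^ Suc j)" by (rule ext) (simp add: b)
  then show ?case
    using poly_likeI[OF lead_term_monom[OF nice_filter_good[OF F], of j a]] by auto
next
  case (3 b c bs)
  note G = nice_filter_good[OF F]
  obtain d e where d: "lead_term F (Suc d) (simple_L (c # bs)) e"
    using "3.IH"(2) "3.prems" unfolding poly_like_def by auto
  have n: "lead_term F (Suc d) (\<lambda>n. of_int (nint (simple_L (c # bs) n))) e"
    by (rule lead_term_nint[OF G F d])
  obtain a j where b: "b = (a, j)" by (cases b)
  have eq: "simple_L (b # c # bs) = (\<lambda>n. a * of_int n ^ j * of_int (nint (simple_L (c # bs) n)))"
    by (rule ext) (simp add: b)
  show ?case
  proof (cases j)
    case 0
    then show ?thesis using lead_term_scale[OF G n, of a] unfolding eq by (auto simp: poly_like_def)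
  next
    case (Suc i)
    from lead_term_mult[OF G lead_term_monom[OF G, of i a] n]
    have "lead_term F (Suc (Suc i + d)) (simple_L (b # c # bs)) (a * e)"
      unfolding eq Suc by simp
    then show ?thesis by (blast intro: poly_likeI)
  qed
qed

lemma SGP_hat_near_int:
  assumes F: "nice_filter F" and g: "g \<in> SGP_hat s" and "e > 0"
  shows "\<forall>\<^sub>F n in F. near_int e (g n)"
proof -
  note G = nice_filter_good[OF F]
  obtain bss where bss: "bss \<noteq> []" "\<forall>bs\<in>set bss. 1 \<le> length bs \<and> snd (last bs) \<ge> 1"
    and geq: "g = (\<lambda>n. prod_list (map (\<lambda>bs. simple_L bs n) bss))"
    using g unfolding SGP_hat_def by blast
  have "\<exists>d. poly_like F (Suc d) (\<lambda>n. prod_list (map (\<lambda>bs. simple_L bs n) bss))"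
    using bss
  proof (induction bss rule: list_nonempty_induct)
    case (single bs)
    then have "\<exists>d. poly_like F (Suc d) (simple_L bs)" by (intro simple_L_poly_like[OF F]) auto
    then show ?case by simp
  next
    case (cons bs bss)
    then have "bs \<noteq> []" "snd (last bs) \<ge> 1" by auto
    from simple_L_poly_like[OF F this] obtain d a where 1: "lead_term F (Suc d) (simple_L bs) a"
      unfolding poly_like_def by blast
    obtain e b where 2: "lead_term F (Suc e) (\<lambda>n. prod_list (map (\<lambda>bs. simple_L bs n) bss)) b"
      using cons unfolding poly_like_def by auto
    from lead_term_mult[OF G 1 2]
    have "lead_term F (Suc (Suc d + e)) (\<lambda>n. prod_list (map (\<lambda>bs. simple_L bs n) (bs # bss))) (a * b)" by simp
    then show ?case unfolding poly_like_def by blast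
  qed
  then show ?thesis unfolding geq using poly_like_near_int[OF G F] \<open>e > 0\<close> by blast
qed

section \<open>Values of formal sums of components\<close>

primrec comp_eval :: "component \<Rightarrow> int \<Rightarrow> real" where
  "comp_eval (Comp a j M) = (\<lambda>n. a * of_int n ^ j *
     prod_mset (image_mset (\<lambda>f. of_int (nint (f n))) (image_mset comp_eval M)))"

definition expansion_eval :: "component multiset \<Rightarrow> int \<Rightarrow> real" where
  "expansion_eval M n = (\<Sum>c\<in>#M. comp_eval c n)"

lemma expansion_eval_empty [simp]: "expansion_eval {#} n = 0"
  and expansion_eval_add_mset [simp]: "expansion_eval (add_mset c M) n = comp_eval c n + expansion_eval M n"
  and expansion_eval_union [simp]: "expansion_eval (M + N) n = expansion_eval M n + expansion_eval N n"
  by (simp_all add: expansion_eval_def)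

lemma comp_eval_scale [simp]: "comp_eval (comp_scale r c) n = r * comp_eval c n"
  by (cases c) simp

lemma comp_degree_scale [simp]: "comp_degree (comp_scale r c) = comp_degree c"
  by (cases c) simp

lemma comp_coeff_scale [simp]: "comp_coeff (comp_scale r c) = r * comp_coeff c"
  by (cases c) simp

lemma comp_eval_mult [simp]: "comp_eval (comp_mult c d) n = comp_eval c n * comp_eval d n"
  by (cases c; cases d) (simp add: power_add)

lemma comp_degree_mult [simp]: "comp_degree (comp_mult c d) = comp_degree c + comp_degree d"
  by (cases c; cases d) simp

lemma comp_coeff_mult [simp]: "comp_coeff (comp_mult c d) = comp_coeff c * comp_coeff d"
  by (cases c; cases d) simp

lemma comp_eval_bracket [simp]: "comp_eval (comp_bracket c) n = of_int (nint (comp_eval c n))"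
  by (auto simp: comp_bracket_def)

lemma comp_degree_bracket [simp]: "comp_degree (comp_bracket c) = comp_degree c"
  by (auto simp: comp_bracket_def)

lemma comp_coeff_bracket [simp]: "comp_coeff (comp_bracket c) = comp_coeff c"
  by (auto simp: comp_bracket_def)

lemma expansion_eval_scale [simp]: "expansion_eval (image_mset (comp_scale r) M) n = r * expansion_eval M n"
  by (induction M) (simp_all add: algebra_simps)

lemma expansion_eval_mult [simp]:
  "expansion_eval (fsum_mult M N) n = expansion_eval M n * expansion_eval N n"
proof -
  have "expansion_eval (image_mset (comp_mult c) N) n = comp_eval c n * expansion_eval N n" for c
    by (induction N) (simp_all add: algebra_simps)
  then show ?thesis by (induction M) (simp_all add: fsum_mult_def algebra_simps)
qed

lemma in_fsum_mult: "c \<in># fsum_mult M N \<longleftrightarrow> (\<exists>a\<in>#M. \<exists>b\<in>#N. c = comp_mult a b)"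
  by (induction M) (auto simp: fsum_mult_def)

text \<open>The formal degree and coefficient describe the actual growth along F. Positive degree is
  demanded because \<open>lead_term\<close> in degree 0 means vanishing.\<close>

definition comp_nice :: "int filter \<Rightarrow> component \<Rightarrow> bool" where
  "comp_nice F c \<longleftrightarrow> 0 < comp_degree c \<and> lead_term F (comp_degree c) (comp_eval c) (comp_coeff c)"

text \<open>Such components arise at the start of the fold in the expansion of
  \<open>GMon a 0 fs\<close>, before any bracket is multiplied in.\<close>

definition comp_const :: "component \<Rightarrow> bool" where
  "comp_const c \<longleftrightarrow> comp_degree c = 0 \<and> comp_eval c = (\<lambda>_. comp_coeff c)"

context
  fixes F :: "int filter"
  assumes F: "nice_filter F"
begin

private lemma G: "good_filter F" by (rule nice_filter_good[OF F])

lemma comp_nice_scale: "comp_nice F c \<Longrightarrow> comp_nice F (comp_scale r c)"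
  unfolding comp_nice_def comp_degree_scale comp_coeff_scale
  using lead_term_scale[OF G, of "comp_degree c" "comp_eval c" "comp_coeff c" r]
  by (simp add: comp_eval_scale[abs_def])

lemma comp_nice_bracket: "comp_nice F c \<Longrightarrow> comp_nice F (comp_bracket c)"
  unfolding comp_nice_def using lead_term_nint[OF G F] by (simp add: comp_eval_bracket[abs_def])

lemma comp_nice_mult:
  assumes "comp_nice F c" "comp_nice F d \<or> comp_const d"
  shows "comp_nice F (comp_mult c d)"
  using assms(2)
proof
  assume d: "comp_nice F d"
  obtain i j where ij: "comp_degree c = Suc i" "comp_degree d = Suc j"
    using assms(1) d unfolding comp_nice_def by (metis Suc_pred)
  have "lead_term F (Suc i + Suc j) (\<lambda>n. comp_eval c n * comp_eval d n) (comp_coeff c * comp_coeff d)"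
    using lead_term_mult[OF G] assms(1) d ij unfolding comp_nice_def by metis
  then show ?thesis unfolding comp_nice_def by (simp add: comp_eval_mult[abs_def] ij)
next
  assume d: "comp_const d"
  have "lead_term F (comp_degree c) (\<lambda>n. comp_coeff d * comp_eval c n) (comp_coeff d * comp_coeff c)"
    using lead_term_scale[OF G] assms(1) unfolding comp_nice_def by blast
  then show ?thesis
    using d assms(1) unfolding comp_nice_def comp_const_def
    by (simp add: comp_eval_mult[abs_def] mult.commute)
qed

lemma expansion_near_int:
  assumes "\<And>c. c \<in># M \<Longrightarrow> comp_nice F c" and "e > 0"
  shows "\<forall>\<^sub>F n in F. near_int e (expansion_eval M n)"
  using assms
proof (induction M arbitrary: e)
  case empty
  then show ?case by simp
next
  case (add c M)
  have "poly_like F (comp_degree c) (comp_eval c)"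
    using add.prems(1)[of c] by (auto simp: comp_nice_def intro: poly_likeI)
  then have "\<forall>\<^sub>F n in F. near_int (e/2) (comp_eval c n)"
    using poly_like_near_int[OF G F] add.prems(2) by simp
  moreover have "\<forall>\<^sub>F n in F. near_int (e/2) (expansion_eval M n)"
    using add by simp
  ultimately show ?case
  proof eventually_elim
    case (elim n)
    show ?case using near_int_add[OF elim] by simp
  qed
qed

text \<open>All partial sums are close to integers along F, so \<open>nint_add\<close> splits off
  one component at a time.\<close>

lemma expansion_bracket:
  assumes "\<And>c. c \<in># M \<Longrightarrow> comp_nice F c"
  shows "\<forall>\<^sub>F n in F. of_int (nint (expansion_eval M n)) = expansion_eval (image_mset comp_bracket M) n"
  using assms
proof (induction M)
  case empty
  then show ?case by simp
next
  case (add c M)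
  have "\<forall>\<^sub>F n in F. near_int (1/4) (expansion_eval {#c#} n)"
    using add.prems by (intro expansion_near_int) auto
  moreover have "\<forall>\<^sub>F n in F. near_int (1/4) (expansion_eval M n)"
    using add.prems by (intro expansion_near_int) auto
  moreover have "\<forall>\<^sub>F n in F. of_int (nint (expansion_eval M n)) = expansion_eval (image_mset comp_bracket M) n"
    using add by simp
  ultimately show ?case
  proof eventually_elim
    case (elim n)
    then show ?case using nint_add[of "comp_eval c n" "expansion_eval M n"] by simp
  qed
qed

lemma gp_expansion:
  assumes "gp d f"
  shows "(\<forall>c\<in>#expansion f. comp_nice F c) \<and> (\<forall>\<^sub>F n in F. gp_eval f n = expansion_eval (expansion f) n)"
  using assms
proof (induction rule: gp.induct)
  case (lower i f d)
  then show ?case by simp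
next
  case (mon d ps fs p0 a)
  let ?P = "\<lambda>f. (\<forall>c\<in>#expansion f. comp_nice F c) \<and> (\<forall>\<^sub>F n in F. gp_eval f n = expansion_eval (expansion f) n)"
  have fs: "\<forall>f\<in>set fs. ?P f"
    using mon.IH by (auto simp: list_all2_conv_all_nth in_set_conv_nth)
  have pos: "p0 > 0 \<or> fs \<noteq> []" using mon by auto
  have base: "comp_nice F (Comp a p0 {#})" if "p0 > 0"
    using that lead_term_monom[OF G, of "p0 - 1" a] by (simp add: comp_nice_def)
  have base0: "comp_const (Comp a p0 {#})" if "p0 = 0"
    using that by (simp add: comp_const_def)
  \<comment> \<open>For p0 = 0 the induction over \<open>fs\<close> starts from a constant, which
    the claim therefore admits for the empty list. In the end \<open>pos\<close>, a consequence of d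
    >= 1, excludes that case.\<close>
  have "(\<forall>c\<in>#expansion (GMon a p0 fs). comp_nice F c \<or> (comp_const c \<and> p0 = 0 \<and> fs = [])) \<and>
     (\<forall>\<^sub>F n in F. gp_eval (GMon a p0 fs) n = expansion_eval (expansion (GMon a p0 fs)) n)"
    using fs
  proof (induction fs)
    case Nil
    then show ?case using base base0 by auto
  next
    case (Cons f fs)
    let ?R = "expansion (GMon a p0 fs)"
    have eq: "expansion (GMon a p0 (f # fs)) = fsum_mult (image_mset comp_bracket (expansion f)) ?R" by simp
    have IH: "\<forall>c\<in>#?R. comp_nice F c \<or> comp_const c"
      "\<forall>\<^sub>F n in F. gp_eval (GMon a p0 fs) n = expansion_eval ?R n"
      using Cons by auto
    have f: "\<And>c. c \<in># expansion f \<Longrightarrow> comp_nice F c"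
      "\<forall>\<^sub>F n in F. gp_eval f n = expansion_eval (expansion f) n" using Cons.prems by auto
    have "comp_nice F c" if "c \<in># expansion (GMon a p0 (f # fs))" for c
      using that IH(1) f(1) unfolding eq in_fsum_mult
      by (auto intro!: comp_nice_mult comp_nice_bracket)
    moreover have b: "\<forall>\<^sub>F n in F. of_int (nint (expansion_eval (expansion f) n))
        = expansion_eval (image_mset comp_bracket (expansion f)) n"
      by (rule expansion_bracket) (rule f(1))
    have "\<forall>\<^sub>F n in F. gp_eval (GMon a p0 (f # fs)) n = expansion_eval (expansion (GMon a p0 (f # fs))) n"
      using IH(2) f(2) b
    proof eventually_elim
      case (elim n)
      have "gp_eval (GMon a p0 (f # fs)) n = of_int (nint (gp_eval f n)) * gp_eval (GMon a p0 fs) n"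
        by simp
      also have "\<dots> = expansion_eval (image_mset comp_bracket (expansion f)) n * expansion_eval ?R n"
        using elim by simp
      finally show ?case unfolding eq by simp
    qed
    ultimately show ?case by blast
  qed
  then show ?case using pos by auto
next
  case (br d f)
  then have f: "\<And>c. c \<in># expansion f \<Longrightarrow> comp_nice F c" by blast
  have b: "\<forall>\<^sub>F n in F. of_int (nint (expansion_eval (expansion f) n))
      = expansion_eval (image_mset comp_bracket (expansion f)) n"
    by (rule expansion_bracket) (rule f)
  have "\<forall>\<^sub>F n in F. gp_eval (GBr f) n = expansion_eval (expansion (GBr f)) n"
    using br.IH[THEN conjunct2] b by eventually_elim simp
  then show ?case using f by (auto intro: comp_nice_bracket)
next
  case (scale d f a)
  then have "\<forall>\<^sub>F n in F. gp_eval f n = expansion_eval (expansion f) n" by blast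
  then have "\<forall>\<^sub>F n in F. gp_eval (GScale a f) n = expansion_eval (expansion (GScale a f)) n"
    by eventually_elim simp
  then show ?case using scale by (auto intro: comp_nice_scale)
next
  case (add d f g)
  have "\<forall>\<^sub>F n in F. gp_eval (GAdd f g) n = expansion_eval (expansion (GAdd f g)) n"
    using add.IH(1)[THEN conjunct2] add.IH(2)[THEN conjunct2] by eventually_elim simp
  then show ?case using add by auto
qed

lemma expansion_lead_term:
  assumes "\<And>c. c \<in># M \<Longrightarrow> comp_nice F c \<and> comp_degree c \<le> D"
  shows "lead_term F D (expansion_eval M) (\<Sum>c\<in>#{#c \<in># M. comp_degree c = D#}. comp_coeff c)"
  using assms
proof (induction M)
  case empty
  then show ?case using lead_term_zero[OF G] by (simp add: expansion_eval_empty[abs_def])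
next
  case (add c M)
  have M: "lead_term F D (expansion_eval M) (\<Sum>c\<in>#{#c \<in># M. comp_degree c = D#}. comp_coeff c)"
    using add by simp
  have "lead_term F D (comp_eval c) (if comp_degree c = D then comp_coeff c else 0)"
    using add.prems[of c] lead_term_lift[OF G, of "comp_degree c" _ _ D] unfolding comp_nice_def by auto
  from lead_term_add[OF G this M] show ?case
    by (cases "comp_degree c = D") (simp_all add: expansion_eval_add_mset[abs_def])
qed

text \<open>Components below the maximal degree contribute 0 to the leading coefficient, so the
  formal sum of top coefficients is the true one.\<close>

lemma top_coeff_nondeg:
  assumes "\<And>c. c \<in># M \<Longrightarrow> comp_nice F c" and "top_coeff M \<noteq> 0"
  shows "nondeg F (expansion_eval M)"
proof -
  have M: "M \<noteq> {#}" using assms(2) by (auto simp: top_coeff_def)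
  have fin: "finite (comp_degree ` set_mset M)" "comp_degree ` set_mset M \<noteq> {}" using M by auto
  have "max_degree M \<in> comp_degree ` set_mset M" unfolding max_degree_def by (rule Max_in[OF fin])
  then obtain d where d: "max_degree M = Suc d"
    using assms(1) unfolding comp_nice_def by (metis Suc_pred imageE)
  have "lead_term F (max_degree M) (expansion_eval M) (\<Sum>c\<in>#{#c \<in># M. comp_degree c = max_degree M#}. comp_coeff c)"
    by (rule expansion_lead_term) (auto simp: assms max_degree_def fin)
  then show ?thesis
    unfolding nondeg_def using assms(2) M d by (auto simp: top_coeff_def)
qed

lemma expansion_eval_diff:
  "expansion_eval (diff_expansion p q) n = expansion_eval (expansion p) n - expansion_eval (expansion q) n"
proof -
  let ?A = "expansion p" and ?B = "expansion q"
  \<comment> \<open>On both sides the multiplicity is the maximum of the two. Hence cancelling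
    common components does not change the value of the difference.\<close>
  have "?A + (?B - ?A) = ?B + (?A - ?B)" by (rule multiset_eqI) simp
  then have "expansion_eval (?A + (?B - ?A)) n = expansion_eval (?B + (?A - ?B)) n" by simp
  then have "expansion_eval ?A n + expansion_eval (?B - ?A) n = expansion_eval ?B n + expansion_eval (?A - ?B) n"
    by simp
  then show ?thesis by (simp add: diff_expansion_def)
qed

lemma nondeg_cong: "\<forall>\<^sub>F n in F. f n = g n \<Longrightarrow> nondeg F f \<Longrightarrow> nondeg F g"
  unfolding nondeg_def using lead_term_cong[OF G] by blast

text \<open>Translates the formal conditions on A into growth along F; the PET induction then deals
  with integer-valued functions and no longer with expressions.\<close>

lemma IGP_nondeg:
  assumes p: "p \<in> IGP" "q \<in> IGP"
  shows "A_coeff p \<noteq> 0 \<Longrightarrow> nondeg F (\<lambda>n. of_int (igp_eval p n))"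
    and "A_diff p q \<noteq> 0 \<Longrightarrow> nondeg F (\<lambda>n. of_int (igp_eval p n - igp_eval q n))"
proof -
  obtain d e where "gp d p" "gp e q" using p by (auto simp: IGP_def intro: gp.br)
  then have P: "\<And>c. c \<in># expansion p \<Longrightarrow> comp_nice F c" "\<forall>\<^sub>F n in F. gp_eval p n = expansion_eval (expansion p) n"
    and Q: "\<And>c. c \<in># expansion q \<Longrightarrow> comp_nice F c" "\<forall>\<^sub>F n in F. gp_eval q n = expansion_eval (expansion q) n"
    using gp_expansion by blast+
  {
    assume "A_coeff p \<noteq> 0"
    then have 1: "nondeg F (expansion_eval (expansion p))"
      using top_coeff_nondeg[OF P(1)] by (simp add: A_coeff_def)
    have "\<forall>\<^sub>F n in F. expansion_eval (expansion p) n = of_int (igp_eval p n)"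
      using P(2) by eventually_elim (simp add: of_int_igp_eval p)
    from nondeg_cong[OF this 1] show "nondeg F (\<lambda>n. of_int (igp_eval p n))" .
  next
    assume "A_diff p q \<noteq> 0"
    have "comp_nice F c" if "c \<in># diff_expansion p q" for c
      using that P(1) Q(1) unfolding diff_expansion_def
      by (auto dest!: in_diffD intro: comp_nice_scale)
    then have 1: "nondeg F (expansion_eval (diff_expansion p q))"
      using top_coeff_nondeg \<open>A_diff p q \<noteq> 0\<close> by (simp add: A_diff_def)
    have "\<forall>\<^sub>F n in F. expansion_eval (diff_expansion p q) n = of_int (igp_eval p n - igp_eval q n)"
      using P(2) Q(2) by eventually_elim (simp add: of_int_igp_eval p expansion_eval_diff)
    from nondeg_cong[OF this 1] show "nondeg F (\<lambda>n. of_int (igp_eval p n - igp_eval q n))" .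
  }
qed

end

section \<open>Hitting times in weakly mixing minimal systems\<close>

lemma ziter_0 [simp]: "ziter T 0 = id"
  by (simp add: ziter_def)

lemma ziter_succ:
  assumes "bij T" shows "ziter T (n + 1) x = T (ziter T n x)"
proof (cases "n \<ge> 0")
  case True
  then have "nat (n + 1) = Suc (nat n)" by simp
  then show ?thesis using True by (simp add: ziter_def)
next
  case False
  then have n: "nat (- n) = Suc (nat (- (n + 1)))" by simp
  have "ziter T n x = inv T ((inv T ^^ nat (- (n + 1))) x)"
    using False n by (simp add: ziter_def del: minus_add_distrib)
  then have "T (ziter T n x) = (inv T ^^ nat (- (n + 1))) x"
    using assms by (simp add: bij_is_surj surj_f_inv_f)
  also have "\<dots> = ziter T (n + 1) x"
  proof (cases "n = -1")
    case False
    with \<open>\<not> 0 \<le> n\<close> have "\<not> 0 \<le> n + 1" by simp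
    then show ?thesis by (simp add: ziter_def del: minus_add_distrib)
  qed (simp add: ziter_def)
  finally show ?thesis by simp
qed

lemma ziter_pred:
  assumes "bij T" shows "ziter T (n - 1) x = inv T (ziter T n x)"
  using ziter_succ[OF assms, of "n - 1" x] assms by (simp add: bij_is_inj)

lemma ziter_add:
  assumes "bij T" shows "ziter T (m + n) x = ziter T m (ziter T n x)"
proof (induction m rule: int_induct[where k = 0])
  case base
  then show ?case by simp
next
  case (step1 i)
  have "ziter T (i + 1 + n) x = T (ziter T (i + n) x)"
    using ziter_succ[OF assms, of "i + n" x] by (simp add: algebra_simps)
  then show ?case using step1 ziter_succ[OF assms] by simp
next
  case (step2 i)
  have "ziter T (i - 1 + n) x = inv T (ziter T (i + n) x)"
    using ziter_pred[OF assms, of "i + n" x] by (simp add: algebra_simps)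
  then show ?case using step2 ziter_pred[OF assms] by simp
qed

lemma tds_bij: "tds T \<Longrightarrow> bij T"
  unfolding tds_def homeomorphism_def bij_def inj_on_def by (metis UNIV_I)

lemma tds_continuous:
  assumes "tds T" shows "continuous_on UNIV T" "continuous_on UNIV (inv T)"
proof -
  obtain S where S: "homeomorphism UNIV UNIV T S" using assms unfolding tds_def by blast
  then show "continuous_on UNIV T" by (simp add: homeomorphism_def)
  have "inv T = S" using S by (intro inv_equality) (auto simp: homeomorphism_def)
  then show "continuous_on UNIV (inv T)" using S by (simp add: homeomorphism_def)
qed

lemma continuous_on_funpow:
  fixes f :: "'a::topological_space \<Rightarrow> 'a"
  shows "continuous_on UNIV f \<Longrightarrow> continuous_on UNIV (f ^^ n)"
proof (induction n)
  case 0
  show ?case by (simp add: id_def continuous_on_id)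
next
  case (Suc n)
  then show ?case using continuous_on_compose[of UNIV "f ^^ n" f] by (auto intro: continuous_on_subset)
qed

lemma open_ziter_vimage:
  assumes "tds T" "open V" shows "open {x. ziter T n x \<in> V}"
proof -
  have "continuous_on UNIV (ziter T n)"
    unfolding ziter_def using tds_continuous[OF assms(1)] by (auto intro: continuous_on_funpow)
  from open_vimage[OF assms(2) this] show ?thesis by (simp add: vimage_def)
qed

section \<open>Hitting times and thickly syndetic sets\<close>

definition hitting_times :: "('a \<Rightarrow> 'a) \<Rightarrow> 'a set \<Rightarrow> 'a set \<Rightarrow> int set" where
  "hitting_times T A B = {n. \<exists>x\<in>A. ziter T n x \<in> B}"

text \<open>These sets are closed under finite intersections and meet every syndetic set. Syndetic
  sets have neither property, as the even and the odd integers show.\<close>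

definition thickly_syndetic :: "int set \<Rightarrow> bool" where
  "thickly_syndetic A \<longleftrightarrow> (\<forall>L::nat. syndetic {n. {n..n + int L} \<subseteq> A})"

lemma thickly_syndetic_mono: "thickly_syndetic A \<Longrightarrow> A \<subseteq> B \<Longrightarrow> thickly_syndetic B"
  unfolding thickly_syndetic_def by (meson syndetic_mono Collect_mono subset_trans)

lemma thickly_syndetic_UNIV [simp]: "thickly_syndetic UNIV"
  unfolding thickly_syndetic_def by (auto intro!: syndeticI[where L = 0])

text \<open>If intervals of length L inside B start in every window of length M, then each interval
  of length L + M inside A contains one of them.\<close>

lemma thickly_syndetic_Int:
  assumes A: "thickly_syndetic A" and B: "thickly_syndetic B"
  shows "thickly_syndetic (A \<inter> B)"
  unfolding thickly_syndetic_def
proof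
  fix L :: nat
  have "syndetic {n. {n..n + int L} \<subseteq> B}" using B unfolding thickly_syndetic_def by blast
  then obtain M where M: "M \<ge> 0" "\<And>n. \<exists>m\<in>{n. {n..n + int L} \<subseteq> B}. n \<le> m \<and> m \<le> n + M"
    by (rule syndeticE) blast
  have "syndetic {n. {n..n + int (L + nat M)} \<subseteq> A}" using A unfolding thickly_syndetic_def by blast
  then obtain K where K: "\<And>n. \<exists>m\<in>{n. {n..n + int (L + nat M)} \<subseteq> A}. n \<le> m \<and> m \<le> n + K"
    by (rule syndeticE) blast
  show "syndetic {n. {n..n + int L} \<subseteq> A \<inter> B}"
  proof (rule syndeticI[where L = "K + M"])
    fix n
    obtain i where i: "{i..i + int (L + nat M)} \<subseteq> A" "n \<le> i" "i \<le> n + K" using K[of n] by blast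
    obtain m where m: "{m..m + int L} \<subseteq> B" "i \<le> m" "m \<le> i + M" using M(2)[of i] by blast
    have "{m..m + int L} \<subseteq> {i..i + int (L + nat M)}" using m M(1) by auto
    then have "{m..m + int L} \<subseteq> A \<inter> B" using i m by blast
    then show "\<exists>m\<in>{n. {n..n + int L} \<subseteq> A \<inter> B}. n \<le> m \<and> m \<le> n + (K + M)"
      using i m by (intro bexI[of _ m]) auto
  qed
qed

lemma thickly_syndetic_INT:
  assumes "finite I" "\<And>i. i \<in> I \<Longrightarrow> thickly_syndetic (A i)"
  shows "thickly_syndetic (\<Inter>i\<in>I. A i)"
  using assms by (induction I) (auto intro: thickly_syndetic_Int)

lemma thickly_syndetic_meets:
  assumes "thickly_syndetic A" "syndetic G" shows "A \<inter> G \<noteq> {}"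
proof -
  obtain L where L: "L \<ge> 0" "\<And>n. \<exists>m\<in>G. n \<le> m \<and> m \<le> n + L" using syndeticE[OF assms(2)] by blast
  obtain n where n: "{n..n + int (nat L)} \<subseteq> A"
    using syndetic_nonempty assms(1) unfolding thickly_syndetic_def by blast
  obtain m where "m \<in> G" "n \<le> m" "m \<le> n + L" using L(2) by blast
  then show ?thesis using n L(1) by auto
qed

lemma thickly_syndetic_shift:
  assumes "thickly_syndetic A" shows "thickly_syndetic {n. n + c \<in> A}"
  unfolding thickly_syndetic_def
proof
  fix L :: nat
  have A: "syndetic {n. {n..n + int L} \<subseteq> A}" using assms unfolding thickly_syndetic_def by blast
  show "syndetic {n. {n..n + int L} \<subseteq> {n. n + c \<in> A}}"
  proof (rule syndetic_finite_shifts[of "{()}", OF _ A])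
    fix n assume n: "n \<in> {n. {n..n + int L} \<subseteq> A}"
    have "i + c \<in> A" if "i \<in> {n + - c..n + - c + int L}" for i
    proof -
      have "i + c \<in> {n..n + int L}" using that by auto
      then show ?thesis using n by blast
    qed
    then show "\<exists>j\<in>{()}. n + - c \<in> {n. {n..n + int L} \<subseteq> {n. n + c \<in> A}}" by blast
  qed simp
qed

lemma thickly_syndetic_uminus:
  assumes "thickly_syndetic A" shows "thickly_syndetic {n. - n \<in> A}"
  unfolding thickly_syndetic_def
proof
  fix L :: nat
  have A: "syndetic {n. {n..n + int L} \<subseteq> A}" using assms unfolding thickly_syndetic_def by blast
  obtain M where M: "\<And>n. \<exists>m\<in>{n. {n..n + int L} \<subseteq> A}. n \<le> m \<and> m \<le> n + M"
    using syndeticE[OF A] by blast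
  show "syndetic {n. {n..n + int L} \<subseteq> {n. - n \<in> A}}"
  proof (rule syndeticI[where L = M])
    fix n
    \<comment> \<open>Chosen so that the reflected interval, which starts at
      \<open>- m - int L\<close>, does so between n and n + M.\<close>
    obtain m where m: "{m..m + int L} \<subseteq> A" "- n - M - int L \<le> m" "m \<le> - n - M - int L + M"
      using M[of "- n - M - int L"] by blast
    have "- i \<in> A" if "i \<in> {- m - int L..- m - int L + int L}" for i
    proof -
      have "- i \<in> {m..m + int L}" using that by auto
      then show ?thesis using m by blast
    qed
    then show "\<exists>m\<in>{n. {n..n + int L} \<subseteq> {n. - n \<in> A}}. n \<le> m \<and> m \<le> n + M"
      using m by (intro bexI[of _ "- m - int L"]) auto
  qed
qed

text \<open>A function of degree 1 is known along the filter only up to a bounded distance K from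
  \<open>a * k\<close>. Demanding A for every integer in that range makes the condition depend on k
  alone.\<close>

lemma thickly_syndetic_affine_pos:
  fixes a K :: real
  assumes A: "thickly_syndetic A" and a: "a > 0" and K: "K \<ge> 0"
  shows "thickly_syndetic {k. \<forall>i. \<bar>of_int i - a * of_int k\<bar> \<le> K \<longrightarrow> i \<in> A}"
  unfolding thickly_syndetic_def
proof
  fix L :: nat
  \<comment> \<open>All i belonging to some k' in {k..k + L} lie within R of \<open>a * k\<close>.
    The required interval in A has length 2 * R, plus a for rounding k up to an integer.\<close>
  define R where "R = K + a * real L"
  have R0: "R \<ge> 0" using a K by (simp add: R_def)
  define L' where "L' = nat \<lceil>2 * R + a\<rceil>"
  have L': "2 * R + a \<le> real L'" unfolding L'_def by linarith
  have "syndetic {n. {n..n + int L'} \<subseteq> A}" using A unfolding thickly_syndetic_def by blast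
  then obtain M where M: "\<And>n. \<exists>m\<in>{n. {n..n + int L'} \<subseteq> A}. n \<le> m \<and> m \<le> n + M"
    by (rule syndeticE) blast
  define M' where "M' = \<lceil>(1 + of_int M + R) / a\<rceil> + 1"
  show "syndetic {n. {n..n + int L} \<subseteq> {k. \<forall>i. \<bar>of_int i - a * of_int k\<bar> \<le> K \<longrightarrow> i \<in> A}}"
  proof (rule syndeticI[where L = M'])
    fix k0 :: int
    obtain n where n: "{n..n + int L'} \<subseteq> A" "\<lceil>a * of_int k0\<rceil> \<le> n" "n \<le> \<lceil>a * of_int k0\<rceil> + M"
      using M[of "\<lceil>a * of_int k0\<rceil>"] by blast
    \<comment> \<open>The first integer k with \<open>a * k - R\<close> to the right of n.\<close>
    define k where "k = \<lceil>(of_int n + R) / a\<rceil>"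
    have "(of_int n + R) / a \<le> of_int k" "of_int k < (of_int n + R) / a + 1" unfolding k_def by linarith+
    then have k: "of_int n + R \<le> a * of_int k" "a * of_int k < of_int n + R + a"
      using a by (simp_all add: field_simps)
    have "of_int n \<ge> a * of_int k0" using n(2) by linarith
    then have "a * of_int k0 \<le> a * of_int k" using k(1) R0 by linarith
    then have 1: "k0 \<le> k" using a by simp
    have "of_int n \<le> a * of_int k0 + 1 + of_int M" using n(3) by linarith
    then have "(of_int n + R) / a \<le> (a * of_int k0 + 1 + of_int M + R) / a"
      using a by (intro divide_right_mono) auto
    also have "\<dots> = of_int k0 + (1 + of_int M + R) / a" using a by (simp add: field_simps)
    finally have 2: "k \<le> k0 + M'" unfolding k_def M'_def by linarith
    have "i \<in> A" if k': "k' \<in> {k..k + int L}" and i: "\<bar>of_int i - a * of_int k'\<bar> \<le> K" for k' i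
    proof -
      have "a * of_int k \<le> a * of_int k'" using k' a by simp
      moreover have "a * of_int k' \<le> a * (of_int k + real L)"
        using k' a by (intro mult_left_mono) auto
      ultimately have "\<bar>of_int i - a * of_int k\<bar> \<le> R"
        using i unfolding R_def distrib_left by linarith
      then have "of_int n \<le> real_of_int i" "real_of_int i \<le> of_int n + real L'"
        using k L' by linarith+
      then have "i \<in> {n..n + int L'}" by simp
      then show ?thesis using n(1) by blast
    qed
    then show "\<exists>m\<in>{n. {n..n + int L} \<subseteq> {k. \<forall>i. \<bar>of_int i - a * of_int k\<bar> \<le> K \<longrightarrow> i \<in> A}}. k0 \<le> m \<and> m \<le> k0 + M'"
      using 1 2 by (intro bexI[of _ k]) auto
  qed
qed

lemma thickly_syndetic_affine:
  fixes a K :: real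
  assumes A: "thickly_syndetic A" and a: "a \<noteq> 0" and K: "K \<ge> 0"
  shows "thickly_syndetic {k. \<forall>i. \<bar>of_int i - a * of_int k\<bar> \<le> K \<longrightarrow> i \<in> A}"
proof (cases "a > 0")
  case True
  then show ?thesis using thickly_syndetic_affine_pos A K by blast
next
  case False
  then have "thickly_syndetic {k. \<forall>i. \<bar>of_int i - (- a) * of_int k\<bar> \<le> K \<longrightarrow> i \<in> {n. - n \<in> A}}"
    using a by (intro thickly_syndetic_affine_pos thickly_syndetic_uminus A K) auto
  then show ?thesis
  proof (rule thickly_syndetic_mono, safe)
    fix k i
    assume k: "\<forall>i. \<bar>of_int i - (- a) * of_int k\<bar> \<le> K \<longrightarrow> i \<in> {n. - n \<in> A}"
      and i: "\<bar>of_int i - a * of_int k\<bar> \<le> K"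
    have "\<bar>of_int (- i) - (- a) * of_int k\<bar> \<le> K" using i by simp
    then show "i \<in> A" using k[rule_format, of "- i"] by simp
  qed
qed

section \<open>Hitting times under minimality and weak mixing\<close>

context
  fixes T :: "'a::metric_space \<Rightarrow> 'a"
  assumes T: "tds T" and minimal: "tds_minimal T" and mixing: "weakly_mixing T"
begin

lemma minimal_cover:
  assumes "open U" "U \<noteq> {}"
  obtains J :: "int set" where "finite J" "\<And>y. \<exists>j\<in>J. ziter T (- j) y \<in> U"
proof -
  have c: "compact (UNIV :: 'a set)" using T by (simp add: tds_def)
  have o: "open {y. ziter T (- j) y \<in> U}" for j using open_ziter_vimage[OF T assms(1)] .
  have u: "(UNIV :: 'a set) \<subseteq> (\<Union>j\<in>UNIV. {y. ziter T (- j) y \<in> U})"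
  proof
    fix y
    have "U \<inter> closure (range (\<lambda>n. ziter T n y)) \<noteq> {}"
      using minimal assms(2) by (simp add: tds_minimal_def)
    then have "U \<inter> range (\<lambda>n. ziter T n y) \<noteq> {}"
      using open_Int_closure_eq_empty[OF assms(1)] by blast
    then obtain n where "ziter T n y \<in> U" by blast
    then have "ziter T (- (- n)) y \<in> U" by simp
    then show "y \<in> (\<Union>j\<in>UNIV. {y. ziter T (- j) y \<in> U})" by blast
  qed
  obtain J where "finite J" "(UNIV :: 'a set) \<subseteq> (\<Union>j\<in>J. {y. ziter T (- j) y \<in> U})"
    by (rule compactE_image[OF c o u]) (use that in blast)
  then show ?thesis using that by blast
qed

lemma ziter_map_prod: "ziter (map_prod T T) n (x, y) = (ziter T n x, ziter T n y)"
proof -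
  have b: "bij T" by (rule tds_bij[OF T])
  have b2: "bij (map_prod T T)" using b by (simp add: bij_def map_prod_surj prod.inj_map)
  have i: "inv (map_prod T T) (x, y) = (inv T x, inv T y)" for x y
    using b by (intro inv_f_eq bij_is_inj[OF b2]) (simp add: bij_is_surj surj_f_inv_f)
  show ?thesis
  proof (induction n rule: int_induct[where k = 0])
    case base
    then show ?case by simp
  next
    case (step1 m)
    then show ?case by (simp add: ziter_succ[OF b] ziter_succ[OF b2])
  next
    case (step2 m)
    then show ?case by (simp add: ziter_pred[OF b] ziter_pred[OF b2] i)
  qed
qed

lemma weakly_mixing_hitting:
  assumes "open A" "A \<noteq> {}" "open B" "B \<noteq> {}" "open A'" "A' \<noteq> {}" "open B'" "B' \<noteq> {}"
  shows "hitting_times T A B \<inter> hitting_times T A' B' \<noteq> {}"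
proof -
  have "open (A \<times> A')" "A \<times> A' \<noteq> {}" "open (B \<times> B')" "B \<times> B' \<noteq> {}"
    using assms by (auto intro: open_Times)
  then have "\<exists>n. (A \<times> A') \<inter> ziter (map_prod T T) n -` (B \<times> B') \<noteq> {}"
    by (intro mixing[unfolded weakly_mixing_def tds_transitive_def, rule_format] conjI)
  then obtain n where "(A \<times> A') \<inter> ziter (map_prod T T) n -` (B \<times> B') \<noteq> {}" ..
  then obtain z where z: "z \<in> (A \<times> A') \<inter> ziter (map_prod T T) n -` (B \<times> B')"
    unfolding ex_in_conv[symmetric] by (rule exE)
  obtain x y where "z = (x, y)" by (cases z)
  then have "x \<in> A" "y \<in> A'" "ziter (map_prod T T) n (x, y) \<in> B \<times> B'"
    using IntD1[OF z] vimageD[OF IntD2[OF z]] by auto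
  then show ?thesis unfolding ziter_map_prod hitting_times_def by auto
qed

text \<open>
  Furstenberg's intersection lemma: one power of \<open>T\<close> meets both \<open>A, A'\<close> and \<open>B, B'\<close>, and it
  commutes with the others.
\<close>

lemma hitting_times_Int:
  assumes "open A" "A \<noteq> {}" "open B" "B \<noteq> {}" "open A'" "A' \<noteq> {}" "open B'" "B' \<noteq> {}"
  obtains U V where "open U" "U \<noteq> {}" "open V" "V \<noteq> {}"
    "hitting_times T U V \<subseteq> hitting_times T A B \<inter> hitting_times T A' B'"
proof -
  note add = ziter_add[OF tds_bij[OF T]]
  obtain n where n: "n \<in> hitting_times T A A'" "n \<in> hitting_times T B B'"
    using weakly_mixing_hitting[of A A' B B'] assms by blast
  define U where "U = A \<inter> {x. ziter T n x \<in> A'}"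
  define V where "V = B \<inter> {x. ziter T n x \<in> B'}"
  show ?thesis
  proof
    show "open U" "open V" unfolding U_def V_def using assms open_ziter_vimage[OF T] by auto
    show "U \<noteq> {}" "V \<noteq> {}" using n unfolding U_def V_def hitting_times_def by auto
    show "hitting_times T U V \<subseteq> hitting_times T A B \<inter> hitting_times T A' B'"
    proof
      fix m assume "m \<in> hitting_times T U V"
      then obtain x where x: "x \<in> U" "ziter T m x \<in> V" unfolding hitting_times_def by blast
      have "ziter T m (ziter T n x) = ziter T n (ziter T m x)"
        using add[of m n x] add[of n m x] by (simp add: add.commute)
      then have "ziter T n x \<in> A'" "ziter T m (ziter T n x) \<in> B'" "x \<in> A" "ziter T m x \<in> B"
        using x unfolding U_def V_def by auto
      then show "m \<in> hitting_times T A B \<inter> hitting_times T A' B'"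
        unfolding hitting_times_def by blast
    qed
  qed
qed

lemma hitting_times_INT:
  assumes "finite I" "open A" "A \<noteq> {}" "\<And>i. i \<in> I \<Longrightarrow> open (B i) \<and> B i \<noteq> {}"
  shows "\<exists>U V. open U \<and> U \<noteq> {} \<and> open V \<and> V \<noteq> {} \<and>
    hitting_times T U V \<subseteq> (\<Inter>i\<in>I. hitting_times T A (B i))"
  using assms(1,4)
proof (induction I)
  case empty
  show ?case using assms(2,3) by auto
next
  case (insert i I)
  then obtain U V where UV: "open U" "U \<noteq> {}" "open V" "V \<noteq> {}"
    "hitting_times T U V \<subseteq> (\<Inter>i\<in>I. hitting_times T A (B i))" by auto
  have "open (B i)" "B i \<noteq> {}" using insert.prems by auto
  then obtain U' V' where "open U'" "U' \<noteq> {}" "open V'" "V' \<noteq> {}"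
    "hitting_times T U' V' \<subseteq> hitting_times T U V \<inter> hitting_times T A (B i)"
    by (rule hitting_times_Int[OF UV(1-4) assms(2,3)]) blast
  then show ?case using UV(5) by (intro exI[of _ U'] exI[of _ V']) auto
qed

text \<open>By minimality a point of \<open>W\<close> returns to \<open>W\<close> with bounded gaps,
  and n0 steps after each return it is in V.\<close>

lemma hitting_times_syndetic:
  assumes "open U" "U \<noteq> {}" "open V" "V \<noteq> {}"
  shows "syndetic (hitting_times T U V)"
proof -
  note add = ziter_add[OF tds_bij[OF T]]
  obtain n0 where n0: "n0 \<in> hitting_times T U V" using weakly_mixing_hitting[of U V U V] assms by blast
  define W where "W = U \<inter> {x. ziter T n0 x \<in> V}"
  have W: "open W" "W \<noteq> {}"
    using n0 assms open_ziter_vimage[OF T] unfolding W_def hitting_times_def by auto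
  then obtain x where x: "x \<in> W" by blast
  obtain J where J: "finite J" "\<And>y. \<exists>j\<in>J. ziter T (- j) y \<in> W" using minimal_cover[OF W] by blast
  show ?thesis
  proof (rule syndetic_finite_shifts[OF J(1)])
    show "syndetic UNIV" by (auto intro!: syndeticI[where L = 0])
    fix n
    obtain j where j: "j \<in> J" "ziter T (- j) (ziter T n x) \<in> W" using J(2) by blast
    then have "ziter T (n0 + (- j + n)) x \<in> V" unfolding W_def by (simp add: add del: add_uminus_conv_diff uminus_add_conv_diff)
    moreover have "n0 + (- j + n) = n + (n0 - j)" by simp
    ultimately have "n + (n0 - j) \<in> hitting_times T U V"
      using x unfolding hitting_times_def W_def by (metis (mono_tags, lifting) IntE mem_Collect_eq)
    then show "\<exists>j\<in>J. n + (n0 - j) \<in> hitting_times T U V" using j by blast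
  qed
qed

text \<open>An interval starting at n consists of hitting times as soon as n hits the preimage of B
  under each of the powers 0, ..., L of T. These finitely many conditions contain the hitting times
  of a single pair of open sets.\<close>

lemma hitting_times_thickly_syndetic:
  assumes "open A" "A \<noteq> {}" "open B" "B \<noteq> {}"
  shows "thickly_syndetic (hitting_times T A B)"
  unfolding thickly_syndetic_def
proof
  note b = tds_bij[OF T]
  fix L :: nat
  have "open {x. ziter T i x \<in> B} \<and> {x. ziter T i x \<in> B} \<noteq> {}" for i
  proof -
    obtain y where "y \<in> B" using assms by blast
    then have "ziter T (- i) y \<in> {x. ziter T i x \<in> B}" using ziter_add[OF b, of i "- i" y] by simp
    then show ?thesis using open_ziter_vimage[OF T assms(3)] by blast
  qed
  then obtain U V where UV: "open U" "U \<noteq> {}" "open V" "V \<noteq> {}"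
    "hitting_times T U V \<subseteq> (\<Inter>i\<in>{0..int L}. hitting_times T A {x. ziter T i x \<in> B})"
    using hitting_times_INT[of "{0..int L}" A "\<lambda>i. {x. ziter T i x \<in> B}"] assms by auto
  show "syndetic {n. {n..n + int L} \<subseteq> hitting_times T A B}"
  proof (rule syndetic_mono[OF hitting_times_syndetic[OF UV(1-4)]], intro subsetI CollectI)
    fix n m assume n: "n \<in> hitting_times T U V" and m: "m \<in> {n..n + int L}"
    then have "n \<in> hitting_times T A {x. ziter T (m - n) x \<in> B}" using UV(5) by auto
    then obtain x where "x \<in> A" "ziter T (m - n) (ziter T n x) \<in> B" unfolding hitting_times_def by blast
    moreover have "ziter T m x = ziter T (m - n) (ziter T n x)" using ziter_add[OF b, of "m - n" n x] by simp
    ultimately show "m \<in> hitting_times T A B" unfolding hitting_times_def by force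
  qed
qed

end

section \<open>PET induction\<close>

text \<open>The first component is the degree minus 1, so it is 0 for functions of degree 1.\<close>

definition leading :: "int filter \<Rightarrow> (int \<Rightarrow> real) \<Rightarrow> nat \<times> real" where
  "leading F f = (SOME p. snd p \<noteq> 0 \<and> lead_term F (Suc (fst p)) f (snd p))"

lemma leadingI:
  assumes "good_filter F" "lead_term F (Suc d) f a" "a \<noteq> 0"
  shows "leading F f = (d, a)"
  unfolding leading_def
proof (rule some_equality)
  fix p assume "snd p \<noteq> 0 \<and> lead_term F (Suc (fst p)) f (snd p)"
  then show "p = (d, a)"
    using lead_term_unique[OF assms(1), of "fst p" f "snd p" d a] assms(2,3) by (cases p) auto
qed (use assms in simp)

lemma nondeg_leading:
  assumes "good_filter F" "nondeg F f"
  shows "lead_term F (Suc (fst (leading F f))) f (snd (leading F f))" "snd (leading F f) \<noteq> 0"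
  using assms leadingI[OF assms(1)] unfolding nondeg_def by (metis fst_conv snd_conv)+

lemma nondeg_minus:
  assumes "good_filter F" "nondeg F f" shows "nondeg F (\<lambda>n. - f n)"
  using assms(2) lead_term_minus[OF assms(1)] unfolding nondeg_def by (metis neg_equal_0_iff_equal)

lemma nondeg_diff_commute:
  assumes "good_filter F" "nondeg F (\<lambda>n. f n - g n)" shows "nondeg F (\<lambda>n. g n - f n)"
  using nondeg_minus[OF assms] by simp

text \<open>The translate is f plus a derivative of lower degree; in the PET step it therefore
  belongs to the class of f.\<close>

lemma lead_term_translate:
  assumes F: "good_filter F" and f: "lead_term F (Suc d) f a"
  shows "\<forall>\<^sub>F k in F. lead_term F (Suc d) (\<lambda>n. f (n + k) - f k) a"
  using lead_term_diff[OF f]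
proof eventually_elim
  case (elim k)
  then obtain c where "lead_term F d (\<lambda>n. f (n + k) - f n - f k) c" unfolding poly_like_def by blast
  then have "lead_term F (Suc d) (\<lambda>n. f (n + k) - f n - f k) 0" by (rule lead_term_lift[OF F]) simp
  from lead_term_add[OF F f this] show ?case by simp
qed

lemma nondeg_translate:
  assumes "good_filter F" "nondeg F f"
  shows "\<forall>\<^sub>F k in F. nondeg F (\<lambda>n. f (n + k) - f k)"
proof -
  obtain d a where "a \<noteq> 0" "lead_term F (Suc d) f a" using assms(2) unfolding nondeg_def by blast
  with lead_term_translate[OF assms(1) this(2)] show ?thesis
    unfolding nondeg_def by (auto elim!: eventually_mono)
qed

lemma lead_term_sub_nondeg:
  assumes F: "good_filter F" and f: "lead_term F (Suc d) f a" "a \<noteq> 0" and g: "lead_term F (Suc e) g b" "b \<noteq> 0"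
    and ne: "(d, a) \<noteq> (e, b)" and "e \<le> d"
  shows "lead_term F (Suc d) (\<lambda>n. f n - g n) (if d = e then a - b else a)"
  using lead_term_sub[OF F f(1) lead_term_lift[OF F g(1), of "Suc d"]] lead_term_sub[OF F f(1), of g b] g(1) assms(7)
  by auto

lemma nondeg_sub:
  assumes F: "good_filter F" and f: "lead_term F (Suc d) f a" "a \<noteq> 0" and g: "lead_term F (Suc e) g b" "b \<noteq> 0"
    and ne: "(d, a) \<noteq> (e, b)"
  shows "nondeg F (\<lambda>n. f n - g n)"
proof (cases "e \<le> d")
  case True
  have "(if d = e then a - b else a) \<noteq> 0" using ne f(2) by auto
  then show ?thesis using lead_term_sub_nondeg[OF F f g ne True] unfolding nondeg_def by blast
next
  case False
  then have "d \<le> e" "(e, b) \<noteq> (d, a)" using ne by auto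
  moreover have "(if e = d then b - a else b) \<noteq> 0" using ne g(2) by auto
  ultimately have "nondeg F (\<lambda>n. g n - f n)"
    using lead_term_sub_nondeg[OF F g f] unfolding nondeg_def by blast
  then show ?thesis by (rule nondeg_diff_commute[OF F])
qed

lemma nondeg_lower_degree:
  assumes F: "good_filter F" and f: "lead_term F (Suc d) f 0" and "nondeg F f"
  obtains e c where "e < d" "c \<noteq> 0" "lead_term F (Suc e) f c"
proof -
  obtain e c where e: "c \<noteq> 0" "lead_term F (Suc e) f c" using assms(3) unfolding nondeg_def by blast
  have "e < d"
  proof (rule ccontr)
    assume "\<not> e < d"
    then have "lead_term F (Suc e) f 0" using f lead_term_lift[OF F f, of "Suc e"] by (cases "e = d") auto
    then show False using lead_term_unique_coeff[OF F e(2)] e(1) by blast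
  qed
  then show ?thesis using that e by blast
qed

text \<open>Functions of different classes cause no difficulty, at any distance. In one class the
  top terms cancel and \<open>f - g\<close> has some coefficient c one degree below, where the
  derivatives by k and l contribute about \<open>(d + 2) * a * (k - l)\<close>. The case f = g is
  included to separate translates of one function.\<close>

lemma nondeg_translates:
  assumes F: "good_filter F"
    and f: "lead_term F (Suc (Suc d)) f a" "a \<noteq> 0" and g: "lead_term F (Suc (Suc e)) g b" "b \<noteq> 0"
    and fg: "f = g \<or> nondeg F (\<lambda>n. f n - g n)"
  obtains M P where "eventually P F"
    "\<And>k l. P k \<Longrightarrow> P l \<Longrightarrow> \<bar>k - l\<bar> \<ge> M \<Longrightarrow> nondeg F (\<lambda>n. (f (n + k) - f k) - (g (n + l) - g l))"
proof (cases "(d, a) = (e, b)")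
  case False
  define P where "P k \<longleftrightarrow> lead_term F (Suc (Suc d)) (\<lambda>n. f (n + k) - f k) a
      \<and> lead_term F (Suc (Suc e)) (\<lambda>n. g (n + k) - g k) b" for k
  have "eventually P F"
    unfolding P_def by (intro eventually_conj lead_term_translate[OF F] f g)
  moreover have "nondeg F (\<lambda>n. (f (n + k) - f k) - (g (n + l) - g l))" if "P k" "P l" for k l
    by (rule nondeg_sub[OF F, of "Suc d" _ a "Suc e" _ b])
      (use that False f(2) g(2) in \<open>auto simp: P_def\<close>)
  ultimately show ?thesis using that by blast
next
  case True
  have "\<exists>c. lead_term F (Suc d) (\<lambda>n. f n - g n) c"
  proof (cases "f = g")
    case True
    then show ?thesis using lead_term_zero[OF F] by auto
  next
    case False
    have z: "lead_term F (Suc (Suc d)) (\<lambda>n. f n - g n) 0"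
      using lead_term_sub[OF F f(1)] g(1) True by fastforce
    obtain i c where i: "i < Suc d" "lead_term F (Suc i) (\<lambda>n. f n - g n) c"
      using nondeg_lower_degree[OF F z] fg False by blast
    then show ?thesis using lead_term_lift[OF F i(2), of "Suc d"] by (cases "i = d") auto
  qed
  then obtain c where c: "lead_term F (Suc d) (\<lambda>n. f n - g n) c" by blast
  define D where "D f K k \<longleftrightarrow> (\<exists>c. lead_term F (Suc d) (\<lambda>n. f (n + k) - f n - f k) c \<and>
                      \<bar>c - (real d + 2) * a * of_int k\<bar> \<le> K)" for f :: "int \<Rightarrow> real" and K k
  obtain K where K: "eventually (D f K) F" using lead_term_diff_coeff[OF F f(1)] unfolding D_def by blast
  obtain L where L: "eventually (D g L) F"
    using lead_term_diff_coeff[OF F g(1)] True unfolding D_def by blast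
  \<comment> \<open>The contribution of the derivatives is exact up to \<open>K + L\<close>; it must
    outweigh this error and c.\<close>
  define M where "M = \<lceil>(K + L + \<bar>c\<bar>) / \<bar>a\<bar>\<rceil> + 1"
  have nd: "nondeg F (\<lambda>n. (f (n + k) - f k) - (g (n + l) - g l))"
    if k: "D f K k" and l: "D g L l" and kl: "\<bar>k - l\<bar> \<ge> M" for k l
  proof -
    obtain u where u: "lead_term F (Suc d) (\<lambda>n. f (n + k) - f n - f k) u" "\<bar>u - (real d + 2) * a * of_int k\<bar> \<le> K"
      using k unfolding D_def by blast
    obtain v where v: "lead_term F (Suc d) (\<lambda>n. g (n + l) - g n - g l) v" "\<bar>v - (real d + 2) * a * of_int l\<bar> \<le> L"
      using l unfolding D_def by blast
    have "lead_term F (Suc d) (\<lambda>n. (f n - g n) + ((f (n + k) - f n - f k) - (g (n + l) - g n - g l))) (c + (u - v))"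
      by (intro lead_term_add[OF F] lead_term_sub[OF F] c u v)
    then have 1: "lead_term F (Suc d) (\<lambda>n. (f (n + k) - f k) - (g (n + l) - g l)) (c + (u - v))"
      by (simp add: algebra_simps)
    have "(K + L + \<bar>c\<bar>) / \<bar>a\<bar> < real_of_int M" unfolding M_def by linarith
    also have "\<dots> \<le> \<bar>of_int k - of_int l\<bar>" using kl by linarith
    finally have "K + L + \<bar>c\<bar> < \<bar>a\<bar> * \<bar>of_int k - of_int l\<bar>"
      using f(2) by (simp add: divide_less_eq mult.commute)
    also have "\<dots> \<le> (real d + 2) * (\<bar>a\<bar> * \<bar>of_int k - of_int l\<bar>)"
    proof -
      have "1 * (\<bar>a\<bar> * \<bar>of_int k - of_int l :: real\<bar>) \<le> (real d + 2) * (\<bar>a\<bar> * \<bar>of_int k - of_int l\<bar>)"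
        by (intro mult_right_mono) auto
      then show ?thesis by simp
    qed
    also have "\<dots> = \<bar>(real d + 2) * a * (of_int k - of_int l)\<bar>" by (simp add: abs_mult)
    also have "(real d + 2) * a * (of_int k - of_int l) = (real d + 2) * a * of_int k - (real d + 2) * a * of_int l"
      by (simp add: algebra_simps)
    finally have "c + (u - v) \<noteq> 0" using u(2) v(2) by linarith
    then show ?thesis using 1 unfolding nondeg_def by blast
  qed
  show ?thesis
  proof (rule that[of "\<lambda>k. D f K k \<and> D g L k" M])
    show "\<forall>\<^sub>F k in F. D f K k \<and> D g L k" using K L by (rule eventually_conj)
  qed (use nd in blast)
qed

text \<open>E and E' are the classes before and after subtracting a function of class
  \<open>(d0, a0)\<close>, with d0 minimal. One occurrence of d0 is lost, and everything new lies
  below d0, which is a descent in the multiset order.\<close>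

lemma PET_weight_decreases:
  fixes E E' :: "(nat \<times> real) set"
  assumes fin: "finite E" "finite E'" and e0: "(d0, a0) \<in> E" and ge: "\<And>p. p \<in> E \<Longrightarrow> d0 \<le> fst p"
    and E': "\<And>p. p \<in> E' \<Longrightarrow> fst p < d0 \<or>
      (\<exists>d a. (d, a) \<in> E - {(d0, a0)} \<and> p = (d, if d = d0 then a - a0 else a))"
  shows "(image_mset fst (mset_set E'), image_mset fst (mset_set E)) \<in> mult less_than"
proof -
  \<comment> \<open>The effect of the subtraction on the other classes. As \<theta> is injective and
    keeps degrees, the classes in \<open>H\<close> are no more numerous in any degree than those
    remaining in E.\<close>
  define \<theta> where "\<theta> p = (fst p, if fst p = d0 then snd p - a0 else snd p)" for p :: "nat \<times> real"
  define H where "H = {p\<in>E'. d0 \<le> fst p}"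
  define L where "L = {p\<in>E'. fst p < d0}"
  have split: "E' = H \<union> L" "H \<inter> L = {}" unfolding H_def L_def by auto
  have finHL: "finite H" "finite L" unfolding H_def L_def using fin by auto
  have inj: "inj_on \<theta> (E - {(d0, a0)})" unfolding \<theta>_def inj_on_def by (auto simp: prod_eq_iff split: if_splits)
  have H: "H \<subseteq> \<theta> ` (E - {(d0, a0)})"
  proof
    fix p assume "p \<in> H"
    then obtain d a where "(d, a) \<in> E - {(d0, a0)}" "p = (d, if d = d0 then a - a0 else a)"
      using E' unfolding H_def by fastforce
    then show "p \<in> \<theta> ` (E - {(d0, a0)})" unfolding \<theta>_def by force
  qed
  define M0 where "M0 = image_mset fst (mset_set (E - {(d0, a0)}))"
  have "mset_set H \<subseteq># mset_set (\<theta> ` (E - {(d0, a0)}))"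
    by (rule subset_imp_msubset_mset_set[OF H]) (use fin in auto)
  then have "image_mset fst (mset_set H) \<subseteq># image_mset fst (mset_set (\<theta> ` (E - {(d0, a0)})))"
    by (rule image_mset_subseteq_mono)
  also have "\<dots> = M0"
    unfolding M0_def image_mset_mset_set[OF inj, symmetric] by (simp add: multiset.map_comp comp_def \<theta>_def)
  finally have sub: "image_mset fst (mset_set H) \<subseteq># M0" .
  let ?I = "image_mset fst (mset_set H)" and ?K = "image_mset fst (mset_set L)"
  have "mset_set E' = mset_set H + mset_set L"
    unfolding split(1) by (rule mset_set_Union[OF finHL split(2)])
  then have 1: "image_mset fst (mset_set E') = ?I + ?K" by simp
  have "mset_set E = add_mset (d0, a0) (mset_set (E - {(d0, a0)}))"
    using mset_set.insert_remove[OF fin(1), of "(d0, a0)"] e0 by (simp add: insert_absorb)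
  then have "image_mset fst (mset_set E) = add_mset d0 M0" by (simp add: M0_def)
  also have "\<dots> = ?I + add_mset d0 (M0 - ?I)" using sub by simp
  finally have 2: "image_mset fst (mset_set E) = ?I + add_mset d0 (M0 - ?I)" .
  show ?thesis
    unfolding 1 2
    by (rule one_step_implies_mult) (use finHL in \<open>auto simp: L_def\<close>)
qed

abbreviation (input) realf :: "(int \<Rightarrow> int) \<Rightarrow> int \<Rightarrow> real" where
  "realf q \<equiv> \<lambda>n. real_of_int (q n)"

text \<open>Every function is paired with its target. For a good filter the last condition forbids
  one function with two targets, since the zero function is degenerate.\<close>

definition PET_family :: "int filter \<Rightarrow> ((int \<Rightarrow> int) \<times> 'a::topological_space set) set \<Rightarrow> bool" where
  "PET_family F Q \<longleftrightarrow> finite Q \<and>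
     (\<forall>x\<in>Q. open (snd x) \<and> snd x \<noteq> {} \<and> nondeg F (realf (fst x))) \<and>
     (\<forall>x\<in>Q. \<forall>y\<in>Q. x \<noteq> y \<longrightarrow> nondeg F (\<lambda>n. realf (fst x) n - realf (fst y) n))"

text \<open>The image is a set, so functions of equal degree and leading coefficient are counted
  once.\<close>

definition PET_weight :: "int filter \<Rightarrow> ((int \<Rightarrow> int) \<times> 'a set) set \<Rightarrow> nat multiset" where
  "PET_weight F Q = image_mset fst (mset_set ((\<lambda>x. leading F (realf (fst x))) ` Q))"

section \<open>Choice of the translations and the induction step\<close>

context
  fixes T :: "'a::metric_space \<Rightarrow> 'a" and F :: "int filter"
  assumes T: "tds T" and minimal: "tds_minimal T" and mixing: "weakly_mixing T" and F: "good_filter F"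
begin

lemma open_ziter_INT:
  assumes "finite J" "open V"
  shows "open {z. \<forall>j\<in>J. ziter T (m j) z \<in> V}"
proof -
  have "{z. \<forall>j\<in>J. ziter T (m j) z \<in> V} = (\<Inter>j\<in>J. {z. ziter T (m j) z \<in> V})" by auto
  then show ?thesis using assms open_ziter_vimage[OF T] by auto
qed

text \<open>The translations are chosen one after another. \<open>W x\<close> is the open set of
  points meeting the demands so far; the next translation l must make \<open>fst x l - i\<close> a
  hitting time from \<open>W x\<close> to \<open>snd x\<close>, for all x at once.\<close>

lemma choose_translations:
  fixes Q1 :: "((int \<Rightarrow> int) \<times> 'a set) set"
  assumes J: "finite J" and Q1: "finite Q1"
    and lin: "\<And>x. x \<in> Q1 \<Longrightarrow> open (snd x) \<and> snd x \<noteq> {} \<and> a x \<noteq> 0 \<and> lead_term F 1 (realf (fst x)) (a x)"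
    and P: "eventually P F"
  shows "\<exists>k. (\<forall>j\<in>J. P (k j)) \<and> (\<forall>j\<in>J. \<forall>i\<in>J. i \<noteq> j \<longrightarrow> \<bar>k i - k j\<bar> \<ge> M) \<and>
     (\<forall>x\<in>Q1. {z. \<forall>j\<in>J. ziter T (fst x (k j) - j) z \<in> snd x} \<noteq> {})"
  using J
proof (induction J)
  case empty
  show ?case by auto
next
  case (insert i J)
  then obtain k where k: "\<forall>j\<in>J. P (k j)" "\<forall>j\<in>J. \<forall>i\<in>J. i \<noteq> j \<longrightarrow> \<bar>k i - k j\<bar> \<ge> M"
     "\<forall>x\<in>Q1. {z. \<forall>j\<in>J. ziter T (fst x (k j) - j) z \<in> snd x} \<noteq> {}" by blast
  define W where "W x = {z. \<forall>j\<in>J. ziter T (fst x (k j) - j) z \<in> snd x}" for x :: "(int \<Rightarrow> int) \<times> 'a set"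
  have W: "open (W x)" "W x \<noteq> {}" if "x \<in> Q1" for x
  proof -
    show "open (W x)" unfolding W_def by (rule open_ziter_INT) (use insert.hyps(1) lin[OF that] in auto)
    show "W x \<noteq> {}" using k(3) that unfolding W_def by blast
  qed
  have "\<exists>K\<ge>0. \<forall>\<^sub>F n in F. \<bar>realf (fst x) n - a x * of_int n\<bar> \<le> K" if "x \<in> Q1" for x
  proof -
    have "lead_term F (Suc 0) (realf (fst x)) (a x)" using lin[OF that] by simp
    then show ?thesis by (rule lead_term_bound) auto
  qed
  then obtain K where K: "\<And>x. x \<in> Q1 \<Longrightarrow> K x \<ge> 0 \<and> (\<forall>\<^sub>F n in F. \<bar>realf (fst x) n - a x * of_int n\<bar> \<le> K x)"
    by metis
  \<comment> \<open>Asking for all integers near \<open>a x * l\<close> makes \<open>A x\<close>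
    thickly syndetic. This strength is needed because the filter condition on l is only known to be
    syndetic.\<close>
  define A where "A x = {l. \<forall>m::int. \<bar>of_int m - a x * of_int l\<bar> \<le> K x \<longrightarrow> m + - i \<in> hitting_times T (W x) (snd x)}"
    for x :: "(int \<Rightarrow> int) \<times> 'a set"
  have TS: "thickly_syndetic (\<Inter>x\<in>Q1. A x)"
  proof (rule thickly_syndetic_INT[OF Q1])
    fix x assume x: "x \<in> Q1"
    have "thickly_syndetic {m. m + - i \<in> hitting_times T (W x) (snd x)}"
      using W[OF x] lin[OF x]
      by (intro thickly_syndetic_shift hitting_times_thickly_syndetic[OF T minimal mixing]) auto
    from thickly_syndetic_affine[OF this, of "a x" "K x"] show "thickly_syndetic (A x)"
      using lin[OF x] K[OF x] by (simp add: A_def)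
  qed
  have "\<forall>\<^sub>F l in F. P l \<and> (\<forall>j\<in>J. \<bar>l - k j\<bar> \<ge> M) \<and> (\<forall>x\<in>Q1. \<bar>realf (fst x) l - a x * of_int l\<bar> \<le> K x)"
  proof (intro eventually_conj P eventually_ball_finite insert.hyps(1) Q1 ballI)
    fix j assume "j \<in> J"
    show "\<forall>\<^sub>F l in F. \<bar>l - k j\<bar> \<ge> M"
      using good_filter_large[OF F, of "M + \<bar>k j\<bar>"] by eventually_elim linarith
  qed (use K in blast)
  from thickly_syndetic_meets[OF TS good_filter_syndetic[OF F this]]
  obtain l where l: "\<forall>x\<in>Q1. l \<in> A x" "P l" "\<forall>j\<in>J. \<bar>l - k j\<bar> \<ge> M"
    "\<forall>x\<in>Q1. \<bar>realf (fst x) l - a x * of_int l\<bar> \<le> K x" by blast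
  have hit: "fst x l - i \<in> hitting_times T (W x) (snd x)" if "x \<in> Q1" for x
    using l(1,4) that unfolding A_def by auto
  define k' where "k' = k(i := l)"
  have k': "k' i = l" "\<And>j. j \<in> J \<Longrightarrow> k' j = k j" using insert.hyps(2) by (auto simp: k'_def)
  show ?case
  proof (intro exI[of _ k'] conjI ballI impI)
    fix j assume "j \<in> insert i J"
    then show "P (k' j)" using k' k(1) l(2) by auto
  next
    fix j j' assume "j \<in> insert i J" "j' \<in> insert i J" "j' \<noteq> j"
    then show "\<bar>k' j' - k' j\<bar> \<ge> M"
      using k' k(2) l(3) by (auto simp: abs_minus_commute)
  next
    fix x assume x: "x \<in> Q1"
    obtain z where "z \<in> W x" "ziter T (fst x l - i) z \<in> snd x"
      using hit[OF x] unfolding hitting_times_def by blast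
    then have "z \<in> {z. \<forall>j\<in>insert i J. ziter T (fst x (k' j) - j) z \<in> snd x}"
      using k' unfolding W_def by auto
    then show "{z. \<forall>j\<in>insert i J. ziter T (fst x (k' j) - j) z \<in> snd x} \<noteq> {}" by blast
  qed
qed

theorem PET_syndetic:
  fixes Q :: "((int \<Rightarrow> int) \<times> 'a set) set"
  assumes "PET_family F Q" "open U" "U \<noteq> {}" "eventually C F"
  shows "syndetic {n. C n \<and> (\<exists>x\<in>U. \<forall>q\<in>Q. ziter T (fst q n) x \<in> snd q)}"
proof -
  note add = ziter_add[OF tds_bij[OF T]]
  have wf: "wf (inv_image (mult less_than) (PET_weight F :: ((int \<Rightarrow> int) \<times> 'a set) set \<Rightarrow> _))"
    by (intro wf_inv_image wf_mult wf_less_than)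
  show ?thesis
    using assms
  proof (induction Q arbitrary: U C rule: wf_induct_rule[OF wf])
    case (1 Q)
    note IH = "1.IH" and U = "1.prems"(2,3) and C = "1.prems"(4)
    have finQ: "finite Q"
      and Q: "\<And>x. x \<in> Q \<Longrightarrow> open (snd x) \<and> snd x \<noteq> {} \<and> nondeg F (realf (fst x))"
      and Qdiff: "\<And>x y. x \<in> Q \<Longrightarrow> y \<in> Q \<Longrightarrow> x \<noteq> y \<Longrightarrow> nondeg F (\<lambda>n. realf (fst x) n - realf (fst y) n)"
      using "1.prems"(1) unfolding PET_family_def by blast+
    show ?case
    proof (cases "Q = {}")
      case True
      have "\<exists>x. x \<in> U" using U by blast
      then show ?thesis using good_filter_syndetic[OF F C] True by simp
    next
      case False
      obtain J :: "int set" where J: "finite J" "\<And>y. \<exists>j\<in>J. ziter T (- j) y \<in> U"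
        using minimal_cover[OF T minimal mixing U] by blast
      obtain j0 where j0: "j0 \<in> J" using J(2) by blast
      define deg where "deg x = fst (leading F (realf (fst x)))" for x :: "(int \<Rightarrow> int) \<times> 'a set"
      define lc where "lc x = snd (leading F (realf (fst x)))" for x :: "(int \<Rightarrow> int) \<times> 'a set"
      have ld: "lead_term F (Suc (deg x)) (realf (fst x)) (lc x)" "lc x \<noteq> 0" if "x \<in> Q" for x
        using nondeg_leading[OF F, of "realf (fst x)"] Q[OF that] unfolding deg_def lc_def by auto
      \<comment> \<open>\<open>Q1\<close> holds the functions of degree 1, because
        \<open>leading\<close> counts from 0.\<close>
      define Q1 where "Q1 = {x\<in>Q. deg x = 0}"
      define Q2 where "Q2 = {x\<in>Q. deg x \<noteq> 0}"
      have fin12: "finite Q1" "finite Q2" unfolding Q1_def Q2_def using finQ by auto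
      have sub12: "Q1 \<subseteq> Q" "Q2 \<subseteq> Q" unfolding Q1_def Q2_def by auto
      define sep where "sep x y M P \<longleftrightarrow> eventually P F \<and> (\<forall>k l. P k \<longrightarrow> P l \<longrightarrow> \<bar>k - l\<bar> \<ge> M \<longrightarrow>
              nondeg F (\<lambda>n. (realf (fst x) (n + k) - realf (fst x) k) - (realf (fst y) (n + l) - realf (fst y) l)))"
        for x y :: "(int \<Rightarrow> int) \<times> 'a set" and M P
      have "\<exists>M P. sep x y M P" if xy: "x \<in> Q2" "y \<in> Q2" for x y
      proof -
        obtain d e where de: "deg x = Suc d" "deg y = Suc e"
          using xy unfolding Q2_def by (metis (mono_tags, lifting) mem_Collect_eq not0_implies_Suc)
        have x: "lead_term F (Suc (Suc d)) (realf (fst x)) (lc x)" "lc x \<noteq> 0"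
          and y: "lead_term F (Suc (Suc e)) (realf (fst y)) (lc y)" "lc y \<noteq> 0"
          using ld[of x] ld[of y] xy sub12 de by auto
        have "realf (fst x) = realf (fst y) \<or> nondeg F (\<lambda>n. realf (fst x) n - realf (fst y) n)"
          using Qdiff[of x y] xy sub12 by blast
        then show ?thesis unfolding sep_def by (rule nondeg_translates[OF F x y]) blast
      qed
      then obtain M P where "\<And>x y. x \<in> Q2 \<Longrightarrow> y \<in> Q2 \<Longrightarrow> sep x y (M x y) (P x y)" by metis
      then have MP: "\<And>x y. x \<in> Q2 \<Longrightarrow> y \<in> Q2 \<Longrightarrow> eventually (P x y) F"
        "\<And>x y k l. x \<in> Q2 \<Longrightarrow> y \<in> Q2 \<Longrightarrow> P x y k \<Longrightarrow> P x y l \<Longrightarrow> \<bar>k - l\<bar> \<ge> M x y \<Longrightarrow>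
              nondeg F (\<lambda>n. (realf (fst x) (n + k) - realf (fst x) k) - (realf (fst y) (n + l) - realf (fst y) l))"
        unfolding sep_def by blast+
      define M0 where "M0 = Max (insert 0 ((\<lambda>(x, y). M x y) ` (Q2 \<times> Q2)))"
      have M0: "M x y \<le> M0" if "x \<in> Q2" "y \<in> Q2" for x y
        unfolding M0_def using fin12 that by (intro Max_ge) auto
      \<comment> \<open>The demands on a single translation. For \<open>Q1\<close> additivity is
        exact, as the derivative has degree 0 and so vanishes along F.\<close>
      define good where "good k \<longleftrightarrow> (\<forall>\<^sub>F n in F. C (n + k)) \<and>
        (\<forall>x\<in>Q. lead_term F (Suc (deg x)) (\<lambda>n. realf (fst x) (n + k) - realf (fst x) k) (lc x)) \<and>
        (\<forall>x\<in>Q1. \<forall>\<^sub>F n in F. fst x (n + k) = fst x n + fst x k) \<and>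
        (\<forall>x\<in>Q. \<forall>y\<in>Q. x \<noteq> y \<longrightarrow> nondeg F (\<lambda>n. (realf (fst x) (n + k) - realf (fst y) (n + k)) - (realf (fst x) k - realf (fst y) k))) \<and>
        (\<forall>x\<in>Q2. \<forall>y\<in>Q2. P x y k)" for k
      have "eventually good F"
        unfolding good_def
      proof (intro eventually_conj eventually_ball_finite finQ fin12 ballI)
        show "\<forall>\<^sub>F k in F. \<forall>\<^sub>F n in F. C (n + k)" by (rule good_filter_shift[OF F C])
      next
        fix x assume "x \<in> Q"
        then show "\<forall>\<^sub>F k in F. lead_term F (Suc (deg x)) (\<lambda>n. realf (fst x) (n + k) - realf (fst x) k) (lc x)"
          using lead_term_translate[OF F] ld by blast
      next
        fix x assume "x \<in> Q1"
        then have "lead_term F (Suc 0) (realf (fst x)) (lc x)" using ld(1)[of x] unfolding Q1_def by simp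
        from lead_term_diff[OF this]
        show "\<forall>\<^sub>F k in F. \<forall>\<^sub>F n in F. fst x (n + k) = fst x n + fst x k"
        proof eventually_elim
          case (elim k)
          then have "\<forall>\<^sub>F n in F. realf (fst x) (n + k) - realf (fst x) n - realf (fst x) k = 0"
            by (simp add: poly_like_def)
          then show ?case by eventually_elim linarith
        qed
      next
        fix x y assume xy: "x \<in> Q" "y \<in> Q"
        show "\<forall>\<^sub>F k in F. x \<noteq> y \<longrightarrow> nondeg F (\<lambda>n. (realf (fst x) (n + k) - realf (fst y) (n + k)) - (realf (fst x) k - realf (fst y) k))"
          using nondeg_translate[OF F Qdiff[OF xy]] by (cases "x = y") auto
      qed (use MP(1) in blast)
      have lin: "open (snd x) \<and> snd x \<noteq> {} \<and> lc x \<noteq> 0 \<and> lead_term F 1 (realf (fst x)) (lc x)"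
        if "x \<in> Q1" for x
        using that Q[of x] ld[of x] unfolding Q1_def by simp
      obtain k where k: "(\<forall>j\<in>J. good (k j)) \<and> (\<forall>j\<in>J. \<forall>i\<in>J. i \<noteq> j \<longrightarrow> \<bar>k i - k j\<bar> \<ge> M0) \<and>
          (\<forall>x\<in>Q1. {z. \<forall>j\<in>J. ziter T (fst x (k j) - j) z \<in> snd x} \<noteq> {})"
        using choose_translations[OF J(1) fin12(1) lin \<open>eventually good F\<close>, of M0] by (rule exE)
      then have good: "good (k j)" if "j \<in> J" for j using that by blast
      have far: "\<bar>k i - k j\<bar> \<ge> M0" if "i \<in> J" "j \<in> J" "i \<noteq> j" for i j
        using k[THEN conjunct2, THEN conjunct1] that by blast
      have ne: "{z. \<forall>j\<in>J. ziter T (fst x (k j) - j) z \<in> snd x} \<noteq> {}" if "x \<in> Q1" for x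
        using k[THEN conjunct2, THEN conjunct2] that by (rule bspec)
      \<comment> \<open>The constant \<open>fst x (k j)\<close> and the shift by j go into the
        target, so that the function is again without constant term.\<close>
      define \<phi> where "\<phi> x j = (\<lambda>n. fst x (n + k j) - fst x (k j), {z. ziter T (fst x (k j) - j) z \<in> snd x})"
        for x :: "(int \<Rightarrow> int) \<times> 'a set" and j
      \<comment> \<open>In degree 1 the functions for all j agree with \<open>fst x\<close> along F;
        a single pair is kept, with the intersection of the targets.\<close>
      define \<psi> where "\<psi> x = (fst x, {z. \<forall>j\<in>J. ziter T (fst x (k j) - j) z \<in> snd x})" for x :: "(int \<Rightarrow> int) \<times> 'a set"
      define R where "R x = (if deg x = 0 then {\<psi> x} else \<phi> x ` J)" for x :: "(int \<Rightarrow> int) \<times> 'a set"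
      define Q' where "Q' = (\<Union>x\<in>Q. R x)"
      have finQ': "finite Q'" unfolding Q'_def R_def using finQ J(1) by auto
      have openR: "open (snd r) \<and> snd r \<noteq> {}" if xr: "x \<in> Q" "r \<in> R x" for x r
      proof (cases "deg x = 0")
        case True
        then have "x \<in> Q1" "r = \<psi> x" using xr unfolding Q1_def R_def by auto
        then show ?thesis using ne[of x] open_ziter_INT[OF J(1)] Q[OF xr(1)] unfolding \<psi>_def by auto
      next
        case False
        then obtain j where r: "r = \<phi> x j" using xr unfolding R_def by auto
        obtain v where "v \<in> snd x" using Q[OF xr(1)] by blast
        then have "ziter T (- (fst x (k j) - j)) v \<in> snd r"
          using add[of "fst x (k j) - j" "- (fst x (k j) - j)" v] unfolding r \<phi>_def by simp
        then show ?thesis using open_ziter_vimage[OF T] Q[OF xr(1)] unfolding r \<phi>_def by auto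
      qed
      have ldR: "lead_term F (Suc (deg x)) (realf (fst r)) (lc x)" if xr: "x \<in> Q" "r \<in> R x" for x r
      proof (cases "deg x = 0")
        case True
        then show ?thesis using xr ld[OF xr(1)] unfolding R_def \<psi>_def by auto
      next
        case False
        then obtain j where j: "j \<in> J" "r = \<phi> x j" using xr unfolding R_def by auto
        then show ?thesis using good[OF j(1)] xr(1) unfolding good_def \<phi>_def by auto
      qed
      have ndQ': "nondeg F (\<lambda>n. realf (fst r) n - realf (fst s) n)"
        if rs: "x \<in> Q" "r \<in> R x" "y \<in> Q" "s \<in> R y" "r \<noteq> s" for x y r s
      proof (cases "(deg x, lc x) = (deg y, lc y)")
        case False
        show ?thesis
          by (rule nondeg_sub[OF F ldR[OF rs(1,2)] _ ldR[OF rs(3,4)] _ False]) (use ld rs in auto)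
      next
        case deg: True
        show ?thesis
        proof (cases "deg x = 0")
          case True
          then show ?thesis using rs deg Qdiff[of x y] unfolding R_def \<psi>_def by auto
        next
          case False
          then obtain i j where ij: "i \<in> J" "j \<in> J" "r = \<phi> x i" "s = \<phi> y j"
            using rs deg unfolding R_def by auto
          show ?thesis
          proof (cases "i = j")
            case True
            then have "x \<noteq> y" using rs(5) ij by auto
            then have "nondeg F (\<lambda>n. (realf (fst x) (n + k j) - realf (fst y) (n + k j)) - (realf (fst x) (k j) - realf (fst y) (k j)))"
              using good[OF ij(2)] rs(1,3) unfolding good_def by blast
            then show ?thesis unfolding ij True \<phi>_def by (simp add: algebra_simps)
          next
            \<comment> \<open>Here x = y is possible: only the distance between the translations
              keeps the two functions apart.\<close>
            case ne: False
            have x2: "x \<in> Q2" "y \<in> Q2" using rs False deg unfolding Q2_def by auto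
            have "P x y (k i)" "P x y (k j)" using good ij x2 unfolding good_def by blast+
            moreover have "M x y \<le> \<bar>k i - k j\<bar>" using far[OF ij(1,2) ne] M0[OF x2] by linarith
            ultimately have "nondeg F (\<lambda>n. (realf (fst x) (n + k i) - realf (fst x) (k i)) - (realf (fst y) (n + k j) - realf (fst y) (k j)))"
              by (rule MP(2)[OF x2])
            then show ?thesis unfolding ij \<phi>_def by simp
          qed
        qed
      qed
      obtain x0 where x0: "x0 \<in> Q" "\<And>x. x \<in> Q \<Longrightarrow> deg x0 \<le> deg x"
        using ex_min_if_finite[of "deg ` Q"] finQ False by (metis (no_types, lifting) arg_min_if_finite(1) arg_min_least)
      have "R x0 \<noteq> {}" unfolding R_def using j0 by auto
      then obtain b where b: "b \<in> R x0" by blast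
      \<comment> \<open>The pair \<open>b\<close> becomes the source: in terms of the image x of y
        under the power \<open>fst b n\<close>, its condition reads x \<in> \<open>snd b\<close>,
        and every other function is diminished by \<open>fst b\<close>.\<close>
      define Q'' where "Q'' = (\<lambda>r. (\<lambda>n. fst r n - fst b n, snd r)) ` (Q' - {b})"
      have ndb: "nondeg F (\<lambda>n. realf (fst r) n - realf (fst b) n)" if "x \<in> Q" "r \<in> R x" "r \<noteq> b" for x r
        using ndQ'[OF that(1,2) x0(1) b that(3)] .
      have fam: "PET_family F Q''"
        unfolding PET_family_def
      proof (intro conjI ballI impI)
        show "finite Q''" unfolding Q''_def using finQ' by auto
      next
        fix q assume "q \<in> Q''"
        then obtain r x where q: "x \<in> Q" "r \<in> R x" "r \<noteq> b" "q = (\<lambda>n. fst r n - fst b n, snd r)"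
          unfolding Q''_def Q'_def by auto
        show "open (snd q)" "snd q \<noteq> {}" using openR[OF q(1,2)] q(4) by auto
        show "nondeg F (realf (fst q))" using ndb[OF q(1-3)] q(4) by simp
      next
        fix q q' assume qq: "q \<in> Q''" "q' \<in> Q''" and neq: "q \<noteq> q'"
        obtain r where r: "r \<in> Q'" "q = (\<lambda>n. fst r n - fst b n, snd r)"
          using qq(1) unfolding Q''_def by blast
        obtain r' where r': "r' \<in> Q'" "q' = (\<lambda>n. fst r' n - fst b n, snd r')"
          using qq(2) unfolding Q''_def by blast
        obtain x x' where x: "x \<in> Q" "r \<in> R x" "x' \<in> Q" "r' \<in> R x'"
          using r(1) r'(1) unfolding Q'_def by blast
        have "r \<noteq> r'" using neq r(2) r'(2) by blast
        from ndQ'[OF x this] show "nondeg F (\<lambda>n. realf (fst q) n - realf (fst q') n)"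
          unfolding r(2) r'(2) by simp
      qed
      have less: "(PET_weight F Q'', PET_weight F Q) \<in> mult less_than"
        unfolding PET_weight_def
      proof (rule PET_weight_decreases)
        show "finite ((\<lambda>x. leading F (realf (fst x))) ` Q)" using finQ by simp
        show "finite ((\<lambda>x. leading F (realf (fst x))) ` Q'')" using fam unfolding PET_family_def by simp
        show "(deg x0, lc x0) \<in> (\<lambda>x. leading F (realf (fst x))) ` Q" using x0(1) unfolding deg_def lc_def by auto
        show "deg x0 \<le> fst p" if "p \<in> (\<lambda>x. leading F (realf (fst x))) ` Q" for p
          using that x0(2) unfolding deg_def by auto
      next
        fix p assume "p \<in> (\<lambda>x. leading F (realf (fst x))) ` Q''"
        then obtain q where q: "q \<in> Q''" "p = leading F (realf (fst q))" by blast
        then obtain r where r: "r \<in> Q'" "r \<noteq> b" and qr: "q = (\<lambda>n. fst r n - fst b n, snd r)"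
          unfolding Q''_def by blast
        have p: "p = leading F (\<lambda>n. realf (fst r) n - realf (fst b) n)" unfolding q(2) qr by simp
        obtain x where x: "x \<in> Q" "r \<in> R x" using r(1) unfolding Q'_def by blast
        note q = x r(2)
        note lr = ldR[OF q(1,2)] ld(2)[OF q(1)] ldR[OF x0(1) b] ld(2)[OF x0(1)]
        show "fst p < deg x0 \<or> (\<exists>d a. (d, a) \<in> (\<lambda>x. leading F (realf (fst x))) ` Q - {(deg x0, lc x0)} \<and>
            p = (d, if d = deg x0 then a - lc x0 else a))"
        proof (cases "(deg x, lc x) = (deg x0, lc x0)")
          case True
          have "lead_term F (Suc (deg x0)) (\<lambda>n. realf (fst r) n - realf (fst b) n) 0"
            using lead_term_sub[OF F lr(1), of "realf (fst b)" "lc x0"] lr(3) True by simp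
          from nondeg_lower_degree[OF F this ndb[OF q]]
          have "fst p < deg x0" unfolding p using leadingI[OF F] by (metis fst_conv)
          then show ?thesis ..
        next
          case False
          have "lead_term F (Suc (deg x)) (\<lambda>n. realf (fst r) n - realf (fst b) n) (if deg x = deg x0 then lc x - lc x0 else lc x)"
            by (rule lead_term_sub_nondeg[OF F lr False x0(2)[OF q(1)]])
          moreover have "(if deg x = deg x0 then lc x - lc x0 else lc x) \<noteq> 0" using False lr(2) by auto
          ultimately have "p = (deg x, if deg x = deg x0 then lc x - lc x0 else lc x)"
            unfolding p by (rule leadingI[OF F])
          moreover have "(deg x, lc x) \<in> (\<lambda>x. leading F (realf (fst x))) ` Q"
            using q(1) unfolding deg_def lc_def by auto
          ultimately show ?thesis using False by blast
        qed
      qed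
      \<comment> \<open>What n must satisfy to come back to the original problem: C at every
        \<open>n + k j\<close>, and the exact additivity on which \<open>\<psi>\<close>
        relies.\<close>
      define C'' where "C'' n \<longleftrightarrow> (\<forall>j\<in>J. C (n + k j)) \<and> (\<forall>x\<in>Q1. \<forall>j\<in>J. fst x (n + k j) = fst x n + fst x (k j))" for n
      have C'': "eventually C'' F"
        unfolding C''_def using good unfolding good_def
        by (intro eventually_conj eventually_ball_finite J(1) fin12(1) ballI) blast+
      have "syndetic {n. C'' n \<and> (\<exists>x\<in>snd b. \<forall>q\<in>Q''. ziter T (fst q n) x \<in> snd q)}"
        using IH[OF _ fam _ _ C''] less openR[OF x0(1) b] by auto
      then show ?thesis
      proof (rule syndetic_finite_shifts[OF J(1)])
        fix n assume "n \<in> {n. C'' n \<and> (\<exists>x\<in>snd b. \<forall>q\<in>Q''. ziter T (fst q n) x \<in> snd q)}"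
        then obtain x where n: "C'' n" and x: "x \<in> snd b" "\<And>q. q \<in> Q'' \<Longrightarrow> ziter T (fst q n) x \<in> snd q" by blast
        define y where "y = ziter T (- fst b n) x"
        have y: "ziter T (fst r n) y \<in> snd r" if "r \<in> Q'" for r
        proof (cases "r = b")
          case True
          then show ?thesis using x(1) add[of "fst b n" "- fst b n" x] unfolding y_def by simp
        next
          case False
          then have "(\<lambda>n. fst r n - fst b n, snd r) \<in> Q''" using that unfolding Q''_def by auto
          from x(2)[OF this] show ?thesis using add[of "fst r n" "- fst b n" x] unfolding y_def by simp
        qed
        \<comment> \<open>Which j works depends on y and thus on n; therefore y had to serve all j
          simultaneously.\<close>
        obtain j where j: "j \<in> J" "ziter T (- j) y \<in> U" using J(2) by blast
        have "ziter T (fst q (n + k j)) (ziter T (- j) y) \<in> snd q" if q: "q \<in> Q" for q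
        proof (cases "deg q = 0")
          case True
          then have q1: "q \<in> Q1" "\<psi> q \<in> Q'" using q unfolding Q1_def Q'_def R_def by auto
          have "ziter T (fst q (k j) - j) (ziter T (fst q n) y) \<in> snd q"
            using y[OF q1(2)] j(1) unfolding \<psi>_def by auto
          then have "ziter T (fst q (k j) - j + fst q n) y \<in> snd q" by (simp only: add)
          moreover have "fst q (k j) - j + fst q n = fst q (n + k j) + - j"
            using n q1(1) j(1) unfolding C''_def by simp
          ultimately show ?thesis by (simp only: add)
        next
          case False
          then have "\<phi> q j \<in> Q'" using q j(1) unfolding Q'_def R_def by auto
          from y[OF this] have "ziter T (fst q (k j) - j) (ziter T (fst q (n + k j) - fst q (k j)) y) \<in> snd q"
            unfolding \<phi>_def by simp
          then have "ziter T (fst q (k j) - j + (fst q (n + k j) - fst q (k j))) y \<in> snd q" by (simp only: add)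
          moreover have "fst q (k j) - j + (fst q (n + k j) - fst q (k j)) = fst q (n + k j) + - j" by simp
          ultimately show ?thesis by (simp only: add)
        qed
        then show "\<exists>j\<in>J. n + k j \<in> {n. C n \<and> (\<exists>x\<in>U. \<forall>q\<in>Q. ziter T (fst q n) x \<in> snd q)}"
          using n j unfolding C''_def by blast
      qed
    qed
  qed
qed

end

section \<open>The theorem\<close>

text \<open>Total boundedness gives a finite cover by balls of radius 1/(m + 1) for each m; together
  these balls form a base.\<close>

lemma compact_UNIV_countable_base:
  assumes "compact (UNIV :: 'a::metric_space set)"
  obtains \<B> :: "'a::metric_space set set" where "countable \<B>" "\<B> \<noteq> {}" "\<And>B. B \<in> \<B> \<Longrightarrow> open B \<and> B \<noteq> {}"
    "\<And>V x. open V \<Longrightarrow> x \<in> V \<Longrightarrow> \<exists>B\<in>\<B>. x \<in> B \<and> B \<subseteq> V"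
proof -
  define r where "r m = inverse (real (Suc m))" for m
  have r0: "r m > 0" for m by (simp add: r_def)
  have "\<exists>k::'a set. finite k \<and> UNIV \<subseteq> (\<Union>x\<in>k. ball x (r m))" for m
    using assms r0[of m] unfolding compact_eq_totally_bounded by blast
  then obtain K :: "nat \<Rightarrow> 'a set" where K: "\<And>m. finite (K m)" "\<And>m. UNIV \<subseteq> (\<Union>x\<in>K m. ball x (r m))"
    by metis
  define \<B> where "\<B> = (\<Union>m. (\<lambda>x. ball x (r m)) ` K m)"
  have base: "\<exists>B\<in>\<B>. x \<in> B \<and> B \<subseteq> V" if V: "open V" "x \<in> V" for V x
  proof -
    obtain e where e: "e > 0" "ball x e \<subseteq> V" using V by (auto simp: open_contains_ball)
    obtain m where "r m < e / 2" unfolding r_def using reals_Archimedean[of "e / 2"] e(1) by auto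
    moreover obtain c where c: "c \<in> K m" "x \<in> ball c (r m)" using K(2)[of m] by blast
    ultimately have "ball c (r m) \<subseteq> ball x e" using dist_triangle_half_r[of c x e]
      by (auto simp: mem_ball intro: dist_triangle_half_r)
    then show ?thesis using c e(2) unfolding \<B>_def by (intro bexI[of _ "ball c (r m)"]) auto
  qed
  show ?thesis
  proof (rule that[of \<B>])
    show "countable \<B>" unfolding \<B>_def using K(1) by (auto intro: countable_finite)
    show "\<B> \<noteq> {}" using base[of UNIV undefined] by auto
    show "open B \<and> B \<noteq> {}" if B: "B \<in> \<B>" for B 
    proof -
      obtain m x where "B = ball x (r m)" using B unfolding \<B>_def by blast
      then show ?thesis using r0[of m] by (metis centre_in_ball empty_iff open_ball)
    qed
  qed (use base in blast)
qed

section \<open>Recurrence and dense orbits for a non-degenerate tuple\<close>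

context
  fixes T :: "'a::metric_space \<Rightarrow> 'a" and p :: "'d::finite \<Rightarrow> gpexpr"
  assumes T: "tds T" and mixing: "weakly_mixing T" and minimal: "tds_minimal T"
    and p: "\<And>i. p i \<in> IGP" and nd: "non_degenerate p"
begin

text \<open>The common source of both assertions: C is taken to be the conditions on the
  \<open>g k\<close> for the second, and trivial for the first.\<close>

lemma recurrence_times_syndetic:
  assumes "open U" "U \<noteq> {}" and V: "\<And>i. open (V i)" "\<And>i. V i \<noteq> {}"
    and F: "nice_filter F" and C: "eventually C F"
  shows "syndetic {n. C n \<and> (\<exists>x\<in>U. \<forall>i. ziter T (igp_eval (p i) n) x \<in> V i)}"
proof -
  note G = nice_filter_good[OF F]
  have nd1: "nondeg F (\<lambda>n. of_int (igp_eval (p i) n))" for i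
    using IGP_nondeg(1)[OF F p p] nd unfolding non_degenerate_def by blast
  have nd2: "nondeg F (\<lambda>n. of_int (igp_eval (p i) n) - of_int (igp_eval (p j) n))" if "i \<noteq> j" for i j
    using IGP_nondeg(2)[OF F p p, of i j] nd that unfolding non_degenerate_def by simp
  define Q where "Q = range (\<lambda>i. (igp_eval (p i), V i))"
  have "PET_family F Q"
    unfolding PET_family_def
  proof (intro conjI ballI impI)
    show "finite Q" by (simp add: Q_def)
  next
    fix q assume "q \<in> Q"
    then show "open (snd q)" "snd q \<noteq> {}" "nondeg F (realf (fst q))"
      using V nd1 by (auto simp: Q_def)
  next
    fix q q' assume "q \<in> Q" "q' \<in> Q" "q \<noteq> q'"
    then obtain i j where "q = (igp_eval (p i), V i)" "q' = (igp_eval (p j), V j)" "i \<noteq> j"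
      unfolding Q_def by blast
    then show "nondeg F (\<lambda>n. realf (fst q) n - realf (fst q') n)" using nd2 by simp
  qed
  from PET_syndetic[OF T minimal mixing G this assms(1,2) C]
  show ?thesis unfolding Q_def by simp
qed

lemma syndetic_return_times:
  assumes "open U" "U \<noteq> {}" "\<And>i. open (V i)" "\<And>i. V i \<noteq> {}" "\<epsilon> > 0"
    and g: "\<And>k. k \<in> I \<Longrightarrow> g k \<in> SGP_hat s" and I: "finite I"
  shows "syndetic ({n. U \<inter> (\<Inter>i. ziter T (igp_eval (p i) n) -` V i) \<noteq> {}}
           \<inter> (\<Inter>k\<in>I. {n. nfrac (g k n) \<in> {-\<epsilon><..<\<epsilon>}}))"
proof -
  obtain F where F: "nice_filter F" using ex_nice_filter by blast
  \<comment> \<open>Up to 1/2 the integer witnessing \<open>near_int\<close> is the nearest one, so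
    that the bound passes to \<open>nfrac\<close>.\<close>
  define e where "e = min \<epsilon> (1/2)"
  have e: "e > 0" "e \<le> \<epsilon>" "e \<le> 1/2" using assms(5) by (auto simp: e_def)
  have ev: "\<forall>\<^sub>F n in F. \<forall>k\<in>I. near_int e (g k n)"
    using SGP_hat_near_int[OF F g e(1)] by (intro eventually_ball_finite I) auto
  have "syndetic {n. (\<forall>k\<in>I. near_int e (g k n)) \<and> (\<exists>x\<in>U. \<forall>i. ziter T (igp_eval (p i) n) x \<in> V i)}"
    by (rule recurrence_times_syndetic[OF assms(1-4) F ev])
  then show ?thesis
  proof (rule syndetic_mono, intro subsetI)
    fix n assume "n \<in> {n. (\<forall>k\<in>I. near_int e (g k n)) \<and> (\<exists>x\<in>U. \<forall>i. ziter T (igp_eval (p i) n) x \<in> V i)}"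
    then obtain x where x: "x \<in> U" "\<And>i. ziter T (igp_eval (p i) n) x \<in> V i"
      and near: "\<And>k. k \<in> I \<Longrightarrow> near_int e (g k n)" by blast
    have "nfrac (g k n) \<in> {-\<epsilon><..<\<epsilon>}" if "k \<in> I" for k
      using near_intD[OF near[OF that] e(3)] e(2) unfolding nfrac_def by (auto simp: abs_less_iff)
    moreover have "x \<in> U \<inter> (\<Inter>i. ziter T (igp_eval (p i) n) -` V i)" using x by auto
    ultimately show "n \<in> {n. U \<inter> (\<Inter>i. ziter T (igp_eval (p i) n) -` V i) \<noteq> {}}
           \<inter> (\<Inter>k\<in>I. {n. nfrac (g k n) \<in> {-\<epsilon><..<\<epsilon>}})" by blast
  qed
qed

text \<open>For each box W of basic open sets, \<open>G W\<close> consists of the points whose orbit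
  of tuples visits the box. It is open, and dense because recurrence holds from every nonempty open
  set. The boxes are countable in number, so Baire's theorem applies.\<close>

lemma residual_dense_orbits:
  "\<exists>X0 :: 'a set. gdelta_in euclidean X0 \<and> closure X0 = UNIV \<and>
     (\<forall>x\<in>X0. closure (range (\<lambda>n::int. \<chi> i. ziter T (igp_eval (p i) n) x)) = (UNIV :: ('a ^ 'd) set))"
proof -
  have cpt: "compact (UNIV :: 'a set)" using T by (simp add: tds_def)
  obtain \<B> :: "'a set set" where \<B>: "countable \<B>" "\<B> \<noteq> {}" "\<And>B. B \<in> \<B> \<Longrightarrow> open B \<and> B \<noteq> {}"
    "\<And>V x. open V \<Longrightarrow> x \<in> V \<Longrightarrow> \<exists>B\<in>\<B>. x \<in> B \<and> B \<subseteq> V"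
    using compact_UNIV_countable_base[OF cpt] by metis
  define \<W> where "\<W> = PiE (UNIV :: 'd set) (\<lambda>_. \<B>)"
  have \<W>: "W \<in> \<W> \<longleftrightarrow> (\<forall>i. W i \<in> \<B>)" for W unfolding \<W>_def by auto
  define G where "G W = (\<Union>n. \<Inter>i. {x. ziter T (igp_eval (p i) n) x \<in> W i})" for W :: "'d \<Rightarrow> 'a set"
  have openG: "open (G W)" if "W \<in> \<W>" for W
    unfolding G_def using that \<B>(3) by (intro open_UN open_INT ballI open_ziter_vimage[OF T]) (auto simp: \<W>)
  have denseG: "closure (G W) = UNIV" if W: "W \<in> \<W>" for W
  proof (rule ccontr)
    assume "closure (G W) \<noteq> UNIV"
    then have U: "open (- closure (G W))" "- closure (G W) \<noteq> {}" by auto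
    obtain F where "nice_filter F" using ex_nice_filter by blast
    then have "syndetic {n. True \<and> (\<exists>x\<in>- closure (G W). \<forall>i. ziter T (igp_eval (p i) n) x \<in> W i)}"
      by (intro recurrence_times_syndetic[OF U]) (use W \<B>(3) in \<open>auto simp: \<W>\<close>)
    then obtain n x where "x \<in> - closure (G W)" "\<forall>i. ziter T (igp_eval (p i) n) x \<in> W i"
      using syndetic_nonempty by blast
    moreover from this have "x \<in> G W" unfolding G_def by auto
    ultimately show False using closure_subset by blast
  qed
  have count: "countable \<W>" unfolding \<W>_def using \<B>(1) by (intro countable_PiE) auto
  have "\<W> \<noteq> {}"
  proof -
    obtain B where "B \<in> \<B>" using \<B>(2) by blast
    then have "(\<lambda>_. B) \<in> \<W>" by (simp add: \<W>)
    then show ?thesis by blast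
  qed
  show ?thesis
  proof (intro exI[of _ "\<Inter>(G ` \<W>)"] conjI ballI)
    show "gdelta_in euclidean (\<Inter>(G ` \<W>))"
      using count \<open>\<W> \<noteq> {}\<close> openG by (intro gdelta_in_Inter) (auto intro: open_imp_gdelta_in)
    have "compact_space (euclidean :: 'a topology)" using cpt by (simp add: compact_space_def)
    then have "locally_compact_space (euclidean :: 'a topology) \<and> regular_space (euclidean :: 'a topology)"
      by (simp add: compact_imp_locally_compact_space metrizable_imp_regular_space metrizable_space_euclidean)
    then have "euclidean closure_of \<Inter>(G ` \<W>) = topspace euclidean"
      using count openG denseG by (intro Baire_category) auto
    then show "closure (\<Inter>(G ` \<W>)) = UNIV" by simp
  next
    fix x assume x: "x \<in> \<Inter>(G ` \<W>)"
    let ?S = "range (\<lambda>n::int. \<chi> i. ziter T (igp_eval (p i) n) x) :: ('a ^ 'd) set"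
    show "closure ?S = UNIV"
    proof (rule ccontr)
      assume "closure ?S \<noteq> UNIV"
      then obtain z where z: "z \<in> - closure ?S" by blast
      then obtain A where A: "\<And>i. open (A i) \<and> z $ i \<in> A i" "\<And>y. (\<And>i. y $ i \<in> A i) \<Longrightarrow> y \<in> - closure ?S"
        using open_Compl[OF closed_closure[of ?S]] unfolding open_vec_def by metis
      have "\<exists>B. B \<in> \<B> \<and> z $ i \<in> B \<and> B \<subseteq> A i" for i
        using \<B>(4)[of "A i" "z $ i"] A(1)[of i] by blast
      then obtain W where W: "\<And>i. W i \<in> \<B> \<and> z $ i \<in> W i \<and> W i \<subseteq> A i" by metis
      then have "W \<in> \<W>" by (simp add: \<W>)
      then have "x \<in> G W" using x by blast
      then obtain n where n: "\<And>i. ziter T (igp_eval (p i) n) x \<in> W i" unfolding G_def by auto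
      have "(\<chi> i. ziter T (igp_eval (p i) n) x) \<in> - closure ?S"
        using n W by (intro A(2)) auto
      then show False using closure_subset[of ?S] by blast
    qed
  qed
qed

end

theorem theorem1p1:
  fixes T :: "'a::metric_space \<Rightarrow> 'a"
    and p :: "'d::finite \<Rightarrow> gpexpr"
  assumes "tds T" and "weakly_mixing T" and "tds_minimal T"
    and "\<And>i. p i \<in> IGP"
    and "non_degenerate p"
  shows "(\<exists>X0 :: 'a set. gdelta_in euclidean X0 \<and> closure X0 = UNIV \<and>
            (\<forall>x\<in>X0. closure (range (\<lambda>n::int. \<chi> i. ziter T (igp_eval (p i) n) x))
                      = (UNIV :: ('a ^ 'd) set)))
       \<and> (\<forall>(U :: 'a set) (V :: 'd \<Rightarrow> 'a set) (\<epsilon> :: real) (s :: nat) (t :: nat)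
             (g :: nat \<Rightarrow> int \<Rightarrow> real).
            open U \<and> U \<noteq> {} \<and> (\<forall>i. open (V i) \<and> V i \<noteq> {}) \<and> \<epsilon> > 0 \<and> s \<ge> 1 \<and> t \<ge> 1 \<and>
            (\<forall>k\<in>{1..t}. g k \<in> SGP_hat s) \<longrightarrow>
            (let C = (\<Inter>k\<in>{1..t}. {n::int. nfrac (g k n) \<in> {-\<epsilon><..<\<epsilon>}});
                 N = {n::int. U \<inter> (\<Inter>i. ziter T (igp_eval (p i) n) -` V i) \<noteq> {}}
             in syndetic (N \<inter> C)))"
proof (intro conjI allI impI)
  show "\<exists>X0 :: 'a set. gdelta_in euclidean X0 \<and> closure X0 = UNIV \<and>
            (\<forall>x\<in>X0. closure (range (\<lambda>n::int. \<chi> i. ziter T (igp_eval (p i) n) x))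
                      = (UNIV :: ('a ^ 'd) set))"
    by (rule residual_dense_orbits[OF assms])
next
  fix U :: "'a set" and V :: "'d \<Rightarrow> 'a set" and \<epsilon> :: real and s t :: nat and g :: "nat \<Rightarrow> int \<Rightarrow> real"
  assume "open U \<and> U \<noteq> {} \<and> (\<forall>i. open (V i) \<and> V i \<noteq> {}) \<and> \<epsilon> > 0 \<and> s \<ge> 1 \<and> t \<ge> 1 \<and>
            (\<forall>k\<in>{1..t}. g k \<in> SGP_hat s)"
  then show "let C = (\<Inter>k\<in>{1..t}. {n::int. nfrac (g k n) \<in> {-\<epsilon><..<\<epsilon>}});
                 N = {n::int. U \<inter> (\<Inter>i. ziter T (igp_eval (p i) n) -` V i) \<noteq> {}}
             in syndetic (N \<inter> C)"
    unfolding Let_def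
    by (intro syndetic_return_times[OF assms, where s = s]) auto
qed

end
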